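(* Let $U\in\mathcal C^2(\mathbb R^d)$ and $0<m\le L$ be such that for all $x,y\in\mathbb R^d$, $|\nabla U(x)-\nabla U(y)|\le L|x-y|$ and $(x-y)\cdot(\nabla U(x)-\nabla U(y))\ge m|x-y|^2$. Suppose moreover that $\gamma\ge 2\sqrt L$ and $0<\delta\le m/(33\gamma^3)$. Let $\pi_\delta$ be the unique invariant probability measure of the OBABO chain with parameters $\delta,\gamma$ and potential $U$, and let $\pi$ be the probability measure on $\mathbb R^{2d}$ with density proportional to $\exp(-U(x)-|v|^2/2)$. Then for all $p\ge1$, $$\mathcal W_p(\pi,\pi_\delta)\ \le\ \delta\sqrt{d+(p-2)_+}\ \frac{2K_1K_3}{\kappa},$$ $$\|\pi-\pi_\delta\|_{TV}\ \le\ \delta d\left(2+|\ln(\delta^3d)|\right)\left(\frac{2K_1^2K_2K_3}{\kappa\sqrt{1-\delta\kappa}}+\frac{K_4}{\kappa}\right),$$ where $K_1,K_2,K_3,K_4,\kappa$ are the explicit constants given in the context (in particular $K_3$ and $K_4$ converge to $L$ as $\delta\to0$).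
   Context: Given a time-step $\delta>0$ and a friction $\gamma>0$, set $\eta=e^{-\delta\gamma/2}$. The OBABO chain is the time-homogeneous Markov chain on $\mathbb R^d\times\mathbb R^d$ whose transition from $(x_0,v_0)$ to $(x_1,v_1)$ is $$x_1=x_0+\delta\left(\eta v_0+\sqrt{1-\eta^2}\,G\right)-\frac{\delta^2}{2}\nabla U(x_0),$$ $$v_1=\eta^2v_0-\frac{\delta\eta}{2}\left(\nabla U(x_0)+\nabla U(x_1)\right)+\sqrt{1-\eta^2}\left(\eta G+G'\right),$$ where $G,G'$ are independent standard Gaussian vectors in $\mathbb R^d$. Under the hypotheses of the claim it has a unique invariant probability measure $\pi_\delta$, with finite moments of all orders. $\mathcal W_p$ is the $p$-Wasserstein distance for the Euclidean norm, $\|\nu-\mu\|_{TV}=\inf_{X\sim\nu,Y\sim\mu}2\,\mathbb P(X\ne Y)$, and $s_+=\max(s,0)$. The constants are (with $\pi$ the number in $K_2$): $$K_1=\sqrt3\max\left(L^{1/2},L^{-1/2}\right),\quad \kappa=\frac{m}{3\gamma},\quad K_2=\sqrt{\frac{\delta}{2\pi(1-\eta^2)}}\max\left(2+\frac{3\delta^2L}{2},3\delta\right),$$ $$K_3=L\left[1+e^{L\delta^2}\left(\frac{\delta}{6}+\frac{\delta^2L}{24}\right)\right]\left(1+\frac{\delta L}{2\sqrt m}\right),$$ $$K_4=L\left(1+\frac{\delta}{4}+\frac{\delta^2L}{4}\right)\left(1+\frac{\delta L}{\sqrt m}+\frac{\delta^2L^2}{4m}\right)+\frac{\delta L^2}{m}.$$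 *)

theory Defs
  imports "HOL-Probability.Probability"
begin

definition grad :: "('a::euclidean_space \<Rightarrow> real) \<Rightarrow> 'a \<Rightarrow> 'a" where
  "grad f x = (THE g. GDERIV f x :> g)"

lemma grad_eqI: "GDERIV f x :> g \<Longrightarrow> grad f x = g"
  unfolding grad_def gderiv_def
proof (rule the_equality)
  fix D assume "FDERIV f x :> (\<lambda>h. inner h g)" "FDERIV f x :> (\<lambda>h. inner h D)"
  then have "(\<lambda>h. inner h D) = (\<lambda>h. inner h g)"
    using has_derivative_unique by blast
  then show "D = g"
    by (simp add: fun_eq_iff vector_eq_ldot)
qed

definition C2 :: "('a::euclidean_space \<Rightarrow> real) \<Rightarrow> bool" where
  "C2 f \<longleftrightarrow> (\<exists>(D :: 'a \<Rightarrow> 'a \<Rightarrow>\<^sub>L real) (D2 :: 'a \<Rightarrow> 'a \<Rightarrow>\<^sub>L ('a \<Rightarrow>\<^sub>L real)).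
     (\<forall>x. (f has_derivative blinfun_apply (D x)) (at x)) \<and>
     (\<forall>x. (D has_derivative blinfun_apply (D2 x)) (at x)) \<and>
     continuous_on UNIV D2)"

definition std_gaussian :: "'a::euclidean_space measure" where
  "std_gaussian = density lborel (\<lambda>x. ennreal (\<Prod>b\<in>Basis. std_normal_density (x \<bullet> b)))"

definition eta :: "real \<Rightarrow> real \<Rightarrow> real" where
  "eta \<delta> \<gamma> = exp (- \<delta> * \<gamma> / 2)"

definition obabo_step ::
    "real \<Rightarrow> real \<Rightarrow> ('a::euclidean_space \<Rightarrow> real) \<Rightarrow> 'a \<times> 'a \<Rightarrow> 'a \<times> 'a \<Rightarrow> 'a \<times> 'a" where
  "obabo_step \<delta> \<gamma> U = (\<lambda>(x0, v0) (G, G').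
     (let \<eta> = eta \<delta> \<gamma>;
          x1 = x0 + \<delta> *\<^sub>R (\<eta> *\<^sub>R v0 + sqrt (1 - \<eta>\<^sup>2) *\<^sub>R G) - (\<delta>\<^sup>2 / 2) *\<^sub>R grad U x0;
          v1 = \<eta>\<^sup>2 *\<^sub>R v0 - (\<delta> * \<eta> / 2) *\<^sub>R (grad U x0 + grad U x1)
               + sqrt (1 - \<eta>\<^sup>2) *\<^sub>R (\<eta> *\<^sub>R G + G')
      in (x1, v1)))"

definition obabo_kernel ::
    "real \<Rightarrow> real \<Rightarrow> ('a::euclidean_space \<Rightarrow> real) \<Rightarrow> 'a \<times> 'a \<Rightarrow> ('a \<times> 'a) measure" where
  "obabo_kernel \<delta> \<gamma> U z =
     distr (std_gaussian \<Otimes>\<^sub>M std_gaussian) borel (obabo_step \<delta> \<gamma> U z)"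

definition invariant_prob ::
    "('b::topological_space \<Rightarrow> 'b measure) \<Rightarrow> 'b measure \<Rightarrow> bool" where
  "invariant_prob K \<mu> \<longleftrightarrow> prob_space \<mu> \<and> sets \<mu> = sets borel \<and> bind \<mu> K = \<mu>"

definition gibbs_weight :: "('a::euclidean_space \<Rightarrow> real) \<Rightarrow> 'a \<times> 'a \<Rightarrow> real" where
  "gibbs_weight U = (\<lambda>(x, v). exp (- U x - (norm v)\<^sup>2 / 2))"

definition gibbs :: "('a::euclidean_space \<Rightarrow> real) \<Rightarrow> ('a \<times> 'a) measure" where
  "gibbs U = density lborel
     (\<lambda>z. ennreal (gibbs_weight U z / (LINT w|lborel. gibbs_weight U w)))"

definition couplings ::
    "'b::second_countable_topology measure \<Rightarrow> 'b measure \<Rightarrow> ('b \<times> 'b) measure set" where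
  "couplings \<mu> \<nu> = {\<Gamma>. prob_space \<Gamma> \<and> sets \<Gamma> = sets borel \<and>
     distr \<Gamma> borel fst = \<mu> \<and> distr \<Gamma> borel snd = \<nu>}"

(* The p-th power of the distance is an infimum of (possibly infinite) nonnegative integrals;
   its p-th root is taken in the extended nonnegative reals, the root of infinity being infinity.
   The metric on a product type is the Euclidean one. *)
definition wasserstein ::
    "real \<Rightarrow> 'b::{metric_space, second_countable_topology} measure \<Rightarrow> 'b measure \<Rightarrow> ennreal" where
  "wasserstein p \<mu> \<nu> =
     (let c = (INF \<Gamma>\<in>couplings \<mu> \<nu>. \<integral>\<^sup>+ z. ennreal (dist (fst z) (snd z) powr p) \<partial>\<Gamma>)
      in if c = top then top else ennreal (enn2real c powr (1 / p)))"

(* Normalised so that mutually singular probability measures are at distance 2. *)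
definition tv_dist ::
    "'b::{t2_space, second_countable_topology} measure \<Rightarrow> 'b measure \<Rightarrow> ennreal" where
  "tv_dist \<mu> \<nu> = (INF \<Gamma>\<in>couplings \<mu> \<nu>. 2 * emeasure \<Gamma> {z. fst z \<noteq> snd z})"

definition K1 :: "real \<Rightarrow> real" where
  "K1 L = sqrt 3 * max (L powr (1/2)) (L powr (-1/2))"

definition kappa :: "real \<Rightarrow> real \<Rightarrow> real" where
  "kappa m \<gamma> = m / (3 * \<gamma>)"

definition K2 :: "real \<Rightarrow> real \<Rightarrow> real \<Rightarrow> real" where
  "K2 L \<gamma> \<delta> = sqrt (\<delta> / (2 * pi * (1 - (eta \<delta> \<gamma>)\<^sup>2))) * max (2 + 3 * \<delta>\<^sup>2 * L / 2) (3 * \<delta>)"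

definition K3 :: "real \<Rightarrow> real \<Rightarrow> real \<Rightarrow> real" where
  "K3 m L \<delta> = L * (1 + exp (L * \<delta>\<^sup>2) * (\<delta> / 6 + \<delta>\<^sup>2 * L / 24)) * (1 + \<delta> * L / (2 * sqrt m))"

definition K4 :: "real \<Rightarrow> real \<Rightarrow> real \<Rightarrow> real" where
  "K4 m L \<delta> = L * (1 + \<delta> / 4 + \<delta>\<^sup>2 * L / 4) * (1 + \<delta> * L / sqrt m + \<delta>\<^sup>2 * L\<^sup>2 / (4 * m))
                + \<delta> * L\<^sup>2 / m"

end

(*
Write g for the gradient of U, O for the partial refreshment v -> eta v + sqrt (1 - eta^2) G and V for
one velocity Verlet step of length delta. One step of the chain is O V O, where O preserves the Gibbs
measure gibbs U. All estimates are made in the norm |x|^2 + (2 / gamma) x.v + |v|^2 / L, in which O V O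
with synchronous noise contracts the squared distance by the factor 1 - delta kappa.

Wasserstein distance. The exact Hamiltonian flow over time delta is obtained, without any theory of
differential equations, as the limit of 2^k Verlet steps of length delta / 2^k. These preserve Lebesgue
measure and conserve the energy up to an error vanishing with k, so their limit preserves gibbs U, and it
differs from V by O(L delta^2 (|v| + delta |g|)). Hence one synchronous step maps a coupling of gibbs U and
the invariant measure to another one whose cost is contracted up to this error. The moments of the error
come from the scaling x -> t x in the integrals of |x|^q exp (- U), compared through convexity.

Total variation. As V preserves Lebesgue measure, one step moves gibbs U by at most the mean energy error
of V, which is O(delta^2 L d). One step from two different points regularises by shifts of the two
Gaussian noises. Taking n of the order of (|ln (delta^3 d)| + 3) / (delta kappa) steps balances the
accumulated error with the contracted Wasserstein distance.
*)
theory Submission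
  imports Defs
begin

section \<open>Convex potentials\<close>

text \<open>The gradient is only Lipschitz, so one Verlet step misses the flow, and misses energy
  conservation, by order \<open>\<delta>\<^sup>2\<close>; over the relaxation time of about
  \<open>1 / (\<delta> * \<kappa>)\<close> steps this sums to the claimed order \<delta>. The
  step-size hypothesis is used as \<open>(\<delta> * \<gamma>)\<^sup>2 \<le> \<delta> * m / (33 *
  \<gamma>)\<close>: all second-order terms of a step then consume less than half of the dissipation
  \<open>\<delta> * m / \<gamma>\<close>. The other half, divided by the 3/2 that compares the
  modified norm with \<open>(norm x)\<^sup>2 + (norm v)\<^sup>2 / L\<close>, is the
  \<open>m / (3 * \<gamma>)\<close> of \<kappa>. The invariant measure is known only through its
  fixed-point identity. Contraction says nothing about an infinite cost, so its moments are bounded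
  beforehand, on truncated functions. No optimal coupling is selected: couplings are improved step
  by step, which suffices for an infimum. The total variation argument is run on events through the
  transition operator, and only at the end a Hahn decomposition turns it into a coupling.\<close>

lemma GDERIV_line:
  fixes U :: "'a::euclidean_space \<Rightarrow> real"
  assumes "\<And>x. GDERIV U x :> g x"
  shows "((\<lambda>t. U (x + t *\<^sub>R D)) has_real_derivative (g (x + t *\<^sub>R D) \<bullet> D)) (at t)"
proof -
  have "(U has_derivative (\<lambda>h. h \<bullet> g (x + t *\<^sub>R D))) (at (x + t *\<^sub>R D))"
    using assms unfolding gderiv_def by blast
  moreover have "((\<lambda>t. x + t *\<^sub>R D) has_derivative (\<lambda>h. h *\<^sub>R D)) (at t)"
    by (auto intro!: derivative_eq_intros)
  ultimately have "((\<lambda>t. U (x + t *\<^sub>R D)) has_derivative (\<lambda>h. (h *\<^sub>R D) \<bullet> g (x + t *\<^sub>R D))) (at t)"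
    using has_derivative_compose by fastforce
  then show ?thesis
    unfolding has_field_derivative_def by (simp add: inner_commute mult.commute[of _ "_ \<bullet> _"])
qed

text \<open>The gradient is the Riesz representative of the derivative, read off on the basis;
  uniqueness (\<open>grad_eqI\<close>) identifies it with the description operator in
  \<open>grad\<close>.\<close>

lemma C2_imp_GDERIV:
  assumes "C2 U"
  shows "GDERIV U x :> grad U x"
proof -
  obtain D where D: "(U has_derivative D) (at x)"
    using assms unfolding C2_def by blast
  define r where "r = (\<Sum>b\<in>Basis. D b *\<^sub>R b)"
  have lin: "linear D" using D by (simp add: has_derivative_linear)
  have "D = (\<lambda>h. h \<bullet> r)"
  proof
    fix h
    have "D h = D (\<Sum>b\<in>Basis. (h \<bullet> b) *\<^sub>R b)" by (simp add: euclidean_representation)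
    also have "\<dots> = h \<bullet> r"
      unfolding r_def by (simp add: linear_sum[OF lin] linear_cmul[OF lin] inner_sum_right mult.commute)
    finally show "D h = h \<bullet> r" .
  qed
  then have "GDERIV U x :> r" using D by (simp add: gderiv_def)
  then show ?thesis using grad_eqI by metis
qed

text \<open>The gradient is an abstract map \<open>g\<close> and no time step occurs, because the
  locale is instantiated twice: at \<open>U\<close>, and at half the squared norm to obtain the
  Gaussian moments.\<close>

locale strongly_convex_smooth =
  fixes U :: "'a::euclidean_space \<Rightarrow> real" and g :: "'a \<Rightarrow> 'a" and m L :: real
  assumes gderiv: "\<And>x. GDERIV U x :> g x"
    and lip: "\<And>x y. norm (g x - g y) \<le> L * norm (x - y)"
    and mono: "\<And>x y. m * (norm (x - y))\<^sup>2 \<le> (x - y) \<bullet> (g x - g y)"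
    and m_pos: "0 < m" and m_le_L: "m \<le> L"
begin

lemma L_pos: "0 < L" using m_pos m_le_L by simp

lemma grad_eq: "grad U = g"
  using gderiv grad_eqI by blast

lemma continuous_U: "continuous_on UNIV U"
  using gderiv unfolding gderiv_def
  by (meson continuous_at_imp_continuous_on has_derivative_continuous)

lemma continuous_g: "continuous_on UNIV g"
proof (rule lipschitz_on_continuous_on)
  show "L-lipschitz_on UNIV g"
    using lip L_pos by (auto simp: lipschitz_on_def dist_norm)
qed

lemma measurable_U [measurable]: "U \<in> borel_measurable borel"
  using continuous_U by (rule borel_measurable_continuous_onI)

lemma measurable_g [measurable]: "g \<in> borel_measurable borel"
  using continuous_g by (rule borel_measurable_continuous_onI)

text \<open>Monotonicity between \<open>x + t *\<^sub>R D\<close> and \<open>x\<close>, divided by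
  \<open>t\<close>, makes the potential along the segment minus its quadratic minorant
  nondecreasing.\<close>

lemma strong_convexity: "U x + g x \<bullet> D + m / 2 * (norm D)\<^sup>2 \<le> U (x + D)"
proof -
  define f where "f t = U (x + t *\<^sub>R D) - t * (g x \<bullet> D) - m / 2 * t\<^sup>2 * (norm D)\<^sup>2" for t
  have "f 0 \<le> f 1"
  proof (rule DERIV_nonneg_imp_nondecreasing[of 0 1 f])
    fix t :: real assume t: "0 \<le> t" "t \<le> 1"
    have d: "(f has_real_derivative (g (x + t *\<^sub>R D) \<bullet> D - g x \<bullet> D - m * t * (norm D)\<^sup>2)) (at t)"
      unfolding f_def by (auto intro!: derivative_eq_intros GDERIV_line gderiv)
    have "0 \<le> g (x + t *\<^sub>R D) \<bullet> D - g x \<bullet> D - m * t * (norm D)\<^sup>2"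
    proof (cases "t = 0")
      case False
      have "m * (t * norm D)\<^sup>2 \<le> t * ((g (x + t *\<^sub>R D) - g x) \<bullet> D)"
        using mono[of "x + t *\<^sub>R D" x] t by (simp add: inner_commute)
      then have "t * (m * t * (norm D)\<^sup>2) \<le> t * ((g (x + t *\<^sub>R D) - g x) \<bullet> D)"
        by (simp add: power2_eq_square algebra_simps)
      then show ?thesis using False t by (simp add: inner_diff_left)
    qed simp
    then show "\<exists>y. (f has_real_derivative y) (at t) \<and> 0 \<le> y" using d by blast
  qed simp
  then show ?thesis by (simp add: f_def)
qed

lemma smoothness: "U (x + D) \<le> U x + g x \<bullet> D + L / 2 * (norm D)\<^sup>2"
proof -
  define f where "f t = U (x + t *\<^sub>R D) - t * (g x \<bullet> D) - L / 2 * t\<^sup>2 * (norm D)\<^sup>2" for t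
  have "f 1 \<le> f 0"
  proof (rule DERIV_nonpos_imp_nonincreasing[of 0 1 f])
    fix t :: real assume t: "0 \<le> t" "t \<le> 1"
    have d: "(f has_real_derivative (g (x + t *\<^sub>R D) \<bullet> D - g x \<bullet> D - L * t * (norm D)\<^sup>2)) (at t)"
      unfolding f_def by (auto intro!: derivative_eq_intros GDERIV_line gderiv)
    have "(g (x + t *\<^sub>R D) - g x) \<bullet> D \<le> norm (g (x + t *\<^sub>R D) - g x) * norm D"
      by (rule norm_cauchy_schwarz)
    also have "\<dots> \<le> L * (t * norm D) * norm D"
      using lip[of "x + t *\<^sub>R D" x] t by (intro mult_right_mono) auto
    finally have "g (x + t *\<^sub>R D) \<bullet> D - g x \<bullet> D - L * t * (norm D)\<^sup>2 \<le> 0"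
      by (simp add: inner_diff_left power2_eq_square algebra_simps)
    then show "\<exists>y. (f has_real_derivative y) (at t) \<and> y \<le> 0" using d by blast
  qed simp
  then show ?thesis by (simp add: f_def)
qed

text \<open>Intermediate point: a gradient step of length \<open>1 / L\<close> from \<open>y\<close>
  for the tilted potential \<open>U - g x \<bullet> _\<close>. Convexity bounds the value there from
  below by the tangent at \<open>x\<close>, smoothness bounds it from above by the expansion at
  \<open>y\<close>.\<close>

lemma bregman_lower: "U x + g x \<bullet> (y - x) + (norm (g y - g x))\<^sup>2 / (2 * L) \<le> U y"
proof -
  define r where "r = g y - g x"
  have "U x + g x \<bullet> (y - (1 / L) *\<^sub>R r - x) \<le> U (y - (1 / L) *\<^sub>R r)"
    using strong_convexity[of x "y - (1 / L) *\<^sub>R r - x"] m_pos by (smt (verit) add.commute diff_add_cancel divide_nonneg_nonneg mult_nonneg_nonneg zero_le_power2)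
  also have "\<dots> \<le> U y + g y \<bullet> (- (1 / L) *\<^sub>R r) + L / 2 * (norm (- (1 / L) *\<^sub>R r))\<^sup>2"
    using smoothness[of y "- (1 / L) *\<^sub>R r"] by simp
  finally have *: "U x + g x \<bullet> (y - (1 / L) *\<^sub>R r - x)
      \<le> U y + g y \<bullet> (- (1 / L) *\<^sub>R r) + L / 2 * (norm (- (1 / L) *\<^sub>R r))\<^sup>2" .
  have "L / 2 * (norm (- (1 / L) *\<^sub>R r))\<^sup>2 = (norm r)\<^sup>2 / (2 * L)"
    using L_pos by (simp add: power_divide field_simps power2_eq_square)
  moreover have "g x \<bullet> (y - (1 / L) *\<^sub>R r - x) - g y \<bullet> (- (1 / L) *\<^sub>R r) = g x \<bullet> (y - x) + (norm r)\<^sup>2 / L"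
    by (simp add: r_def power2_norm_eq_inner inner_diff_right inner_diff_left algebra_simps diff_divide_distrib add_divide_distrib inner_commute)
  ultimately have "U x + g x \<bullet> (y - x) + (norm r)\<^sup>2 / L \<le> U y + (norm r)\<^sup>2 / (2 * L)"
    using * by linarith
  moreover have "(norm r)\<^sup>2 / L = (norm r)\<^sup>2 / (2 * L) + (norm r)\<^sup>2 / (2 * L)"
    by simp
  ultimately show ?thesis by (simp add: r_def)
qed

text \<open>Sum of \<open>bregman_lower\<close> for \<open>(x, y)\<close> and \<open>(y, x)\<close>.
  In the contraction it lets the dissipation pay for the squared force.\<close>

lemma cocoercive: "(norm (g x - g y))\<^sup>2 \<le> L * ((x - y) \<bullet> (g x - g y))"
proof -
  have "(norm (g x - g y))\<^sup>2 / L \<le> (x - y) \<bullet> (g x - g y)"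
    using bregman_lower[of x y] bregman_lower[of y x]
    by (simp add: norm_minus_commute inner_diff_right inner_diff_left inner_commute field_simps)
  then show ?thesis using L_pos by (simp add: field_simps)
qed

text \<open>The two Bregman inequalities enclose the error of the trapezoidal rule by
  \<open>r \<bullet> D / 2 - (norm r)\<^sup>2 / (2 * L)\<close>, which is largest at
  \<open>r = (L / 2) *\<^sub>R D\<close>. No regularity of the second derivative enters, at the
  price of an error that is only quadratic in the increment.\<close>

lemma trapezoid_error:
  "\<bar>U y - U x - ((g x + g y) \<bullet> (y - x)) / 2\<bar> \<le> L / 8 * (norm (y - x))\<^sup>2"
proof -
  define r where "r = g y - g x"
  define D where "D = y - x"
  have "0 \<le> (norm (r - (L / 2) *\<^sub>R D))\<^sup>2" by simp
  also have "\<dots> = (norm r)\<^sup>2 - L * (r \<bullet> D) + L\<^sup>2 / 4 * (norm D)\<^sup>2"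
    unfolding power2_norm_eq_inner
    by (simp add: inner_diff_left inner_diff_right inner_commute power2_eq_square)
  finally have "0 \<le> (norm r)\<^sup>2 - L * (r \<bullet> D) + L\<^sup>2 / 4 * (norm D)\<^sup>2" .
  moreover have "L * (r \<bullet> D / 2 - (norm r)\<^sup>2 / (2 * L)) = L * (r \<bullet> D) / 2 - (norm r)\<^sup>2 / 2"
    using L_pos by (simp add: right_diff_distrib)
  moreover have "L * (L / 8 * (norm D)\<^sup>2) = L\<^sup>2 / 4 * (norm D)\<^sup>2 / 2"
    by (simp add: power2_eq_square)
  ultimately have "L * (r \<bullet> D / 2 - (norm r)\<^sup>2 / (2 * L)) \<le> L * (L / 8 * (norm D)\<^sup>2)"
    by linarith
  then have *: "r \<bullet> D / 2 - (norm r)\<^sup>2 / (2 * L) \<le> L / 8 * (norm D)\<^sup>2"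
    using L_pos by (simp only: mult_le_cancel_left_pos)
  have "U x + g x \<bullet> D + (norm r)\<^sup>2 / (2 * L) \<le> U y"
    using bregman_lower[of x y] by (simp add: r_def D_def)
  moreover have "U y - g y \<bullet> D + (norm r)\<^sup>2 / (2 * L) \<le> U x"
    using bregman_lower[of y x] by (simp add: r_def D_def norm_minus_commute inner_diff_right)
  moreover have "(g x + g y) \<bullet> D = g x \<bullet> D + g y \<bullet> D" "r \<bullet> D = g y \<bullet> D - g x \<bullet> D"
    by (simp_all add: r_def inner_add_left inner_diff_left)
  ultimately have "\<bar>U y - U x - ((g x + g y) \<bullet> D) / 2\<bar> \<le> L / 8 * (norm D)\<^sup>2"
    using * by linarith
  then show ?thesis by (simp add: D_def)
qed

text \<open>Outside the ball of radius \<open>2 * norm (g 0) / m\<close> the quadratic growth beats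
  the linear term at 0, so the minimum over the ball is global.\<close>

lemma ex_critical: "\<exists>x. g x = 0"
proof -
  define R where "R = 2 * norm (g 0) / m"
  have R: "0 \<le> R" using m_pos by (simp add: R_def)
  have "\<exists>x\<in>cball 0 R. \<forall>y\<in>cball 0 R. U x \<le> U y"
    using continuous_attains_inf[of "cball 0 R" U] continuous_on_subset[OF continuous_U] R by auto
  then obtain x where x: "\<And>y. y \<in> cball 0 R \<Longrightarrow> U x \<le> U y" by blast
  have "U x \<le> U y" for y
  proof (cases "y \<in> cball 0 R")
    case False
    then have "2 * norm (g 0) \<le> m * norm y"
      using m_pos by (simp add: R_def field_simps)
    then have "norm (g 0) * norm y \<le> m / 2 * (norm y)\<^sup>2"
      using mult_right_mono[of "2 * norm (g 0)" "m * norm y" "norm y"] by (simp add: power2_eq_square)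
    moreover have "\<bar>g 0 \<bullet> y\<bar> \<le> norm (g 0) * norm y"
      by (rule Cauchy_Schwarz_ineq2)
    ultimately have "U 0 \<le> U y"
      using strong_convexity[of 0 y] by simp
    then show ?thesis using x[of 0] R by simp
  qed (use x in auto)
  then have "(\<lambda>h. h \<bullet> g x) = (\<lambda>h. 0)"
    using differential_zero_maxmin[of x UNIV U "\<lambda>h. h \<bullet> g x"] gderiv[of x] unfolding gderiv_def by auto
  then have "g x \<bullet> g x = 0" by metis
  then show ?thesis by auto
qed

end

section \<open>Contraction of the chain\<close>

locale obabo = strongly_convex_smooth U g m L
  for U :: "'a::euclidean_space \<Rightarrow> real" and g m L +
  fixes \<gamma> \<delta> :: real
  assumes gamma_ge: "2 * sqrt L \<le> \<gamma>" and delta_pos: "0 < \<delta>" and delta_le: "\<delta> \<le> m / (33 * \<gamma> ^ 3)"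
begin

section \<open>Parameters of the chain and consequences of the step-size bound\<close>

definition "\<omega> = sqrt L"
definition "\<eta> = eta \<delta> \<gamma>"
definition "\<sigma> = sqrt (1 - \<eta>\<^sup>2)"
definition "\<kappa> = kappa m \<gamma>"

lemma omega_pos: "0 < \<omega>" using L_pos by (simp add: \<omega>_def)
lemma omega_sq: "\<omega>\<^sup>2 = L" using L_pos by (simp add: \<omega>_def)
lemma omega_mult: "\<omega> * \<omega> = L" using omega_sq by (simp add: power2_eq_square)
lemma omega_le: "\<omega> \<le> \<gamma> / 2" using gamma_ge by (simp add: \<omega>_def)
lemma gamma_pos: "0 < \<gamma>" using omega_pos omega_le by simp

lemma L_le_gamma: "L \<le> \<gamma>\<^sup>2 / 4"
  using power_mono[OF omega_le, of 2] omega_pos by (simp add: omega_sq power_divide)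

lemma m_le_gamma: "m \<le> \<gamma>\<^sup>2 / 4"
  using L_le_gamma m_le_L by simp

text \<open>The form in which the step-size bound is consumed: with
  \<open>h = \<delta> * \<gamma>\<close>, quadratic errors \<open>h\<^sup>2\<close> are at most 1/33
  of the dissipation rate \<open>\<delta> * m / \<gamma>\<close>.\<close>

lemma h_sq_le: "(\<delta> * \<gamma>)\<^sup>2 \<le> \<delta> * m / (33 * \<gamma>)"
proof -
  have "\<delta> * (33 * \<gamma> ^ 3) \<le> m"
    using delta_le gamma_pos by (simp add: pos_le_divide_eq)
  then have "\<delta> * (\<delta> * (33 * \<gamma> ^ 3)) \<le> \<delta> * m"
    using delta_pos by simp
  then show ?thesis
    using gamma_pos by (simp add: pos_le_divide_eq power2_eq_square power3_eq_cube algebra_simps)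
qed

lemma h_le: "\<delta> * \<gamma> \<le> 1 / 132"
proof -
  have "(\<delta> * \<gamma>)\<^sup>2 \<le> \<delta> * (\<gamma>\<^sup>2 / 4) / (33 * \<gamma>)"
    by (rule order_trans[OF h_sq_le])
      (use m_le_gamma delta_pos gamma_pos in \<open>intro divide_right_mono mult_left_mono, auto\<close>)
  also have "\<dots> = (\<delta> * \<gamma>) / 132"
    using gamma_pos by (simp add: power2_eq_square)
  finally show ?thesis
    using delta_pos gamma_pos by (simp add: power2_eq_square)
qed

lemma h_pos: "0 < \<delta> * \<gamma>" using delta_pos gamma_pos by simp

lemma eta_pos: "0 < \<eta>" by (simp add: \<eta>_def eta_def)

lemma eta_lt_1: "\<eta> < 1" using h_pos by (simp add: \<eta>_def eta_def)

lemma eta_ge: "1 - \<delta> * \<gamma> / 2 \<le> \<eta>"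
  using exp_ge_add_one_self[of "- \<delta> * \<gamma> / 2"] by (simp add: \<eta>_def eta_def)

lemma eta_sq: "\<eta>\<^sup>2 = exp (- (\<delta> * \<gamma>))"
  by (simp add: \<eta>_def eta_def power2_eq_square flip: exp_add)

lemma one_minus_eta_sq_le: "1 - \<eta>\<^sup>2 \<le> \<delta> * \<gamma>"
  using exp_ge_add_one_self[of "- (\<delta> * \<gamma>)"] by (simp add: eta_sq)

lemma one_minus_eta_sq_ge: "\<delta> * \<gamma> - (\<delta> * \<gamma>)\<^sup>2 / 2 \<le> 1 - \<eta>\<^sup>2"
proof -
  define h where "h = \<delta> * \<gamma>"
  have h: "0 < h" "h \<le> 1" using h_pos h_le by (auto simp: h_def)
  \<comment> \<open>The product equals \<open>1 + h ^ 4 / 4\<close>, so the quadratic lower bound of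
    \<open>exp h\<close> inverts to a quadratic upper bound of \<open>exp (- h)\<close>.\<close>
  have "1 \<le> (1 - h + h\<^sup>2 / 2) * (1 + h + h\<^sup>2 / 2)"
    using h by (simp add: algebra_simps power2_eq_square)
  also have "\<dots> \<le> (1 - h + h\<^sup>2 / 2) * exp h"
    using exp_lower_Taylor_quadratic[of h] h by (intro mult_left_mono) auto
  finally have "exp (- h) \<le> 1 - h + h\<^sup>2 / 2"
    by (simp add: exp_minus field_simps)
  then show ?thesis by (simp add: eta_sq h_def)
qed

lemma one_minus_eta_sq_pos: "0 < 1 - \<eta>\<^sup>2"
  using eta_lt_1 eta_pos by (simp add: power_less_one_iff)

lemma sigma_pos: "0 < \<sigma>" and sigma_sq: "\<sigma>\<^sup>2 = 1 - \<eta>\<^sup>2"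
  using one_minus_eta_sq_pos by (auto simp: \<sigma>_def)

lemma kappa_pos: "0 < \<kappa>" using m_pos gamma_pos by (simp add: \<kappa>_def kappa_def)

lemma delta_kappa_le: "\<delta> * \<kappa> \<le> 1 / 1000"
proof -
  have "\<kappa> \<le> \<gamma> / 12"
    using m_le_gamma gamma_pos by (simp add: \<kappa>_def kappa_def field_simps power2_eq_square)
  then have "\<delta> * \<kappa> \<le> \<delta> * (\<gamma> / 12)" using delta_pos by simp
  then show ?thesis using h_le by simp
qed

text \<open>Square root of the quadratic form after completing the square: the Euclidean norm of a
  linear image of \<open>z\<close>, whence the triangle inequality. The weight under the root is
  nonnegative because \<open>L \<le> \<gamma>\<^sup>2 / 4\<close>.\<close>

definition nb :: "'a \<times> 'a \<Rightarrow> real" where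
  "nb z = norm (fst z + (1 / \<gamma>) *\<^sub>R snd z, sqrt (1 / L - 1 / \<gamma>\<^sup>2) *\<^sub>R snd z)"

lemma nb_sq: "(nb z)\<^sup>2 = (norm (fst z))\<^sup>2 + 2 / \<gamma> * (fst z \<bullet> snd z) + (norm (snd z))\<^sup>2 / L"
proof -
  have "1 / \<gamma>\<^sup>2 \<le> 1 / (4 * L)"
    using L_le_gamma L_pos gamma_pos by (intro divide_left_mono) auto
  also have "\<dots> \<le> 1 / L" using L_pos by (simp add: field_simps)
  finally have *: "(sqrt (1 / L - 1 / \<gamma>\<^sup>2))\<^sup>2 = 1 / L - 1 / \<gamma>\<^sup>2" by simp
  have "(norm (fst z + (1 / \<gamma>) *\<^sub>R snd z))\<^sup>2
      = (norm (fst z))\<^sup>2 + 2 / \<gamma> * (fst z \<bullet> snd z) + 1 / \<gamma>\<^sup>2 * (norm (snd z))\<^sup>2"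
    unfolding power2_norm_eq_inner
    by (simp add: inner_add_left inner_add_right inner_commute power2_eq_square)
  moreover have "(nb z)\<^sup>2 = (norm (fst z + (1 / \<gamma>) *\<^sub>R snd z))\<^sup>2
      + (norm (sqrt (1 / L - 1 / \<gamma>\<^sup>2) *\<^sub>R snd z))\<^sup>2"
    unfolding nb_def norm_Pair by simp
  ultimately show ?thesis
    by (simp add: power_mult_distrib * left_diff_distrib)
qed

lemma nb_nonneg [simp]: "0 \<le> nb z" by (simp add: nb_def)

lemma nb_triangle: "nb (z + w) \<le> nb z + nb w"
proof -
  have "(fst (z + w) + (1 / \<gamma>) *\<^sub>R snd (z + w), sqrt (1 / L - 1 / \<gamma>\<^sup>2) *\<^sub>R snd (z + w))
     = (fst z + (1 / \<gamma>) *\<^sub>R snd z, sqrt (1 / L - 1 / \<gamma>\<^sup>2) *\<^sub>R snd z)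
     + (fst w + (1 / \<gamma>) *\<^sub>R snd w, sqrt (1 / L - 1 / \<gamma>\<^sup>2) *\<^sub>R snd w)"
    by (simp add: scaleR_add_right)
  then show ?thesis unfolding nb_def using norm_triangle_ineq by metis
qed

lemma continuous_nb: "continuous_on UNIV nb"
  unfolding nb_def by (intro continuous_intros)

lemma measurable_nb [measurable]: "nb \<in> borel_measurable borel"
  using continuous_nb by (rule borel_measurable_continuous_onI)

lemma cross_term_le: "2 / \<gamma> * \<bar>x \<bullet> v\<bar> \<le> norm x * (norm v / \<omega>)"
proof -
  have "2 / \<gamma> \<le> 1 / \<omega>" using omega_le omega_pos gamma_pos by (simp add: field_simps)
  then have "2 / \<gamma> * \<bar>x \<bullet> v\<bar> \<le> 1 / \<omega> * (norm x * norm v)"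
    using omega_pos by (intro mult_mono Cauchy_Schwarz_ineq2) auto
  then show ?thesis by simp
qed

text \<open>With \<open>a = norm (fst z)\<close> and \<open>b = norm (snd z) / \<omega>\<close>, the
  friction bound gives \<open>2 / \<gamma> \<le> 1 / \<omega>\<close>, so the cross term is at most
  \<open>a * b\<close> in absolute value.\<close>

lemma nb_sq_le: "(nb z)\<^sup>2 \<le> 3 / 2 * ((norm (fst z))\<^sup>2 + (norm (snd z))\<^sup>2 / L)"
  and nb_sq_ge: "1 / 2 * ((norm (fst z))\<^sup>2 + (norm (snd z))\<^sup>2 / L) \<le> (nb z)\<^sup>2"
  and nb_le: "nb z \<le> norm (fst z) + norm (snd z) / \<omega>"
proof -
  define a b where "a = norm (fst z)" and "b = norm (snd z) / \<omega>"
  have b2: "b\<^sup>2 = (norm (snd z))\<^sup>2 / L" by (simp add: b_def power_divide omega_sq)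
  have ab: "0 \<le> a" "0 \<le> b" using omega_pos by (auto simp: a_def b_def)
  have c: "\<bar>2 / \<gamma> * (fst z \<bullet> snd z)\<bar> \<le> a * b"
    using cross_term_le[of "fst z" "snd z"] gamma_pos by (simp add: a_def b_def abs_mult)
  define t where "t = 2 / \<gamma> * (fst z \<bullet> snd z)"
  have t: "t \<le> a * b" "- (a * b) \<le> t" using c unfolding t_def[symmetric] by linarith+
  have q: "(nb z)\<^sup>2 = a\<^sup>2 + t + b\<^sup>2"
    by (simp add: nb_sq b2 a_def t_def)
  have am: "2 * (a * b) \<le> a\<^sup>2 + b\<^sup>2"
    using sum_squares_bound[of a b] by simp
  show "(nb z)\<^sup>2 \<le> 3 / 2 * ((norm (fst z))\<^sup>2 + (norm (snd z))\<^sup>2 / L)"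
    using t am unfolding q b2[symmetric] a_def[symmetric] by (simp add: distrib_left)
  show "1 / 2 * ((norm (fst z))\<^sup>2 + (norm (snd z))\<^sup>2 / L) \<le> (nb z)\<^sup>2"
    using t am unfolding q b2[symmetric] a_def[symmetric] by (simp add: distrib_left)
  have "(nb z)\<^sup>2 \<le> (a + b)\<^sup>2"
    using t mult_nonneg_nonneg[OF ab] unfolding q power2_sum by simp
  then show "nb z \<le> norm (fst z) + norm (snd z) / \<omega>"
    using ab by (auto simp: a_def[symmetric] b_def[symmetric] intro: power2_le_imp_le)
qed

lemma norm_le_nb: "norm z \<le> sqrt 2 * max 1 \<omega> * nb z"
proof -
  define M where "M = max 1 \<omega>"
  have M: "1 \<le> M\<^sup>2" "L \<le> M\<^sup>2"
    using omega_pos power_mono[of 1 M 2] power_mono[of \<omega> M 2] by (auto simp: M_def omega_sq)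
  have "(norm z)\<^sup>2 = (norm (fst z))\<^sup>2 + L * ((norm (snd z))\<^sup>2 / L)"
    using L_pos by (simp add: norm_prod_def)
  also have "\<dots> \<le> M\<^sup>2 * (norm (fst z))\<^sup>2 + M\<^sup>2 * ((norm (snd z))\<^sup>2 / L)"
    using M L_pos by (intro add_mono mult_right_mono) (auto simp: mult_right_le_one_le mult_le_cancel_right1)
  also have "\<dots> = M\<^sup>2 * ((norm (fst z))\<^sup>2 + (norm (snd z))\<^sup>2 / L)" by (simp add: distrib_left)
  also have "\<dots> \<le> M\<^sup>2 * (2 * (nb z)\<^sup>2)"
    using nb_sq_ge[of z] by (intro mult_left_mono) auto
  also have "\<dots> = (sqrt 2 * M * nb z)\<^sup>2" by (simp add: power_mult_distrib)
  finally show ?thesis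
    unfolding M_def[symmetric] by (rule power2_le_imp_le) (auto simp: M_def)
qed

text \<open>Here \<open>x\<close>, \<open>v\<close> stand for the difference of two states driven by
  the same noise, and \<open>w0\<close>, \<open>w1\<close> for the differences of the gradients at
  the old and the new positions; the three properties of each are monotonicity, cocoercivity and the
  Lipschitz bound. The increment \<open>(a, b)\<close> is of first order in \<open>h\<close>, so its
  linear terms decide and the rest is error.\<close>

lemma step_contraction_aux:
  fixes x v w0 w1 :: 'a
  defines "x1 \<equiv> x + (\<delta> * \<eta>) *\<^sub>R v - (\<delta>\<^sup>2 / 2) *\<^sub>R w0"
  defines "v1 \<equiv> \<eta>\<^sup>2 *\<^sub>R v - (\<delta> * \<eta> / 2) *\<^sub>R (w0 + w1)"
  assumes w0: "m * (norm x)\<^sup>2 \<le> x \<bullet> w0" "(norm w0)\<^sup>2 \<le> L * (x \<bullet> w0)" "norm w0 \<le> L * norm x"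
  assumes w1: "m * (norm x1)\<^sup>2 \<le> x1 \<bullet> w1" "(norm w1)\<^sup>2 \<le> L * (x1 \<bullet> w1)" "norm w1 \<le> L * norm x1"
  shows "(nb (x1, v1))\<^sup>2 \<le> (1 - \<delta> * \<kappa>) * (nb (x, v))\<^sup>2"
proof -
  define N where "N = sqrt ((norm x)\<^sup>2 + (norm v)\<^sup>2 / L)"
  define h where "h = \<delta> * \<gamma>"
  define e where "e = 1 - \<eta>\<^sup>2"
  define w where "w = (1 / 2) *\<^sub>R (w0 + w1)"
  define a where "a = (\<delta> * \<eta>) *\<^sub>R v - (\<delta>\<^sup>2 / 2) *\<^sub>R w0"
  define b where "b = - (e *\<^sub>R v) - (\<delta> * \<eta>) *\<^sub>R w"
  define S where "S = (x \<bullet> w0 + x1 \<bullet> w1) / 2"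
  have x1: "x1 = x + a" by (simp add: x1_def a_def)
  have v1: "v1 = v + b" by (simp add: v1_def b_def e_def w_def algebra_simps)
  have h: "0 < h" "h \<le> 1 / 132" "h\<^sup>2 \<le> \<delta> * m / (33 * \<gamma>)"
    using h_pos h_le h_sq_le by (auto simp: h_def)
  have e: "h - h\<^sup>2 / 2 \<le> e" "e \<le> h" "0 \<le> e"
    using one_minus_eta_sq_ge one_minus_eta_sq_le one_minus_eta_sq_pos by (auto simp: h_def e_def)
  have eta: "1 - h / 2 \<le> \<eta>" "\<eta> \<le> 1" "0 \<le> \<eta>"
    using eta_ge eta_lt_1 eta_pos by (auto simp: h_def)
  have de: "\<delta> * \<eta> \<le> \<delta>" "0 \<le> \<delta> * \<eta>" using eta delta_pos by auto
  have N2: "N\<^sup>2 = (norm x)\<^sup>2 + (norm v)\<^sup>2 / L" using L_pos by (simp add: N_def)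
  have N0: "0 \<le> N" using L_pos by (simp add: N_def)
  have xN: "norm x \<le> N"
    using L_pos by (intro power2_le_imp_le[OF _ N0]) (simp add: N2)
  have vN: "norm v \<le> \<omega> * N"
  proof (rule power2_le_imp_le)
    show "(norm v)\<^sup>2 \<le> (\<omega> * N)\<^sup>2"
      using L_pos by (simp add: power_mult_distrib omega_sq N2 distrib_left)
  qed (use omega_pos N0 in simp)
  have dw: "\<delta> * \<omega> \<le> h / 2" using omega_le delta_pos by (simp add: h_def)
  have dL: "\<delta> * L \<le> h / 2 * \<omega>"
    using mult_right_mono[OF dw, of \<omega>] omega_pos by (simp add: mult.assoc omega_mult)
  have ddL: "\<delta>\<^sup>2 * L \<le> h\<^sup>2 / 4"
    using power_mono[OF dw, of 2] omega_pos delta_pos by (simp add: power_mult_distrib omega_sq power_divide)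
  have dLg: "\<delta> * L / \<gamma> \<le> h / 4"
  proof -
    have "\<delta> * L \<le> \<delta> * (\<gamma>\<^sup>2 / 4)" using L_le_gamma delta_pos by simp
    then show ?thesis using gamma_pos by (simp add: h_def divide_simps power2_eq_square)
  qed
  have w0N: "norm w0 \<le> L * N"
    using w0(3) xN L_pos by (meson mult_left_mono order_trans less_imp_le)
  have aN: "norm a \<le> h * N"
  proof -
    have "norm a \<le> norm ((\<delta> * \<eta>) *\<^sub>R v) + norm ((\<delta>\<^sup>2 / 2) *\<^sub>R w0)"
      unfolding a_def by (rule norm_triangle_ineq4)
    also have "\<dots> = (\<delta> * \<eta>) * norm v + \<delta>\<^sup>2 / 2 * norm w0"
      using de delta_pos eta by simp
    also have "\<dots> \<le> \<delta> * (\<omega> * N) + \<delta>\<^sup>2 / 2 * (L * N)"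
      using de vN w0N by (intro add_mono mult_mono) auto
    also have "\<dots> = (\<delta> * \<omega>) * N + (\<delta>\<^sup>2 * L) / 2 * N" by simp
    also have "\<dots> \<le> h / 2 * N + (h\<^sup>2 / 4) / 2 * N"
      by (intro add_mono mult_right_mono divide_right_mono dw ddL N0) simp_all
    also have "\<dots> \<le> h / 2 * N + h / 2 * N"
    proof -
      have "h\<^sup>2 \<le> h" using h by (simp add: power2_eq_square)
      then show ?thesis using N0 h by (intro add_left_mono mult_right_mono) auto
    qed
    finally show ?thesis by (simp add: mult.commute)
  qed
  have hN: "h * N \<le> N" using h N0 by (simp add: mult_left_le_one_le)
  have x1N: "norm x1 \<le> 2 * N"
    using norm_triangle_ineq[of x a] xN aN hN by (simp add: x1)
  have w1N: "norm w1 \<le> 2 * (L * N)"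
    using order_trans[OF w1(3) mult_left_mono[OF x1N, of L]] L_pos by simp
  have wN: "norm w \<le> 2 * (L * N)"
  proof -
    have "0 \<le> L * N" using L_pos N0 by simp
    then show ?thesis
      using norm_triangle_ineq[of w0 w1] w0N w1N by (simp add: w_def)
  qed
  have bN: "norm b \<le> 2 * h * \<omega> * N"
  proof -
    have "norm b \<le> norm (e *\<^sub>R v) + norm ((\<delta> * \<eta>) *\<^sub>R w)"
      unfolding b_def by (metis norm_minus_cancel norm_triangle_ineq4)
    also have "\<dots> = e * norm v + \<delta> * \<eta> * norm w" using e de by simp
    also have "\<dots> \<le> h * (\<omega> * N) + \<delta> * (2 * (L * N))"
      using e de h vN wN by (intro add_mono mult_mono) auto
    also have "\<dots> = h * \<omega> * N + 2 * (\<delta> * L) * N" by simp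
    also have "\<dots> \<le> h * \<omega> * N + 2 * (h / 2 * \<omega>) * N"
      using dL N0 by (intro add_left_mono mult_right_mono) auto
    finally show ?thesis by (simp add: mult_ac)
  qed
  \<comment> \<open>Common unit of all second-order errors; \<open>N\<close> is the norm without
    cross term.\<close>
  define E where "E = h\<^sup>2 * N\<^sup>2"
  define DS where "DS = \<delta> * \<eta> / \<gamma> * S"
  \<comment> \<open>All velocity terms: gain from transport, loss by friction, and the share of the
    Young inequality \<open>T7\<close>.\<close>
  define VV where "VV = 2 * \<delta> * \<eta> / \<gamma> * (norm v)\<^sup>2 - 2 * e / L * (norm v)\<^sup>2 + \<delta> * \<eta> * \<gamma> / L * (norm v)\<^sup>2"
  have quad: "(nb (a, b))\<^sup>2 \<le> 9 * E"
  proof -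
    have "norm b / \<omega> \<le> 2 * h * N" using bN omega_pos by (simp add: field_simps)
    then have "nb (a, b) \<le> 3 * h * N"
      using nb_le[of "(a, b)"] aN by simp
    then have "(nb (a, b))\<^sup>2 \<le> (3 * h * N)\<^sup>2" by (intro power_mono) auto
    then show ?thesis by (simp add: power_mult_distrib E_def)
  qed
  have expand: "(nb (x1, v1))\<^sup>2 = (nb (x, v))\<^sup>2 + (nb (a, b))\<^sup>2
      + (2 * (x \<bullet> a) + 2 / \<gamma> * (x \<bullet> b + a \<bullet> v) + 2 / L * (v \<bullet> b))"
    unfolding nb_sq x1 v1 power2_norm_eq_inner
    by (simp add: inner_add_left inner_add_right inner_commute algebra_simps add_divide_distrib)
  have lin: "2 * (x \<bullet> a) + 2 / \<gamma> * (x \<bullet> b + a \<bullet> v) + 2 / L * (v \<bullet> b)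
      = (2 * \<delta> * \<eta> - 2 * e / \<gamma>) * (x \<bullet> v) - \<delta>\<^sup>2 * (x \<bullet> w0) - 2 * \<delta> * \<eta> / \<gamma> * (x \<bullet> w)
        + 2 * \<delta> * \<eta> / \<gamma> * (norm v)\<^sup>2 - \<delta>\<^sup>2 / \<gamma> * (w0 \<bullet> v) - 2 * e / L * (norm v)\<^sup>2
        - 2 * \<delta> * \<eta> / L * (v \<bullet> w)"
    unfolding a_def b_def power2_norm_eq_inner
    by (simp add: inner_diff_left inner_diff_right inner_commute algebra_simps)
  \<comment> \<open>The force \<open>w\<close> is an average over both positions, so dissipation is
    measured by \<open>S\<close>, the same average. Pairing \<open>w1\<close> with \<open>x\<close>
    instead of \<open>x1\<close> costs \<open>(a \<bullet> w1) / 2\<close>, of second order.\<close>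
  have xw: "x \<bullet> w = S - (a \<bullet> w1) / 2"
    unfolding S_def w_def x1 by (simp add: inner_add_right inner_add_left add_divide_distrib)
  \<comment> \<open>The first-order parts cancel, since \<open>e\<close> and
    \<open>\<delta> * \<eta> * \<gamma>\<close> both agree with \<open>h\<close> up to order
    \<open>h\<^sup>2\<close>. The weight \<open>2 / \<gamma>\<close> of the cross term in
    \<open>nb\<close> is tuned to this.\<close>
  have T1: "(2 * \<delta> * \<eta> - 2 * e / \<gamma>) * (x \<bullet> v) \<le> 1 / 2 * E"
  proof -
    have e1: "e / \<gamma> \<le> \<delta>" "\<delta> - \<delta> * h / 2 \<le> e / \<gamma>"
      using e gamma_pos by (auto simp: h_def field_simps power2_eq_square)
    have "\<delta> * (1 - h / 2) \<le> \<delta> * \<eta>" using eta delta_pos by (intro mult_left_mono) auto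
    then have "\<bar>2 * \<delta> * \<eta> - 2 * e / \<gamma>\<bar> \<le> \<delta> * h"
    proof -
      have "\<delta> - \<delta> * h / 2 \<le> \<delta> * \<eta>"
        using \<open>\<delta> * (1 - h / 2) \<le> \<delta> * \<eta>\<close> by (simp add: right_diff_distrib)
      then have "\<bar>\<delta> * \<eta> - e / \<gamma>\<bar> \<le> \<delta> * h / 2"
        using e1 de unfolding abs_le_iff by linarith
      moreover have "2 * \<delta> * \<eta> - 2 * e / \<gamma> = 2 * (\<delta> * \<eta> - e / \<gamma>)" by simp
      ultimately show ?thesis by linarith
    qed
    then have "\<bar>2 * \<delta> * \<eta> - 2 * e / \<gamma>\<bar> * \<bar>x \<bullet> v\<bar> \<le> (\<delta> * h) * (N * (\<omega> * N))"
      using Cauchy_Schwarz_ineq2[of x v] mult_mono[OF xN vN N0 norm_ge_zero]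
      by (intro mult_mono) auto
    then have "(2 * \<delta> * \<eta> - 2 * e / \<gamma>) * (x \<bullet> v) \<le> (\<delta> * \<omega>) * (h * N\<^sup>2)"
      by (simp add: abs_mult[symmetric] power2_eq_square mult_ac)
    also have "\<dots> \<le> h / 2 * (h * N\<^sup>2)" using dw h by (intro mult_right_mono) auto
    finally show ?thesis by (simp add: E_def power2_eq_square mult_ac)
  qed
  have T2: "0 \<le> \<delta>\<^sup>2 * (x \<bullet> w0)"
    using order_trans[OF _ w0(1)] m_pos by simp
  have T3: "2 * \<delta> * \<eta> / \<gamma> * (a \<bullet> w1) / 2 \<le> 1 / 2 * E"
  proof -
    have "a \<bullet> w1 \<le> (h * N) * (2 * (L * N))"
      using order_trans[OF norm_cauchy_schwarz mult_mono[OF aN w1N]] h N0 by simp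
    then have "(\<delta> * \<eta> / \<gamma>) * (a \<bullet> w1) \<le> (\<delta> * \<eta> / \<gamma>) * ((h * N) * (2 * (L * N)))"
      using de gamma_pos by (intro mult_left_mono) auto
    also have "\<dots> \<le> (\<delta> / \<gamma>) * ((h * N) * (2 * (L * N)))"
      using de gamma_pos h N0 L_pos by (intro mult_right_mono divide_right_mono) auto
    also have "\<dots> = (\<delta> * L / \<gamma>) * (2 * h * N\<^sup>2)" by (simp add: power2_eq_square)
    also have "\<dots> \<le> h / 4 * (2 * h * N\<^sup>2)" using dLg h by (intro mult_right_mono) auto
    finally show ?thesis by (simp add: E_def power2_eq_square mult_ac)
  qed
  have T5: "- (\<delta>\<^sup>2 / \<gamma> * (w0 \<bullet> v)) \<le> 1 / 8 * E"
  proof -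
    have "- (w0 \<bullet> v) \<le> (L * N) * (\<omega> * N)"
      using order_trans[OF Cauchy_Schwarz_ineq2[of w0 v] mult_mono[OF w0N vN]] L_pos N0
      by (simp add: abs_le_iff)
    then have "\<delta>\<^sup>2 / \<gamma> * (- (w0 \<bullet> v)) \<le> \<delta>\<^sup>2 / \<gamma> * ((L * N) * (\<omega> * N))"
      using gamma_pos by (intro mult_left_mono) auto
    also have "\<dots> = (\<delta> * L / \<gamma>) * ((\<delta> * \<omega>) * N\<^sup>2)" by (simp add: power2_eq_square)
    also have "\<dots> \<le> h / 4 * (h / 2 * N\<^sup>2)"
      using dLg dw h gamma_pos L_pos delta_pos omega_pos by (intro mult_mono mult_right_mono) auto
    finally show ?thesis by (simp add: E_def power2_eq_square mult_ac)
  qed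
  have wS: "(norm w)\<^sup>2 \<le> L * S"
  proof -
    have "(norm w)\<^sup>2 \<le> ((norm w0)\<^sup>2 + (norm w1)\<^sup>2) / 2"
    proof -
      have "0 \<le> (norm (w0 - w1))\<^sup>2" by simp
      then show ?thesis
        unfolding w_def power2_norm_eq_inner
        by (simp add: inner_add_left inner_add_right inner_diff_left inner_diff_right inner_commute)
    qed
    also have "\<dots> \<le> L * S" using w0(2) w1(2) by (simp add: S_def distrib_left)
    finally show ?thesis .
  qed
  \<comment> \<open>Young with weight \<gamma>, then cocoercivity in the form \<open>wS\<close>: one
    of the two units \<open>DS\<close> of dissipation is spent here, and the term in
    \<open>(norm v)\<^sup>2\<close> takes about half of the friction.\<close>
  have T7: "- (2 * \<delta> * \<eta> / L * (v \<bullet> w)) \<le> DS + \<delta> * \<eta> * \<gamma> / L * (norm v)\<^sup>2"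
  proof -
    have "- (2 * (v \<bullet> w)) \<le> 2 * (norm w * norm v)"
      using Cauchy_Schwarz_ineq2[of v w] by (simp add: mult.commute abs_le_iff)
    also have "\<dots> \<le> (norm w)\<^sup>2 / \<gamma> + \<gamma> * (norm v)\<^sup>2"
    proof -
      have "0 \<le> (norm w - \<gamma> * norm v)\<^sup>2 / \<gamma>" using gamma_pos by simp
      also have "\<dots> = (norm w)\<^sup>2 / \<gamma> + \<gamma> * (norm v)\<^sup>2 - 2 * (norm w * norm v)"
        using gamma_pos by (simp add: power2_diff field_simps power2_eq_square)
      finally show ?thesis by simp
    qed
    also have "\<dots> \<le> L * S / \<gamma> + \<gamma> * (norm v)\<^sup>2"
      using wS gamma_pos by (simp add: divide_right_mono)
    finally have "\<delta> * \<eta> / L * (- (2 * (v \<bullet> w))) \<le> \<delta> * \<eta> / L * (L * S / \<gamma> + \<gamma> * (norm v)\<^sup>2)"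
      using de L_pos by (intro mult_left_mono) auto
    then show ?thesis using L_pos gamma_pos by (simp add: field_simps DS_def)
  qed
  \<comment> \<open>The second unit \<open>DS\<close> yields the decay in position, by monotonicity
    at both ends; the error of 3/8 is 1/4 for the motion of the position plus 1/8 for replacing
    \<eta> by 1.\<close>
  have S: "- DS \<le> - (\<delta> * m / \<gamma> * (norm x)\<^sup>2) + 3 / 8 * E"
  proof -
    have x1g: "norm x - norm a \<le> norm x1" using norm_diff_ineq[of x a] by (simp add: x1)
    have "(norm x)\<^sup>2 - 2 * (norm x * norm a) \<le> (norm x1)\<^sup>2"
    proof (cases "norm a \<le> norm x")
      case True
      then have "(norm x - norm a)\<^sup>2 \<le> (norm x1)\<^sup>2" using x1g by (intro power_mono) auto
      then show ?thesis
        using zero_le_power2[of "norm a"] unfolding power2_diff by linarith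
    next
      case False
      then have "norm x * norm x \<le> norm x * norm a"
        using mult_left_mono[of "norm x" "norm a" "norm x"] by simp
      moreover have "0 \<le> norm x * norm a" by simp
      ultimately show ?thesis
        using zero_le_power2[of "norm x1"] unfolding power2_eq_square by linarith
    qed
    moreover have "norm x * norm a \<le> h * N\<^sup>2"
      using mult_mono[OF xN aN N0 norm_ge_zero] by (simp add: power2_eq_square mult_ac)
    ultimately have "2 * (norm x)\<^sup>2 - 2 * h * N\<^sup>2 \<le> (norm x)\<^sup>2 + (norm x1)\<^sup>2" by linarith
    then have "m * (2 * (norm x)\<^sup>2 - 2 * h * N\<^sup>2) \<le> m * ((norm x)\<^sup>2 + (norm x1)\<^sup>2)"
      using m_pos by (intro mult_left_mono) auto
    also have "\<dots> \<le> 2 * S" using w0(1) w1(1) by (simp add: S_def distrib_left)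
    finally have "m * (norm x)\<^sup>2 - m * h * N\<^sup>2 \<le> S" by (simp add: algebra_simps)
    then have "\<delta> * \<eta> / \<gamma> * (m * (norm x)\<^sup>2 - m * h * N\<^sup>2) \<le> \<delta> * \<eta> / \<gamma> * S"
      using de gamma_pos by (intro mult_left_mono) auto
    moreover have "\<delta> * \<eta> / \<gamma> * (m * h * N\<^sup>2) \<le> 1 / 4 * E"
    proof -
      have "\<delta> * \<eta> / \<gamma> * (m * h * N\<^sup>2) \<le> \<delta> / \<gamma> * (L * h * N\<^sup>2)"
        using de gamma_pos m_le_L m_pos h delta_pos by (intro mult_mono mult_right_mono divide_right_mono) auto
      also have "\<dots> = (\<delta> * L / \<gamma>) * (h * N\<^sup>2)" by simp
      also have "\<dots> \<le> h / 4 * (h * N\<^sup>2)" using dLg h by (intro mult_right_mono) auto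
      finally show ?thesis by (simp add: E_def power2_eq_square mult_ac)
    qed
    moreover have "\<delta> * m / \<gamma> * (norm x)\<^sup>2 - 1 / 8 * E \<le> \<delta> * \<eta> / \<gamma> * (m * (norm x)\<^sup>2)"
    proof -
      have "\<delta> * m / \<gamma> * (norm x)\<^sup>2 * (1 - \<eta>) \<le> (\<delta> * L / \<gamma>) * N\<^sup>2 * (h / 2)"
        using m_le_L m_pos delta_pos gamma_pos xN eta L_pos
        by (intro mult_mono divide_right_mono mult_left_mono power_mono) auto
      also have "\<dots> \<le> h / 4 * N\<^sup>2 * (h / 2)" using dLg h by (intro mult_right_mono) auto
      also have "\<dots> = 1 / 8 * E" by (simp add: E_def power2_eq_square)
      finally have "\<delta> * m / \<gamma> * (norm x)\<^sup>2 - \<delta> * m / \<gamma> * (norm x)\<^sup>2 * \<eta> \<le> 1 / 8 * E"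
        by (simp only: right_diff_distrib mult_1_right)
      moreover have "\<delta> * m / \<gamma> * (norm x)\<^sup>2 * \<eta> = \<delta> * \<eta> / \<gamma> * (m * (norm x)\<^sup>2)" by simp
      ultimately show ?thesis by linarith
    qed
    ultimately show ?thesis unfolding DS_def right_diff_distrib by linarith
  qed
  \<comment> \<open>With \<open>Y = (norm v)\<^sup>2 / L\<close>, friction \<open>2 * h\<close>
    minus the \<open>h\<close> spent in \<open>T7\<close> minus a transport gain of at most
    \<open>h / 2\<close> leaves \<open>h / 2\<close>, which exceeds
    \<open>\<delta> * m / \<gamma> \<le> h / 4\<close>.\<close>
  have V: "VV \<le> - (\<delta> * m / \<gamma> * ((norm v)\<^sup>2 / L)) + E"
  proof -
    define Y where "Y = (norm v)\<^sup>2 / L"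
    have Y: "0 \<le> Y" "Y \<le> N\<^sup>2" using L_pos by (auto simp: Y_def N2)
    have vY: "(norm v)\<^sup>2 = L * Y" using L_pos by (simp add: Y_def)
    have "VV = (2 * ((\<delta> * \<eta>) * L / \<gamma>) - 2 * e + (\<delta> * \<eta>) * \<gamma>) * Y"
      unfolding VV_def vY using L_pos by (simp add: algebra_simps)
    also have "\<dots> \<le> (2 * (\<delta> * L / \<gamma>) - 2 * (h - h\<^sup>2 / 2) + h) * Y"
    proof -
      have "(\<delta> * \<eta>) * L / \<gamma> \<le> \<delta> * L / \<gamma>"
        using de L_pos gamma_pos by (intro divide_right_mono mult_right_mono) auto
      moreover have "(\<delta> * \<eta>) * \<gamma> \<le> h" unfolding h_def using de gamma_pos by (intro mult_right_mono) auto
      ultimately show ?thesis using e Y by (intro mult_right_mono) auto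
    qed
    also have "\<dots> \<le> (- (\<delta> * m / \<gamma>) + h\<^sup>2) * Y"
    proof -
      have "\<delta> * m / \<gamma> \<le> \<delta> * L / \<gamma>"
        using m_le_L delta_pos gamma_pos by (intro divide_right_mono) auto
      moreover have "2 * A - 2 * (h - q / 2) + h \<le> - B + q" if "B \<le> A" "A \<le> h / 4" for A B q :: real
        using that h(1) by (simp add: right_diff_distrib)
      ultimately have "2 * (\<delta> * L / \<gamma>) - 2 * (h - h\<^sup>2 / 2) + h \<le> - (\<delta> * m / \<gamma>) + h\<^sup>2"
        using dLg by blast
      then show ?thesis using Y by (intro mult_right_mono) auto
    qed
    also have "\<dots> \<le> - (\<delta> * m / \<gamma> * Y) + h\<^sup>2 * N\<^sup>2"
      using Y mult_left_mono[OF Y(2), of "h\<^sup>2"] by (simp add: algebra_simps)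
    finally show ?thesis by (simp add: Y_def E_def)
  qed
  \<comment> \<open>Budget of errors: 9 (\<open>quad\<close>), 1/2 (\<open>T1\<close>), 1/2
    (\<open>T3\<close>), 1/8 (\<open>T5\<close>), 3/8 (\<open>S\<close>) and 1 (\<open>V\<close>)
    add up to 23/2.\<close>
  have "(nb (x1, v1))\<^sup>2 - (nb (x, v))\<^sup>2 \<le> 23 / 2 * E - \<delta> * m / \<gamma> * N\<^sup>2"
  proof -
    have 1: "2 * \<delta> * \<eta> / \<gamma> * (x \<bullet> w) = 2 * DS - 2 * \<delta> * \<eta> / \<gamma> * (a \<bullet> w1) / 2"
      unfolding xw DS_def by (simp add: right_diff_distrib)
    have 2: "\<delta> * m / \<gamma> * N\<^sup>2 = \<delta> * m / \<gamma> * (norm x)\<^sup>2 + \<delta> * m / \<gamma> * ((norm v)\<^sup>2 / L)"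
      unfolding N2 by (simp add: distrib_left)
    have "2 * (x \<bullet> a) + 2 / \<gamma> * (x \<bullet> b + a \<bullet> v) + 2 / L * (v \<bullet> b)
      \<le> 1 / 2 * E + 1 / 2 * E + 1 / 8 * E - DS + VV"
      using 1 T1 T2 T3 T5 T7 VV_def unfolding lin by linarith
    then show ?thesis using expand quad S V 2 by linarith
  qed
  \<comment> \<open>As 23/66 is below 1/2, half of the dissipation survives; the factor 3/2 of
    \<open>nb_sq_le\<close> then turns \<open>m / (2 * \<gamma>)\<close> into \<kappa>.\<close>
  also have "\<dots> \<le> 23 / 2 * (\<delta> * m / (33 * \<gamma>) * N\<^sup>2) - \<delta> * m / \<gamma> * N\<^sup>2"
    unfolding E_def using h(3) by (intro diff_right_mono mult_left_mono mult_right_mono) auto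
  also have "\<dots> \<le> - (1 / 2) * (\<delta> * m / \<gamma> * N\<^sup>2)"
  proof -
    have "0 \<le> \<delta> * m / \<gamma> * N\<^sup>2" using delta_pos m_pos gamma_pos by simp
    then show ?thesis by (simp add: algebra_simps)
  qed
  also have "\<dots> = - (\<delta> * \<kappa> * (3 / 2 * N\<^sup>2))"
    by (simp add: \<kappa>_def kappa_def)
  also have "\<dots> \<le> - (\<delta> * \<kappa> * (nb (x, v))\<^sup>2)"
    using nb_sq_le[of "(x, v)"] delta_pos kappa_pos by (simp add: N2 mult_left_mono)
  finally show ?thesis by (simp add: algebra_simps)
qed

end

section \<open>The Hamiltonian flow as a limit of Verlet steps\<close>

context obabo
begin

section \<open>A single Verlet step: stability, local error, energy error\<close>

definition verlet :: "real \<Rightarrow> 'a \<times> 'a \<Rightarrow> 'a \<times> 'a" where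
  "verlet h z = (let p = snd z - (h / 2) *\<^sub>R g (fst z); x = fst z + h *\<^sub>R p in (x, p - (h / 2) *\<^sub>R g x))"

text \<open>This is \<omega> times the upper bound of \<open>nb\<close> in \<open>nb_le\<close>, in
  units of velocity.\<close>

definition nu :: "'a \<times> 'a \<Rightarrow> real" where
  "nu z = \<omega> * norm (fst z) + norm (snd z)"

text \<open>A bound for the speeds met while a time \<theta> is still to run: the velocity plus the
  kick that the present force would give in that time.\<close>

definition psi :: "real \<Rightarrow> 'a \<times> 'a \<Rightarrow> real" where
  "psi \<theta> z = norm (snd z) + \<theta> * norm (g (fst z))"

definition energy :: "'a \<times> 'a \<Rightarrow> real" where
  "energy z = U (fst z) + (norm (snd z))\<^sup>2 / 2"

lemma psi_nonneg: "0 \<le> \<theta> \<Longrightarrow> 0 \<le> psi \<theta> z" by (simp add: psi_def)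

lemma nu_nonneg: "0 \<le> nu z" using omega_pos by (simp add: nu_def)

lemma nu_triangle: "nu (z + w) \<le> nu z + nu w"
proof -
  have "\<omega> * norm (fst z + fst w) \<le> \<omega> * (norm (fst z) + norm (fst w))"
    using omega_pos by (intro mult_left_mono norm_triangle_ineq) auto
  then show ?thesis
    using norm_triangle_ineq[of "snd z" "snd w"] by (simp add: nu_def distrib_left)
qed

lemma nu_diff_triangle: "nu (a - c) \<le> nu (a - b) + nu (b - c)"
  using nu_triangle[of "a - b" "b - c"] by simp

lemma continuous_nu: "continuous_on UNIV nu"
  unfolding nu_def by (intro continuous_intros)

lemma continuous_verlet: "continuous_on UNIV (verlet h)"
  unfolding verlet_def Let_def
  by (intro continuous_intros continuous_on_compose2[OF continuous_g]) auto

lemma L_h_sq_le: "0 \<le> h \<Longrightarrow> h \<le> \<delta> \<Longrightarrow> L * h\<^sup>2 \<le> 1 / 10000"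
  and omega_h_le: "0 \<le> h \<Longrightarrow> h \<le> \<delta> \<Longrightarrow> \<omega> * h \<le> 1 / 264"
proof -
  assume h: "0 \<le> h" "h \<le> \<delta>"
  have "\<omega> * h \<le> (\<gamma> / 2) * \<delta>"
    using omega_le omega_pos h by (intro mult_mono) auto
  then show *: "\<omega> * h \<le> 1 / 264" using h_le by (simp add: mult.commute)
  have "L * h\<^sup>2 = (\<omega> * h)\<^sup>2" by (simp add: power_mult_distrib omega_sq)
  also have "\<dots> \<le> (1 / 264)\<^sup>2" using * omega_pos h by (intro power_mono) auto
  finally show "L * h\<^sup>2 \<le> 1 / 10000" by (simp add: power2_eq_square)
qed

text \<open>The exponential form of the constant matters: it is reproduced exactly when a step is
  replaced by two steps of half the length.\<close>

lemma verlet_lipschitz: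
  assumes h: "0 \<le> h" "h \<le> \<delta>"
  shows "nu (verlet h z - verlet h z') \<le> exp (2 * \<omega> * h) * nu (z - z')"
proof -
  define a where "a = \<omega> * h"
  define p p' where "p = snd z - (h / 2) *\<^sub>R g (fst z)" and "p' = snd z' - (h / 2) *\<^sub>R g (fst z')"
  define x x' where "x = fst z + h *\<^sub>R p" and "x' = fst z' + h *\<^sub>R p'"
  define A B P X where "A = \<omega> * norm (fst z - fst z')" and "B = norm (snd z - snd z')"
    and "P = norm (p - p')" and "X = \<omega> * norm (x - x')"
  have a: "0 \<le> a" "a \<le> 1" using omega_h_le[OF h] omega_pos h by (auto simp: a_def)
  have hL: "h / 2 * (L * r) = a / 2 * (\<omega> * r)" for r
  proof -
    have "a / 2 * (\<omega> * r) = h / 2 * ((\<omega> * \<omega>) * r)" by (simp add: a_def)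
    then show ?thesis unfolding omega_mult by (rule sym)
  qed
  have dg: "h / 2 * norm (g y - g y') \<le> a / 2 * (\<omega> * norm (y - y'))" for y y'
  proof -
    have "h / 2 * norm (g y - g y') \<le> h / 2 * (L * norm (y - y'))"
      using lip h by (intro mult_left_mono) auto
    then show ?thesis unfolding hL .
  qed
  have "P \<le> B + norm ((h / 2) *\<^sub>R (g (fst z) - g (fst z')))"
  proof -
    have "p - p' = (snd z - snd z') - (h / 2) *\<^sub>R (g (fst z) - g (fst z'))"
      by (simp add: p_def p'_def algebra_simps)
    then show ?thesis unfolding P_def B_def using norm_triangle_ineq4 by metis
  qed
  then have P: "P \<le> B + a / 2 * A"
    using dg[of "fst z" "fst z'"] h by (simp add: A_def)
  have "norm (x - x') \<le> norm (fst z - fst z') + norm (h *\<^sub>R (p - p'))"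
  proof -
    have "x - x' = (fst z - fst z') + h *\<^sub>R (p - p')" by (simp add: x_def x'_def algebra_simps)
    then show ?thesis using norm_triangle_ineq by metis
  qed
  then have X: "X \<le> A + a * P"
    using mult_left_mono[of "norm (x - x')" "norm (fst z - fst z') + h * P" \<omega>] omega_pos h
    by (simp add: X_def A_def P_def a_def distrib_left)
  have "norm ((p - (h / 2) *\<^sub>R g x) - (p' - (h / 2) *\<^sub>R g x')) \<le> P + norm ((h / 2) *\<^sub>R (g x - g x'))"
  proof -
    have "(p - (h / 2) *\<^sub>R g x) - (p' - (h / 2) *\<^sub>R g x') = (p - p') - (h / 2) *\<^sub>R (g x - g x')"
      by (simp add: algebra_simps)
    then show ?thesis unfolding P_def using norm_triangle_ineq4 by metis
  qed
  then have V: "norm ((p - (h / 2) *\<^sub>R g x) - (p' - (h / 2) *\<^sub>R g x')) \<le> P + a / 2 * X"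
    using dg[of x x'] h by (simp add: X_def)
  have AB: "0 \<le> A" "0 \<le> B" using omega_pos by (auto simp: A_def B_def)
  have "nu (verlet h z - verlet h z') \<le> X + (P + a / 2 * X)"
    using V by (simp add: nu_def verlet_def Let_def p_def[symmetric] p'_def[symmetric] x_def[symmetric] x'_def[symmetric] X_def)
  also have "\<dots> = (1 + a / 2) * X + P" by (simp add: algebra_simps)
  also have "\<dots> \<le> (1 + a / 2) * (A + a * P) + P"
    using X a by (intro add_right_mono mult_left_mono) auto
  also have "\<dots> = (1 + a / 2) * A + (1 + a + a\<^sup>2 / 2) * P" by (simp add: algebra_simps power2_eq_square)
  also have "\<dots> \<le> (1 + a / 2) * A + (1 + a + a\<^sup>2 / 2) * (B + a / 2 * A)"
    using P a by (intro add_left_mono mult_left_mono) auto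
  also have "\<dots> = (1 + a + (a * a / 2 + a * a * a / 4)) * A + (1 + a + a * a / 2) * B"
    by (simp add: algebra_simps power2_eq_square)
  also have "\<dots> \<le> (1 + 2 * a) * A + (1 + 2 * a) * B"
  proof -
    have "a * a \<le> a" using a mult_left_le by blast
    moreover have "a * a * a \<le> a" using a calculation mult_left_le[of a "a * a"] by simp
    ultimately have "1 + a + (a * a / 2 + a * a * a / 4) \<le> 1 + 2 * a" "1 + a + a * a / 2 \<le> 1 + 2 * a"
      using a by linarith+
    then show ?thesis using AB by (intro add_mono[OF mult_right_mono mult_right_mono])
  qed
  also have "\<dots> = (1 + 2 * a) * nu (z - z')" by (simp add: nu_def A_def B_def algebra_simps)
  also have "\<dots> \<le> exp (2 * a) * nu (z - z')"
    using exp_ge_add_one_self[of "2 * a"] nu_nonneg by (intro mult_right_mono) auto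
  finally show ?thesis by (simp add: a_def mult.assoc)
qed

lemma norm_half_kick_le:
  assumes "0 \<le> h" "h \<le> \<theta>"
  shows "norm (snd z - (h / 2) *\<^sub>R g (fst z)) \<le> psi \<theta> z"
proof -
  have "norm (snd z - (h / 2) *\<^sub>R g (fst z)) \<le> norm (snd z) + norm ((h / 2) *\<^sub>R g (fst z))"
    by (rule norm_triangle_ineq4)
  also have "\<dots> = norm (snd z) + h / 2 * norm (g (fst z))"
    using assms by simp
  also have "\<dots> \<le> psi \<theta> z"
    unfolding psi_def using assms by (intro add_left_mono mult_right_mono) auto
  finally show ?thesis .
qed

lemma norm_g_shift_le: "0 \<le> h \<Longrightarrow> norm (g (x + h *\<^sub>R p)) \<le> norm (g x) + L * (h * norm p)"
  using norm_triangle_ineq2[of "g (x + h *\<^sub>R p)" "g x"] lip[of "x + h *\<^sub>R p" x] by simp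

text \<open>The remaining time shrinks by the time used. The kicks move force of total weight
  \<open>h\<close> from the budget into the velocity, so the force present at the start is not
  counted twice; only its variation along the drift costs a factor, again in exponential
  form.\<close>

lemma psi_verlet:
  assumes h: "0 \<le> h" "h \<le> \<theta>" "\<theta> \<le> \<delta>"
  shows "psi (\<theta> - h) (verlet h z) \<le> exp (L * \<delta> * h) * psi \<theta> z"
proof -
  define p where "p = snd z - (h / 2) *\<^sub>R g (fst z)"
  define g0 g1 where "g0 = g (fst z)" and "g1 = g (fst z + h *\<^sub>R p)"
  have p: "norm p \<le> psi \<theta> z"
    unfolding p_def using h by (intro norm_half_kick_le)
  have psi: "0 \<le> psi \<theta> z" using h by (intro psi_nonneg) auto
  have "norm g1 \<le> norm g0 + L * (h * norm p)"
    unfolding g1_def g0_def using h by (intro norm_g_shift_le)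
  also have "\<dots> \<le> norm g0 + L * (h * psi \<theta> z)"
    using p h L_pos by (intro add_left_mono mult_left_mono) auto
  finally have g1: "(\<theta> - h / 2) * norm g1 \<le> (\<theta> - h / 2) * (norm g0 + L * (h * psi \<theta> z))"
    using h by (intro mult_left_mono) auto
  have "norm (p - (h / 2) *\<^sub>R g1) \<le> norm (snd z) + norm ((h / 2) *\<^sub>R g0) + norm ((h / 2) *\<^sub>R g1)"
    using norm_triangle_ineq4[of p "(h / 2) *\<^sub>R g1"] norm_triangle_ineq4[of "snd z" "(h / 2) *\<^sub>R g0"]
    by (simp add: p_def g0_def)
  then have v: "norm (p - (h / 2) *\<^sub>R g1) \<le> norm (snd z) + h / 2 * norm g0 + h / 2 * norm g1"
    using h by simp
  have "psi (\<theta> - h) (verlet h z) = norm (p - (h / 2) *\<^sub>R g1) + (\<theta> - h) * norm g1"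
    by (simp add: psi_def verlet_def Let_def p_def[symmetric] g1_def)
  also have "\<dots> \<le> norm (snd z) + h / 2 * norm g0 + (\<theta> - h / 2) * norm g1"
    using v by (simp add: left_diff_distrib)
  also have "\<dots> \<le> norm (snd z) + h / 2 * norm g0 + (\<theta> - h / 2) * (norm g0 + L * (h * psi \<theta> z))"
    using g1 by simp
  also have "\<dots> = psi \<theta> z + (\<theta> - h / 2) * (L * (h * psi \<theta> z))"
    by (simp add: psi_def g0_def algebra_simps)
  also have "\<dots> \<le> psi \<theta> z + \<delta> * (L * (h * psi \<theta> z))"
    using h psi L_pos by (intro add_left_mono mult_right_mono) auto
  also have "\<dots> = (1 + L * \<delta> * h) * psi \<theta> z" by (simp add: algebra_simps)
  also have "\<dots> \<le> exp (L * \<delta> * h) * psi \<theta> z"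
    using psi by (intro mult_right_mono exp_ge_add_one_self) auto
  finally show ?thesis .
qed

text \<open>Both schemes apply kicks of the same total weight and differ in where the force is
  evaluated. With \<open>q = h / 2\<close> the Lipschitz bound gives a velocity error of order
  \<open>L * q\<^sup>2\<close> and a position error of order \<open>L * q ^ 3\<close>.\<close>

lemma verlet_halving_error:
  assumes h: "0 \<le> h" "h \<le> \<theta>" "\<theta> \<le> \<delta>"
  shows "nu (verlet (h / 2) (verlet (h / 2) z) - verlet h z) \<le> 101 / 400 * L * h\<^sup>2 * psi \<theta> z"
proof -
  define q where "q = h / 2"
  have hq: "h = 2 * q" by (simp add: q_def)
  define p' where "p' = snd z - (q / 2) *\<^sub>R g (fst z)"
  define y where "y = fst z + q *\<^sub>R p'"
  define p'' where "p'' = p' - q *\<^sub>R g y"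
  define y1 where "y1 = y + q *\<^sub>R p''"
  define x1 where "x1 = fst z + h *\<^sub>R (snd z - q *\<^sub>R g (fst z))"
  define v1 where "v1 = snd z - q *\<^sub>R g (fst z) - q *\<^sub>R g x1"
  define v' where "v' = p'' - (q / 2) *\<^sub>R g y1"
  define S where "S = psi \<theta> z"
  have q: "0 \<le> q" "q \<le> \<delta>" "q \<le> \<theta>" using h by (auto simp: q_def)
  have S0: "0 \<le> S" using psi_nonneg h by (simp add: S_def)
  have Lq: "L * q\<^sup>2 \<le> 1 / 10000" and oq: "\<omega> * q \<le> 1 / 264" using L_h_sq_le[OF q(1,2)] omega_h_le[OF q(1,2)] .
  have e1: "verlet (h / 2) (verlet (h / 2) z) = (y1, v')"
  proof -
    have "p' - (q / 2) *\<^sub>R g y - (q / 2) *\<^sub>R g y = p''"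
      unfolding p''_def by (simp add: diff_diff_add flip: scaleR_add_left)
    then show ?thesis
      unfolding q_def[symmetric] verlet_def Let_def by (simp add: p'_def[symmetric] y_def[symmetric] y1_def v'_def)
  qed
  have e2: "verlet h z = (x1, v1)"
    unfolding verlet_def Let_def q_def[symmetric] by (simp add: x1_def v1_def)
  have p'S: "norm p' \<le> S" unfolding p'_def S_def using q by (intro norm_half_kick_le)
  have "norm p'' \<le> (1 + L * q\<^sup>2) * S"
  proof -
    have "norm p'' \<le> norm p' + norm (q *\<^sub>R g y)" unfolding p''_def by (rule norm_triangle_ineq4)
    also have "\<dots> \<le> (norm (snd z) + q / 2 * norm (g (fst z))) + q * (norm (g (fst z)) + L * (q * norm p'))"
    proof (intro add_mono)
      show "norm p' \<le> norm (snd z) + q / 2 * norm (g (fst z))"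
        using norm_triangle_ineq4[of "snd z" "(q / 2) *\<^sub>R g (fst z)"] q by (simp add: p'_def)
      show "norm (q *\<^sub>R g y) \<le> q * (norm (g (fst z)) + L * (q * norm p'))"
        using mult_left_mono[OF norm_g_shift_le[OF q(1), of "fst z" p'], of q] q by (simp add: y_def)
    qed
    also have "\<dots> = (norm (snd z) + 3 / 2 * q * norm (g (fst z))) + L * q\<^sup>2 * norm p'"
      by (simp add: algebra_simps power2_eq_square)
    also have "\<dots> \<le> S + L * q\<^sup>2 * S"
    proof (intro add_mono)
      show "norm (snd z) + 3 / 2 * q * norm (g (fst z)) \<le> S"
        unfolding S_def psi_def using q h hq by (intro add_left_mono mult_right_mono) auto
      show "L * q\<^sup>2 * norm p' \<le> L * q\<^sup>2 * S" using p'S L_pos by (intro mult_left_mono) auto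
    qed
    finally show ?thesis by (simp add: algebra_simps)
  qed
  then have p''S: "norm p'' \<le> 10001 / 10000 * S"
    using mult_right_mono[OF _ S0, of "1 + L * q\<^sup>2" "10001 / 10000"] Lq by simp
  have gy: "norm (g y - g (fst z)) \<le> L * (q * S)"
  proof -
    have "norm (g y - g (fst z)) \<le> L * norm (y - fst z)" by (rule lip)
    also have "\<dots> \<le> L * (q * S)" using p'S q L_pos by (intro mult_left_mono) (auto simp: y_def mult_left_mono)
    finally show ?thesis .
  qed
  have gy1: "norm (g y - g y1) \<le> L * (q * (10001 / 10000 * S))"
  proof -
    have "norm (g y - g y1) \<le> L * norm (y - y1)" by (rule lip)
    also have "norm (y - y1) = q * norm p''" using q by (simp add: y1_def)
    also have "L * (q * norm p'') \<le> L * (q * (10001 / 10000 * S))"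
      using p''S q L_pos by (intro mult_left_mono) auto
    finally show ?thesis .
  qed
  have xd: "y1 - x1 = q\<^sup>2 *\<^sub>R (g (fst z) - g y)"
    unfolding y1_def y_def x1_def p''_def p'_def hq
    by (rule euclidean_eqI)
      (simp add: inner_add_left inner_diff_left algebra_simps power2_eq_square)
  have xn: "norm (y1 - x1) \<le> q\<^sup>2 * (L * (q * S))"
    unfolding xd using gy by (simp add: norm_minus_commute mult_left_mono)
  have vd: "v1 - v' = (q / 2) *\<^sub>R (g y - g (fst z)) + (q / 2) *\<^sub>R (g y - g y1) + q *\<^sub>R (g y1 - g x1)"
    unfolding v1_def v'_def p''_def p'_def
    by (simp add: algebra_simps) (simp add: scaleR_2[symmetric] scaleR_left_distrib[symmetric] diff_diff_add)
  have vn: "norm (v' - v1) \<le> q / 2 * (L * (q * S)) + q / 2 * (L * (q * (10001 / 10000 * S))) + q * (L * (q\<^sup>2 * (L * (q * S))))"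
  proof -
    have "norm (v' - v1) \<le> norm ((q / 2) *\<^sub>R (g y - g (fst z))) + norm ((q / 2) *\<^sub>R (g y - g y1)) + norm (q *\<^sub>R (g y1 - g x1))"
      unfolding norm_minus_commute[of v' v1] vd
      by (intro order_trans[OF norm_triangle_ineq] add_right_mono norm_triangle_ineq)
    also have "\<dots> \<le> q / 2 * (L * (q * S)) + q / 2 * (L * (q * (10001 / 10000 * S))) + q * (L * (q\<^sup>2 * (L * (q * S))))"
    proof (intro add_mono)
      show "norm ((q / 2) *\<^sub>R (g y - g (fst z))) \<le> q / 2 * (L * (q * S))"
        using mult_left_mono[OF gy, of "q / 2"] q by simp
      show "norm ((q / 2) *\<^sub>R (g y - g y1)) \<le> q / 2 * (L * (q * (10001 / 10000 * S)))"
        using mult_left_mono[OF gy1, of "q / 2"] q by simp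
      have "norm (g y1 - g x1) \<le> L * (q\<^sup>2 * (L * (q * S)))"
        using order_trans[OF lip[of y1 x1] mult_left_mono[OF xn, of L]] L_pos by simp
      then show "norm (q *\<^sub>R (g y1 - g x1)) \<le> q * (L * (q\<^sup>2 * (L * (q * S))))"
        using q by (simp add: mult_left_mono)
    qed
    finally show ?thesis .
  qed
  have "nu (verlet (h / 2) (verlet (h / 2) z) - verlet h z) = \<omega> * norm (y1 - x1) + norm (v' - v1)"
    unfolding e1 e2 by (simp add: nu_def)
  also have "\<dots> \<le> \<omega> * (q\<^sup>2 * (L * (q * S))) +
      (q / 2 * (L * (q * S)) + q / 2 * (L * (q * (10001 / 10000 * S))) + q * (L * (q\<^sup>2 * (L * (q * S)))))"
    using xn vn omega_pos by (intro add_mono mult_left_mono) auto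
  also have "\<dots> = (\<omega> * q + 20001 / 20000 + L * q\<^sup>2) * (L * q\<^sup>2 * S)"
    by (simp add: algebra_simps power2_eq_square)
  \<comment> \<open>The bracket is at most 1/264 + 20001/20000 + 1/10000; with
    \<open>q\<^sup>2 = h\<^sup>2 / 4\<close> this becomes 101/400.\<close>
  also have "\<dots> \<le> (101 / 100) * (L * q\<^sup>2 * S)"
    using Lq oq S0 L_pos by (intro mult_right_mono) auto
  also have "\<dots> = 101 / 400 * L * h\<^sup>2 * S" by (simp add: hq power2_eq_square)
  finally show ?thesis by (simp add: S_def)
qed

lemma energy_verlet_error:
  fixes h z
  defines "p \<equiv> snd z - (h / 2) *\<^sub>R g (fst z)"
  assumes h: "0 \<le> h"
  shows "\<bar>energy (verlet h z) - energy z\<bar>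
    \<le> L * h\<^sup>2 / 8 * ((1 + L * h\<^sup>2) * (norm p)\<^sup>2 + 2 * h * (norm p * norm (g (fst z))))"
proof -
  define x0 x1 where "x0 = fst z" and "x1 = fst z + h *\<^sub>R p"
  define g0 g1 where "g0 = g x0" and "g1 = g x1"
  define err where "err = U x1 - U x0 - ((g0 + g1) \<bullet> (x1 - x0)) / 2"
  have err: "\<bar>err\<bar> \<le> L / 8 * (h * norm p)\<^sup>2"
    using trapezoid_error[of x1 x0] h by (simp add: err_def g0_def g1_def x0_def x1_def)
  have v: "snd z = p + (h / 2) *\<^sub>R g0" by (simp add: p_def g0_def x0_def)
  \<comment> \<open>With the half-kicked momentum \<open>p\<close> common to both ends, the
    first-order part of the change of kinetic energy is exactly the trapezoidal rule for the
    potential; what remains is its error and the difference of the squared forces.\<close>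
  have e: "energy (verlet h z) - energy z = err + h\<^sup>2 / 8 * ((norm g1)\<^sup>2 - (norm g0)\<^sup>2)"
  proof -
    have "energy (verlet h z) - energy z = U x1 - U x0 + ((norm (p - (h / 2) *\<^sub>R g1))\<^sup>2 - (norm (p + (h / 2) *\<^sub>R g0))\<^sup>2) / 2"
      unfolding energy_def v[symmetric]
      by (simp add: verlet_def Let_def p_def[symmetric] x1_def[symmetric] g1_def x0_def diff_divide_distrib)
    also have "(norm (p - (h / 2) *\<^sub>R g1))\<^sup>2 - (norm (p + (h / 2) *\<^sub>R g0))\<^sup>2
       = - ((g0 + g1) \<bullet> (h *\<^sub>R p)) + h\<^sup>2 / 4 * ((norm g1)\<^sup>2 - (norm g0)\<^sup>2)"
      unfolding power2_norm_eq_inner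
      by (simp add: inner_add_left inner_add_right inner_diff_left inner_diff_right inner_commute
          power2_eq_square algebra_simps)
    finally show ?thesis by (simp add: err_def x1_def x0_def)
  qed
  have d: "norm (g1 - g0) \<le> L * (h * norm p)"
    using lip[of x1 x0] h by (simp add: g1_def g0_def x1_def x0_def)
  have "\<bar>(norm g1)\<^sup>2 - (norm g0)\<^sup>2\<bar> \<le> (L * (h * norm p)) * (2 * norm g0 + L * (h * norm p))"
  proof -
    have "\<bar>(norm g1)\<^sup>2 - (norm g0)\<^sup>2\<bar> = \<bar>norm g1 - norm g0\<bar> * (norm g1 + norm g0)"
    proof -
      have "(norm g1)\<^sup>2 - (norm g0)\<^sup>2 = (norm g1 - norm g0) * (norm g1 + norm g0)"
        by (simp add: power2_eq_square algebra_simps)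
      then show ?thesis by (simp add: abs_mult)
    qed
    also have "\<dots> \<le> (L * (h * norm p)) * (2 * norm g0 + L * (h * norm p))"
      using d norm_triangle_ineq3[of g1 g0] norm_triangle_ineq2[of g1 g0] L_pos h
      by (intro mult_mono) auto
    finally show ?thesis .
  qed
  then have "h\<^sup>2 / 8 * \<bar>(norm g1)\<^sup>2 - (norm g0)\<^sup>2\<bar>
      \<le> h\<^sup>2 / 8 * ((L * (h * norm p)) * (2 * norm g0 + L * (h * norm p)))"
    by (intro mult_left_mono) auto
  then have "\<bar>energy (verlet h z) - energy z\<bar> \<le> L / 8 * (h * norm p)\<^sup>2 + h\<^sup>2 / 8 * ((L * (h * norm p)) * (2 * norm g0 + L * (h * norm p)))"
    using err unfolding e by (intro order_trans[OF abs_triangle_ineq] add_mono) (auto simp: abs_mult)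
  also have "\<dots> = L * h\<^sup>2 / 8 * ((1 + L * h\<^sup>2) * (norm p)\<^sup>2 + 2 * h * (norm p * norm g0))"
    by (simp add: algebra_simps power2_eq_square)
  finally show ?thesis by (simp add: g0_def x0_def)
qed

lemma energy_verlet_psi:
  assumes h: "0 \<le> h" "h \<le> \<theta>" "\<theta> \<le> \<delta>"
  shows "\<bar>energy (verlet h z) - energy z\<bar> \<le> L * h\<^sup>2 * (psi \<theta> z)\<^sup>2"
proof -
  define p where "p = snd z - (h / 2) *\<^sub>R g (fst z)"
  define S where "S = psi \<theta> z"
  have S0: "0 \<le> S" using psi_nonneg h by (simp add: S_def)
  have p: "norm p \<le> S" unfolding p_def S_def using h by (intro norm_half_kick_le)
  have gS: "h * norm (g (fst z)) \<le> S"
  proof -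
    have "h * norm (g (fst z)) \<le> \<theta> * norm (g (fst z))" using h by (intro mult_right_mono) auto
    then show ?thesis unfolding S_def psi_def using norm_ge_zero[of "snd z"] by linarith
  qed
  have 1: "(1 + L * h\<^sup>2) * (norm p)\<^sup>2 \<le> 2 * S\<^sup>2"
    using L_h_sq_le[of h] h p L_pos by (intro mult_mono power_mono) auto
  have 2: "norm p * (h * norm (g (fst z))) \<le> S * S"
    using p gS S0 h by (intro mult_mono) auto
  have "\<bar>energy (verlet h z) - energy z\<bar> \<le> L * h\<^sup>2 / 8 * ((1 + L * h\<^sup>2) * (norm p)\<^sup>2 + 2 * h * (norm p * norm (g (fst z))))"
    unfolding p_def using h(1) by (rule energy_verlet_error)
  also have "\<dots> \<le> L * h\<^sup>2 / 8 * (8 * S\<^sup>2)"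
  proof (rule mult_left_mono)
    have "2 * h * (norm p * norm (g (fst z))) = 2 * (norm p * (h * norm (g (fst z))))" by simp
    moreover have "0 \<le> S\<^sup>2" by simp
    ultimately show "(1 + L * h\<^sup>2) * (norm p)\<^sup>2 + 2 * h * (norm p * norm (g (fst z))) \<le> 8 * S\<^sup>2"
      using 1 2 unfolding power2_eq_square[of S] by linarith
  qed (use L_pos in auto)
  finally show ?thesis by (simp add: S_def)
qed

section \<open>Repeated halving of the step and passage to the limit\<close>

fun flow :: "nat \<Rightarrow> real \<Rightarrow> 'a \<times> 'a \<Rightarrow> 'a \<times> 'a" where
  "flow 0 h = verlet h"
| "flow (Suc k) h = flow k (h / 2) \<circ> flow k (h / 2)"

lemma continuous_flow: "continuous_on UNIV (flow k h)"
proof (induction k arbitrary: h)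
  case (Suc k)
  show ?case
    unfolding flow.simps using Suc by (intro continuous_on_compose continuous_on_subset[OF Suc]) auto
qed (simp add: continuous_verlet)

lemma measurable_flow [measurable]: "flow k h \<in> borel_measurable borel"
  using continuous_flow by (rule borel_measurable_continuous_onI)

lemma flow_lipschitz:
  assumes "0 \<le> h" "h \<le> \<delta>"
  shows "nu (flow k h z - flow k h z') \<le> exp (2 * \<omega> * h) * nu (z - z')"
  using assms
proof (induction k arbitrary: h z z')
  case 0
  then show ?case by (simp add: verlet_lipschitz)
next
  case (Suc k)
  have "nu (flow (Suc k) h z - flow (Suc k) h z')
      \<le> exp (2 * \<omega> * (h / 2)) * nu (flow k (h / 2) z - flow k (h / 2) z')"
    using Suc.prems Suc.IH[of "h / 2" "flow k (h / 2) z" "flow k (h / 2) z'"] by simp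
  also have "\<dots> \<le> exp (2 * \<omega> * (h / 2)) * (exp (2 * \<omega> * (h / 2)) * nu (z - z'))"
    using Suc.prems by (intro mult_left_mono Suc.IH) auto
  also have "\<dots> = exp (2 * \<omega> * h) * nu (z - z')"
    by (simp add: exp_add[symmetric] mult.assoc[symmetric])
  finally show ?case .
qed

lemma psi_flow:
  assumes "0 \<le> h" "h \<le> \<theta>" "\<theta> \<le> \<delta>"
  shows "psi (\<theta> - h) (flow k h z) \<le> exp (L * \<delta> * h) * psi \<theta> z"
  using assms
proof (induction k arbitrary: h \<theta> z)
  case 0
  then show ?case by (simp add: psi_verlet)
next
  case (Suc k)
  have "psi (\<theta> - h / 2 - h / 2) (flow k (h / 2) (flow k (h / 2) z))
      \<le> exp (L * \<delta> * (h / 2)) * psi (\<theta> - h / 2) (flow k (h / 2) z)"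
    using Suc.prems by (intro Suc.IH) auto
  also have "\<dots> \<le> exp (L * \<delta> * (h / 2)) * (exp (L * \<delta> * (h / 2)) * psi \<theta> z)"
    using Suc.prems by (intro mult_left_mono Suc.IH) auto
  also have "\<dots> = exp (L * \<delta> * h) * psi \<theta> z"
    by (simp add: exp_add[symmetric] mult.assoc[symmetric])
  finally show ?case by simp
qed

text \<open>Doubling the number of steps while dividing the squared length by 4 gains a factor 1/2
  per level. The induction splits \<open>F (F z) - G (G z)\<close> at \<open>G (F z)\<close>: the
  first part is the hypothesis started at \<open>F z\<close>, controlled by \<open>psi_flow\<close>,
  the second is stability of \<open>G\<close>.\<close>

lemma flow_Suc_diff:
  assumes "0 \<le> h" "h \<le> \<theta>" "\<theta> \<le> \<delta>"
  shows "nu (flow (Suc k) h z - flow k h z)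
    \<le> exp (2 * \<omega> * h) * exp (L * \<delta> * h) * (101 / 400 * L * h\<^sup>2 * (1 / 2) ^ k) * psi \<theta> z"
  using assms
proof (induction k arbitrary: h \<theta> z)
  case 0
  have "nu (flow (Suc 0) h z - flow 0 h z) \<le> 1 * (101 / 400 * L * h\<^sup>2 * psi \<theta> z)"
    using verlet_halving_error[OF 0] by simp
  also have "\<dots> \<le> (exp (2 * \<omega> * h) * exp (L * \<delta> * h)) * (101 / 400 * L * h\<^sup>2 * psi \<theta> z)"
    using 0 omega_pos L_pos delta_pos psi_nonneg[of \<theta> z]
    by (intro mult_right_mono) (auto simp flip: exp_add)
  finally show ?case by simp
next
  case (Suc k)
  define q where "q = h / 2"
  have q: "0 \<le> q" "q \<le> \<theta>" "q \<le> \<theta> - q" "\<theta> - q \<le> \<delta>" "q \<le> \<delta>" using Suc.prems by (auto simp: q_def)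
  define c where "c = 101 / 400 * L * q\<^sup>2 * (1 / 2) ^ k"
  define e1 e2 where "e1 = exp (2 * \<omega> * q)" and "e2 = exp (L * \<delta> * q)"
  define S where "S = psi \<theta> z"
  have pos: "0 \<le> c" "1 \<le> e1" "1 \<le> e2" "0 \<le> S"
    using L_pos q omega_pos delta_pos Suc.prems by (auto simp: c_def e1_def e2_def S_def psi_nonneg)
  let ?F = "flow (Suc k) q" and ?G = "flow k q"
  have "nu (flow (Suc (Suc k)) h z - flow (Suc k) h z) = nu (?F (?F z) - ?G (?G z))"
    by (simp add: q_def)
  also have "\<dots> \<le> nu (?F (?F z) - ?G (?F z)) + nu (?G (?F z) - ?G (?G z))"
    by (rule nu_diff_triangle)
  also have "\<dots> \<le> e1 * e2 * c * psi (\<theta> - q) (?F z) + e1 * nu (?F z - ?G z)"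
    unfolding c_def e1_def e2_def using q Suc.prems
    by (intro add_mono Suc.IH flow_lipschitz) auto
  also have "\<dots> \<le> e1 * e2 * c * (e2 * S) + e1 * (e1 * e2 * c * S)"
  proof (intro add_mono mult_left_mono)
    show "psi (\<theta> - q) (?F z) \<le> e2 * S"
      unfolding e2_def S_def using q Suc.prems by (intro psi_flow) auto
    show "nu (?F z - ?G z) \<le> e1 * e2 * c * S"
      unfolding c_def e1_def e2_def S_def using q Suc.prems by (intro Suc.IH) auto
  qed (use pos in auto)
  \<comment> \<open>Each summand lacks one of the factors \<open>e1\<close>, \<open>e2\<close>, both
    at least 1; inserting it makes the summands equal and rebuilds the exponentials of the full
    time.\<close>
  also have "\<dots> \<le> e1 * e2 * c * (e2 * S) * e1 + e1 * (e1 * e2 * c * S) * e2"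
    using mult_left_mono[OF pos(2), of "e1 * e2 * c * (e2 * S)"]
      mult_left_mono[OF pos(3), of "e1 * (e1 * e2 * c * S)"] pos by (intro add_mono) auto
  also have "\<dots> = (e1 * e1) * (e2 * e2) * (2 * c) * S" by (simp add: algebra_simps)
  also have "e1 * e1 = exp (2 * \<omega> * h)" by (simp add: e1_def q_def exp_add[symmetric])
  also have "e2 * e2 = exp (L * \<delta> * h)" by (simp add: e2_def q_def exp_add[symmetric])
  also have "2 * c = 101 / 400 * L * h\<^sup>2 * (1 / 2) ^ Suc k"
    by (simp add: c_def q_def power2_eq_square)
  finally show ?case by (simp add: S_def)
qed

text \<open>Same scheme as \<open>flow_Suc_diff\<close>: a local error of order
  \<open>h\<^sup>2\<close> halves with each level, and the square of \<open>psi\<close> accounts for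
  the doubled exponent.\<close>

lemma flow_energy:
  assumes "0 \<le> h" "h \<le> \<theta>" "\<theta> \<le> \<delta>"
  shows "\<bar>energy (flow k h z) - energy z\<bar> \<le> exp (2 * (L * \<delta> * h)) * (L * h\<^sup>2 * (1 / 2) ^ k) * (psi \<theta> z)\<^sup>2"
  using assms
proof (induction k arbitrary: h \<theta> z)
  case 0
  have "\<bar>energy (flow 0 h z) - energy z\<bar> \<le> 1 * (L * h\<^sup>2 * (psi \<theta> z)\<^sup>2)"
    using energy_verlet_psi[OF 0] by simp
  also have "\<dots> \<le> exp (2 * (L * \<delta> * h)) * (L * h\<^sup>2 * (psi \<theta> z)\<^sup>2)"
    using 0 L_pos delta_pos by (intro mult_right_mono) auto
  finally show ?case by simp
next
  case (Suc k)
  define q where "q = h / 2"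
  have q: "0 \<le> q" "q \<le> \<theta>" "q \<le> \<theta> - q" "\<theta> - q \<le> \<delta>" "q \<le> \<delta>" using Suc.prems by (auto simp: q_def)
  define c where "c = L * q\<^sup>2 * (1 / 2) ^ k"
  define e where "e = exp (2 * (L * \<delta> * q))"
  define S where "S = psi \<theta> z"
  have pos: "0 \<le> c" "1 \<le> e" "0 \<le> S"
    using L_pos q delta_pos Suc.prems by (auto simp: c_def e_def S_def psi_nonneg)
  let ?G = "flow k q"
  have "\<bar>energy (flow (Suc k) h z) - energy z\<bar>
      \<le> \<bar>energy (?G (?G z)) - energy (?G z)\<bar> + \<bar>energy (?G z) - energy z\<bar>"
    by (simp add: q_def)
  also have "\<dots> \<le> e * c * (psi (\<theta> - q) (?G z))\<^sup>2 + e * c * S\<^sup>2"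
    unfolding c_def e_def S_def using q Suc.prems by (intro add_mono Suc.IH) auto
  also have "\<dots> \<le> e * c * (e * S\<^sup>2) + e * c * (e * S\<^sup>2)"
  proof (intro add_mono mult_left_mono)
    have "(psi (\<theta> - q) (?G z))\<^sup>2 \<le> (exp (L * \<delta> * q) * S)\<^sup>2"
      unfolding S_def using q Suc.prems by (intro power_mono psi_flow psi_nonneg) auto
    also have "\<dots> = e * S\<^sup>2"
      unfolding e_def by (simp add: power_mult_distrib power2_eq_square[of "exp _"] exp_add[symmetric])
    finally show "(psi (\<theta> - q) (?G z))\<^sup>2 \<le> e * S\<^sup>2" .
    show "S\<^sup>2 \<le> e * S\<^sup>2" using pos by (simp add: mult_le_cancel_right1)
  qed (use pos in auto)
  also have "\<dots> = (e * e) * (2 * c) * S\<^sup>2" by (simp add: algebra_simps)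
  also have "e * e = exp (2 * (L * \<delta> * h))" by (simp add: e_def q_def exp_add[symmetric])
  also have "2 * c = L * h\<^sup>2 * (1 / 2) ^ Suc k"
    by (simp add: c_def q_def power2_eq_square)
  finally show ?case by (simp add: S_def)
qed

definition Flow :: "'a \<times> 'a \<Rightarrow> 'a \<times> 'a" where
  "Flow z = lim (\<lambda>k. flow k \<delta> z)"

lemma norm_le_nu: "norm z \<le> (1 / \<omega> + 1) * nu z"
proof -
  have "norm z \<le> norm (fst z) + norm (snd z)"
    by (metis norm_Pair_le prod.collapse)
  also have "\<dots> \<le> (1 / \<omega> + 1) * nu z"
    using omega_pos by (simp add: nu_def algebra_simps)
  finally show ?thesis .
qed

lemma flow_tendsto: "(\<lambda>k. flow k \<delta> z) \<longlonglongrightarrow> Flow z"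
proof -
  define C where "C = exp (2 * \<omega> * \<delta>) * exp (L * \<delta> * \<delta>) * (101 / 400 * L * \<delta>\<^sup>2) * psi \<delta> z"
  have "summable (\<lambda>k. flow (Suc k) \<delta> z - flow k \<delta> z)"
  proof (rule summable_comparison_test)
    show "summable (\<lambda>k. (1 / \<omega> + 1) * C * (1 / 2) ^ k :: real)"
      by (intro summable_mult summable_geometric) auto
    show "\<exists>N. \<forall>k\<ge>N. norm (flow (Suc k) \<delta> z - flow k \<delta> z) \<le> (1 / \<omega> + 1) * C * (1 / 2) ^ k"
    proof (intro exI allI impI)
      fix k
      have "norm (flow (Suc k) \<delta> z - flow k \<delta> z) \<le> (1 / \<omega> + 1) * nu (flow (Suc k) \<delta> z - flow k \<delta> z)"
        by (rule norm_le_nu)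
      also have "\<dots> \<le> (1 / \<omega> + 1) * (exp (2 * \<omega> * \<delta>) * exp (L * \<delta> * \<delta>) * (101 / 400 * L * \<delta>\<^sup>2 * (1 / 2) ^ k) * psi \<delta> z)"
        using omega_pos delta_pos by (intro mult_left_mono flow_Suc_diff) auto
      finally show "norm (flow (Suc k) \<delta> z - flow k \<delta> z) \<le> (1 / \<omega> + 1) * C * (1 / 2) ^ k"
        by (simp add: C_def mult_ac)
    qed
  qed
  then have "convergent (\<lambda>n. \<Sum>k<n. flow (Suc k) \<delta> z - flow k \<delta> z)"
    by (simp add: summable_iff_convergent)
  then have "convergent (\<lambda>n. flow n \<delta> z - flow 0 \<delta> z)"
    unfolding sum_lessThan_telescope[of "\<lambda>k. flow k \<delta> z"] .
  then have "convergent (\<lambda>n. (flow n \<delta> z - flow 0 \<delta> z) + flow 0 \<delta> z)"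
    by (intro convergent_add convergent_const)
  then have "convergent (\<lambda>n. flow n \<delta> z)" by simp
  then show ?thesis unfolding Flow_def by (simp add: convergent_LIMSEQ_iff)
qed

text \<open>The differences between consecutive levels form a geometric series with sum
  \<open>2 * C\<close>.\<close>

lemma Flow_verlet_diff: "nu (Flow z - verlet \<delta> z) \<le> 3 / 5 * L * \<delta>\<^sup>2 * psi \<delta> z"
proof -
  define C where "C = exp (2 * \<omega> * \<delta>) * exp (L * \<delta> * \<delta>) * (101 / 400 * L * \<delta>\<^sup>2) * psi \<delta> z"
  have C0: "0 \<le> C" using L_pos delta_pos psi_nonneg by (simp add: C_def)
  have k: "nu (flow k \<delta> z - verlet \<delta> z) \<le> 2 * C * (1 - (1 / 2) ^ k)" for k
  proof (induction k)
    case 0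
    show ?case by (simp add: nu_def)
  next
    case (Suc k)
    have "nu (flow (Suc k) \<delta> z - verlet \<delta> z) \<le> nu (flow (Suc k) \<delta> z - flow k \<delta> z) + nu (flow k \<delta> z - verlet \<delta> z)"
      by (rule nu_diff_triangle)
    also have "\<dots> \<le> C * (1 / 2) ^ k + 2 * C * (1 - (1 / 2) ^ k)"
      using Suc flow_Suc_diff[of \<delta> \<delta> k z] delta_pos by (intro add_mono) (auto simp: C_def mult_ac)
    also have "\<dots> = 2 * C * (1 - (1 / 2) ^ Suc k)" by (simp add: algebra_simps)
    finally show ?case .
  qed
  have "(\<lambda>k. nu (flow k \<delta> z - verlet \<delta> z)) \<longlonglongrightarrow> nu (Flow z - verlet \<delta> z)"
    using continuous_nu by (intro continuous_on_tendsto_compose[OF continuous_nu] tendsto_intros flow_tendsto) auto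
  moreover have "nu (flow k \<delta> z - verlet \<delta> z) \<le> 2 * C" for k
  proof -
    have "2 * C * (1 - (1 / 2) ^ k) \<le> 2 * C" using C0 by (simp add: mult_left_le)
    then show ?thesis using k[of k] by linarith
  qed
  ultimately have "nu (Flow z - verlet \<delta> z) \<le> 2 * C"
    by (intro LIMSEQ_le_const2) auto
  also have "\<dots> \<le> 3 / 5 * L * \<delta>\<^sup>2 * psi \<delta> z"
  proof -
    define t where "t = 2 * \<omega> * \<delta> + L * \<delta> * \<delta>"
    have t: "0 \<le> t" "t \<le> 1 / 100"
      using omega_h_le[of \<delta>] L_h_sq_le[of \<delta>] delta_pos omega_pos L_pos
      by (auto simp: t_def power2_eq_square)
    have "exp t \<le> 1 + t + t\<^sup>2" using t by (intro exp_bound) auto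
    also have "\<dots> \<le> 11 / 10"
    proof -
      have "t\<^sup>2 \<le> t" using t by (simp add: power2_eq_square mult_left_le)
      then show ?thesis using t by simp
    qed
    \<comment> \<open>Twice 101/400, times the bound 11/10 of all exponential factors, stays below
      3/5.\<close>
    finally have "exp t * (202 / 400) \<le> 3 / 5" by simp
    then have "exp t * (202 / 400) * (L * \<delta>\<^sup>2 * psi \<delta> z) \<le> 3 / 5 * (L * \<delta>\<^sup>2 * psi \<delta> z)"
      using L_pos delta_pos psi_nonneg[of \<delta> z] by (intro mult_right_mono) auto
    moreover have "2 * C = exp t * (202 / 400) * (L * \<delta>\<^sup>2 * psi \<delta> z)"
      by (simp add: C_def t_def exp_add)
    ultimately show ?thesis by (simp only: mult.assoc)
  qed
  finally show ?thesis .
qed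

lemma flow_energy_tendsto: "(\<lambda>k. energy (flow k \<delta> z)) \<longlonglongrightarrow> energy z"
proof -
  define C where "C = exp (2 * (L * \<delta> * \<delta>)) * (L * \<delta>\<^sup>2) * (psi \<delta> z)\<^sup>2"
  have lim: "(\<lambda>k. C * (1 / 2) ^ k) \<longlonglongrightarrow> 0"
    by (intro tendsto_mult_right_zero LIMSEQ_power_zero) auto
  have "\<bar>energy (flow k \<delta> z) - energy z\<bar> \<le> C * (1 / 2) ^ k" for k
  proof -
    have "\<bar>energy (flow k \<delta> z) - energy z\<bar> \<le> exp (2 * (L * \<delta> * \<delta>)) * (L * \<delta>\<^sup>2 * (1 / 2) ^ k) * (psi \<delta> z)\<^sup>2"
      using delta_pos by (intro flow_energy) auto
    also have "\<dots> = C * (1 / 2) ^ k" by (simp add: C_def)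
    finally show ?thesis .
  qed
  then have "\<forall>\<^sub>F k in sequentially. norm (energy (flow k \<delta> z) - energy z) \<le> C * (1 / 2) ^ k"
    by (intro always_eventually allI) (simp only: real_norm_def)
  then have "(\<lambda>k. energy (flow k \<delta> z) - energy z) \<longlonglongrightarrow> 0"
    using lim by (rule Lim_null_comparison)
  then show ?thesis by (simp add: LIM_zero_iff)
qed

lemma measurable_Flow [measurable]: "Flow \<in> borel_measurable borel"
  by (rule borel_measurable_LIMSEQ_metric[OF measurable_flow flow_tendsto])

end

section \<open>Gaussian measures\<close>

text \<open>States carry \<open>borel\<close> on a product type, not a product sigma-algebra; this
  rule and the next let the measurability prover see through the projections there.\<close>

lemma borel_measurable_fst_borel [measurable (raw)]:
  fixes f :: "'c \<Rightarrow> 'a::second_countable_topology \<times> 'b::second_countable_topology"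
  shows "f \<in> borel_measurable M \<Longrightarrow> (\<lambda>x. fst (f x)) \<in> borel_measurable M"
  by (rule measurable_compose[OF _ borel_measurable_continuous_onI[OF continuous_on_fst[OF continuous_on_id]]])

lemma borel_measurable_snd_borel [measurable (raw)]:
  fixes f :: "'c \<Rightarrow> 'a::second_countable_topology \<times> 'b::second_countable_topology"
  shows "f \<in> borel_measurable M \<Longrightarrow> (\<lambda>x. snd (f x)) \<in> borel_measurable M"
  by (rule measurable_compose[OF _ borel_measurable_continuous_onI[OF continuous_on_snd[OF continuous_on_id]]])

section \<open>Shears, dilations and rotations\<close>

lemma nn_integral_shear_snd:
  fixes f :: "'a::euclidean_space \<Rightarrow> 'b::euclidean_space"
  assumes [measurable]: "f \<in> borel_measurable borel" "F \<in> borel_measurable borel"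
  shows "(\<integral>\<^sup>+z. F (fst z, snd z + f (fst z)) \<partial>lborel) = (\<integral>\<^sup>+z. F z \<partial>lborel)"
proof -
  have [measurable]: "F \<in> borel_measurable (lborel \<Otimes>\<^sub>M lborel)"
    by (simp add: lborel_prod)
  have [measurable]: "(\<lambda>y. F (x, y)) \<in> borel_measurable borel" for x
    by (simp add: borel_prod[symmetric])
  have *: "(\<integral>\<^sup>+y. F (x, y + f x) \<partial>lborel) = (\<integral>\<^sup>+y. F (x, y) \<partial>lborel)" for x
    by (subst (2) lborel_distr_plus[of "f x", symmetric])
      (simp add: nn_integral_distr add.commute)
  have "(\<integral>\<^sup>+z. F (fst z, snd z + f (fst z)) \<partial>lborel) = (\<integral>\<^sup>+x. \<integral>\<^sup>+y. F (x, y + f x) \<partial>lborel \<partial>lborel)"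
    unfolding lborel_prod[symmetric] by (subst lborel.nn_integral_fst[symmetric]) (simp_all add: borel_prod)
  also have "\<dots> = (\<integral>\<^sup>+x. \<integral>\<^sup>+y. F (x, y) \<partial>lborel \<partial>lborel)" by (simp add: *)
  also have "\<dots> = (\<integral>\<^sup>+z. F z \<partial>lborel)"
    unfolding lborel_prod[symmetric] by (subst lborel.nn_integral_fst[symmetric]) (simp_all add: borel_prod)
  finally show ?thesis .
qed

lemma nn_integral_shear_fst:
  fixes f :: "'b::euclidean_space \<Rightarrow> 'a::euclidean_space"
  assumes [measurable]: "f \<in> borel_measurable borel" "F \<in> borel_measurable borel"
  shows "(\<integral>\<^sup>+z. F (fst z + f (snd z), snd z) \<partial>lborel) = (\<integral>\<^sup>+z. F z \<partial>lborel)"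
proof -
  have [measurable]: "F \<in> borel_measurable (lborel \<Otimes>\<^sub>M lborel)"
    by (simp add: lborel_prod)
  have [measurable]: "(\<lambda>x. F (x, y)) \<in> borel_measurable borel" for y
    by (simp add: borel_prod[symmetric])
  have *: "(\<integral>\<^sup>+x. F (x + f y, y) \<partial>lborel) = (\<integral>\<^sup>+x. F (x, y) \<partial>lborel)" for y
    by (subst (2) lborel_distr_plus[of "f y", symmetric])
      (simp add: nn_integral_distr add.commute)
  have "(\<integral>\<^sup>+z. F (fst z + f (snd z), snd z) \<partial>lborel) = (\<integral>\<^sup>+y. \<integral>\<^sup>+x. F (x + f y, y) \<partial>lborel \<partial>lborel)"
    unfolding lborel_prod[symmetric] by (subst lborel_pair.nn_integral_snd[symmetric]) (simp_all add: borel_prod)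
  also have "\<dots> = (\<integral>\<^sup>+y. \<integral>\<^sup>+x. F (x, y) \<partial>lborel \<partial>lborel)" by (simp add: *)
  also have "\<dots> = (\<integral>\<^sup>+z. F z \<partial>lborel)"
    unfolding lborel_prod[symmetric] by (subst lborel_pair.nn_integral_snd[symmetric]) (simp_all add: borel_prod)
  finally show ?thesis .
qed

lemma nn_integral_lborel_affine:
  fixes a :: "'a::euclidean_space"
  assumes [measurable]: "F \<in> borel_measurable borel" and "0 < t"
  shows "(\<integral>\<^sup>+x. F x \<partial>lborel) = ennreal (t ^ DIM('a)) * (\<integral>\<^sup>+x. F (a + t *\<^sub>R x) \<partial>lborel)"
  using assms(2)
  by (subst lborel_affine[of t a]) (simp_all add: nn_integral_density nn_integral_distr nn_integral_cmult)

definition gauss_const :: "'a::euclidean_space itself \<Rightarrow> real" where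
  "gauss_const _ = (1 / sqrt (2 * pi)) ^ DIM('a)"

lemma gauss_const_pos: "0 < gauss_const TYPE('a::euclidean_space)"
  by (simp add: gauss_const_def)

lemma std_gaussian_eq:
  "std_gaussian = density lborel (\<lambda>x::'a::euclidean_space. ennreal (gauss_const TYPE('a) * exp (- ((norm x)\<^sup>2 / 2))))"
proof -
  have "(\<Prod>b\<in>Basis. std_normal_density (x \<bullet> b)) = gauss_const TYPE('a) * exp (- ((norm x)\<^sup>2 / 2))" for x :: 'a
  proof -
    have "(\<Prod>b\<in>Basis. std_normal_density (x \<bullet> b)) = gauss_const TYPE('a) * (\<Prod>b\<in>Basis. exp (- ((x \<bullet> b)\<^sup>2 / 2)))"
      by (simp add: std_normal_density_def prod.distrib gauss_const_def prod_dividef power_divide real_sqrt_power[symmetric])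
    also have "(\<Prod>b\<in>Basis. exp (- ((x \<bullet> b)\<^sup>2 / 2))) = exp (\<Sum>b\<in>Basis. - ((x \<bullet> b)\<^sup>2 / 2))"
      by (simp add: exp_sum)
    also have "(\<Sum>b\<in>Basis. - ((x \<bullet> b)\<^sup>2 / 2)) = - ((norm x)\<^sup>2 / 2)"
      unfolding power2_norm_eq_inner euclidean_inner[of x x]
      by (simp add: sum_negf sum_divide_distrib power2_eq_square)
    finally show ?thesis .
  qed
  then show ?thesis unfolding std_gaussian_def by simp
qed

lemma sets_std_gaussian [simp, measurable_cong]: "sets std_gaussian = sets borel"
  and space_std_gaussian [simp]: "space std_gaussian = UNIV"
  by (simp_all add: std_gaussian_def)

lemma prob_space_std_gaussian: "prob_space (std_gaussian :: 'a::euclidean_space measure)"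
proof
  have "emeasure (std_gaussian :: 'a measure) (space std_gaussian)
      = (\<integral>\<^sup>+x. (\<Prod>b\<in>Basis. ennreal (std_normal_density (x \<bullet> b))) \<partial>(lborel :: 'a measure))"
    unfolding std_gaussian_def by (simp add: emeasure_density prod_ennreal)
  also have "\<dots> = (\<Prod>b\<in>(Basis::'a set). (\<integral>\<^sup>+x. ennreal (std_normal_density x) \<partial>lborel))"
    by (intro nn_integral_lborel_prod) auto
  also have "(\<integral>\<^sup>+x. ennreal (std_normal_density x) \<partial>lborel) = 1"
  proof -
    interpret prob_space "density lborel std_normal_density"
      by (rule prob_space_normal_density) simp
    show ?thesis using emeasure_space_1 by (simp add: emeasure_density)
  qed
  finally show "emeasure (std_gaussian :: 'a measure) (space std_gaussian) = 1" by simp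
qed

interpretation std_gaussian: prob_space "std_gaussian :: 'a::euclidean_space measure"
  by (rule prob_space_std_gaussian)

interpretation std_gaussian_pair: pair_prob_space
  "std_gaussian :: 'a::euclidean_space measure" "std_gaussian :: 'b::euclidean_space measure" ..

text \<open>The density of two independent Gaussians is rotation invariant, and so is Lebesgue
  measure, because a plane rotation is a product \<open>A B A\<close> of three shears.\<close>

lemma nn_integral_std_gaussian_rotate:
  fixes F :: "'a::euclidean_space \<Rightarrow> ennreal"
  assumes [measurable]: "F \<in> borel_measurable borel" and s: "s\<^sup>2 + c\<^sup>2 = 1" "s \<noteq> 0"
  shows "(\<integral>\<^sup>+v. \<integral>\<^sup>+w. F (c *\<^sub>R v + s *\<^sub>R w) \<partial>std_gaussian \<partial>std_gaussian) = (\<integral>\<^sup>+v. F v \<partial>std_gaussian)"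
proof -
  define k where "k = gauss_const TYPE('a)"
  have k: "0 < k" using gauss_const_pos by (simp add: k_def)
  define \<phi> where "\<phi> x = ennreal (k * exp (- ((norm x)\<^sup>2 / 2)))" for x :: 'a
  have [measurable]: "\<phi> \<in> borel_measurable borel" unfolding \<phi>_def[abs_def] by measurable
  have G: "std_gaussian = density lborel \<phi>" by (simp add: std_gaussian_eq \<phi>_def[abs_def] k_def)
  define H where "H z = \<phi> (fst z) * \<phi> (snd z)" for z :: "'a \<times> 'a"
  have H: "H z = ennreal (k * k * exp (- ((norm z)\<^sup>2 / 2)))" for z
    using k by (simp add: H_def \<phi>_def norm_prod_def ennreal_mult[symmetric] add_divide_distrib exp_add[symmetric] mult_ac)
  have int: "(\<integral>\<^sup>+v. \<integral>\<^sup>+w. f v w \<partial>std_gaussian \<partial>std_gaussian) = (\<integral>\<^sup>+z. H z * f (fst z) (snd z) \<partial>lborel)"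
    if [measurable]: "(\<lambda>z. f (fst z) (snd z)) \<in> borel_measurable borel" for f :: "'a \<Rightarrow> 'a \<Rightarrow> ennreal"
  proof -
    have [measurable]: "(\<lambda>(x, y). f x y) \<in> borel_measurable (borel \<Otimes>\<^sub>M borel)"
      using that by (simp add: borel_prod case_prod_beta')
    have "(\<integral>\<^sup>+v. \<integral>\<^sup>+w. f v w \<partial>std_gaussian \<partial>std_gaussian)
        = (\<integral>\<^sup>+v. \<integral>\<^sup>+w. H (v, w) * f v w \<partial>lborel \<partial>lborel)"
    proof -
      have 1: "(\<integral>\<^sup>+w. f v w \<partial>std_gaussian) = (\<integral>\<^sup>+w. \<phi> w * f v w \<partial>lborel)" for v
        unfolding G by (intro nn_integral_density) measurable
      have "(\<lambda>v. \<integral>\<^sup>+w. \<phi> w * f v w \<partial>lborel) \<in> borel_measurable borel"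
        by measurable
      then show ?thesis
        unfolding 1 unfolding G H_def
        by (subst nn_integral_density) (simp_all add: nn_integral_cmult[symmetric] mult.assoc)
    qed
    also have "\<dots> = (\<integral>\<^sup>+z. H z * f (fst z) (snd z) \<partial>(lborel \<Otimes>\<^sub>M lborel))"
      unfolding H_def by (subst lborel.nn_integral_fst[symmetric]) (auto simp: borel_prod)
    finally show ?thesis by (simp add: lborel_prod)
  qed
  \<comment> \<open>The tangent of half the rotation angle, the shear parameter for which
    \<open>A B A\<close> is the rotation.\<close>
  define a where "a = (1 - c) / s"
  define A where "A z = (fst z + a *\<^sub>R snd z, snd z)" for z :: "'a \<times> 'a"
  define B where "B z = (fst z, snd z + (- s) *\<^sub>R fst z)" for z :: "'a \<times> 'a"
  have [measurable]: "A \<in> borel_measurable borel" "B \<in> borel_measurable borel"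
    unfolding A_def B_def by (intro borel_measurable_continuous_onI continuous_intros)+
  have ac: "a * (- s) + 1 = c" "a + a * c = s"
    using s by (auto simp: a_def field_simps power2_eq_square)
  have R: "A (B (A z)) = (c *\<^sub>R fst z + s *\<^sub>R snd z, c *\<^sub>R snd z - s *\<^sub>R fst z)" for z
  proof -
    have 1: "snd (B (A z)) = c *\<^sub>R snd z - s *\<^sub>R fst z"
      unfolding ac(1)[symmetric] by (simp add: A_def B_def algebra_simps)
    have "fst (A (B (A z))) = fst z + a *\<^sub>R snd z + a *\<^sub>R (c *\<^sub>R snd z - s *\<^sub>R fst z)"
      using 1 by (simp add: A_def B_def)
    also have "\<dots> = (a * (- s) + 1) *\<^sub>R fst z + (a + a * c) *\<^sub>R snd z"
      by (simp add: algebra_simps)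
    finally show ?thesis using 1 unfolding ac by (simp add: A_def prod_eq_iff)
  qed
  have nR: "(norm (A (B (A z))))\<^sup>2 = (norm z)\<^sup>2" for z
  proof -
    have nP: "(norm (x, y))\<^sup>2 = (norm x)\<^sup>2 + (norm y)\<^sup>2" for x y :: 'a
      by (simp add: norm_Pair)
    have "(norm (A (B (A z))))\<^sup>2 = (s\<^sup>2 + c\<^sup>2) * ((norm (fst z))\<^sup>2 + (norm (snd z))\<^sup>2)"
      unfolding R nP
      by (simp add: power2_norm_eq_inner inner_add_left inner_add_right inner_diff_left inner_diff_right
          inner_commute algebra_simps power2_eq_square[of s] power2_eq_square[of c] real_sqrt_pow2)
    then show ?thesis using s by (simp add: norm_prod_def)
  qed
  have "(\<integral>\<^sup>+v. \<integral>\<^sup>+w. F (c *\<^sub>R v + s *\<^sub>R w) \<partial>std_gaussian \<partial>std_gaussian)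
      = (\<integral>\<^sup>+z. H z * F (c *\<^sub>R fst z + s *\<^sub>R snd z) \<partial>lborel)"
    by (rule int) measurable
  also have "\<dots> = (\<integral>\<^sup>+z. (\<lambda>y. H y * F (fst y)) (A (B (A z))) \<partial>lborel)"
    by (simp add: H nR) (simp add: R)
  also have "\<dots> = (\<integral>\<^sup>+z. (\<lambda>y. H y * F (fst y)) (A (B z)) \<partial>lborel)"
    using nn_integral_shear_fst[of "\<lambda>y. a *\<^sub>R y" "\<lambda>z. (\<lambda>y. H y * F (fst y)) (A (B z))"]
    unfolding H_def by (simp add: A_def[symmetric])
  also have "\<dots> = (\<integral>\<^sup>+z. (\<lambda>y. H y * F (fst y)) (A z) \<partial>lborel)"
    using nn_integral_shear_snd[of "\<lambda>y. (- s) *\<^sub>R y" "\<lambda>z. (\<lambda>y. H y * F (fst y)) (A z)"]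
    unfolding H_def B_def by simp
  also have "\<dots> = (\<integral>\<^sup>+z. H z * F (fst z) \<partial>lborel)"
    using nn_integral_shear_fst[of "\<lambda>y. a *\<^sub>R y" "\<lambda>y. H y * F (fst y)"]
    unfolding H_def A_def by simp
  also have "\<dots> = (\<integral>\<^sup>+v. \<integral>\<^sup>+w. F v \<partial>(std_gaussian :: 'a measure) \<partial>std_gaussian)"
    by (rule int[symmetric]) measurable
  also have "\<dots> = (\<integral>\<^sup>+v. F v \<partial>std_gaussian)"
    by (simp add: std_gaussian.emeasure_space_1[simplified])
  finally show ?thesis .
qed

section \<open>Moments\<close>

context strongly_convex_smooth
begin

text \<open>Along a ray from the minimiser: strong convexity from \<open>xs + t *\<^sub>R y\<close>
  to \<open>xs + y\<close>, with the slope at the inner point bounded below by monotonicity against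
  \<open>xs\<close>.\<close>

lemma potential_contract:
  assumes xs: "g xs = 0" and t: "0 < t" "t < 1"
  shows "U (xs + t *\<^sub>R y) \<le> U (xs + y) - m * (1 - t\<^sup>2) / 2 * (norm y)\<^sup>2"
proof -
  have "t * (m * t * (norm y)\<^sup>2) \<le> t * (g (xs + t *\<^sub>R y) \<bullet> y)"
    using mono[of "xs + t *\<^sub>R y" xs] t xs by (simp add: power_mult_distrib power2_eq_square inner_commute mult_ac)
  then have "m * t * (norm y)\<^sup>2 \<le> g (xs + t *\<^sub>R y) \<bullet> y"
    using t by (simp only: mult_le_cancel_left_pos)
  then have "(1 - t) * (m * t * (norm y)\<^sup>2) \<le> (1 - t) * (g (xs + t *\<^sub>R y) \<bullet> y)"
    using t by (intro mult_left_mono) auto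
  moreover have "U (xs + t *\<^sub>R y) + (1 - t) * (g (xs + t *\<^sub>R y) \<bullet> y) + m / 2 * ((1 - t) * norm y)\<^sup>2 \<le> U (xs + y)"
  proof -
    have "xs + t *\<^sub>R y + (1 - t) *\<^sub>R y = xs + y" by (simp add: scaleR_left_diff_distrib)
    then show ?thesis
      using strong_convexity[of "xs + t *\<^sub>R y" "(1 - t) *\<^sub>R y"] t by (simp add: add.assoc)
  qed
  moreover have "(1 - t) * (m * t * (norm y)\<^sup>2) + m / 2 * ((1 - t) * norm y)\<^sup>2 = m * (1 - t\<^sup>2) / 2 * (norm y)\<^sup>2"
    by (simp add: power2_eq_square field_simps)
  ultimately show ?thesis by linarith
qed

context
  fixes xs :: 'a and c :: real and M J
  assumes xs: "g xs = 0" and c: "0 \<le> c"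
  defines "M \<equiv> density lborel (\<lambda>x. ennreal (c * exp (- U x)))"
  defines "J \<equiv> (\<lambda>q. \<integral>\<^sup>+x. ennreal (norm (x - xs) powr q) \<partial>M)"
  assumes M: "prob_space M"
begin

lemma moment_eq: "J q = (\<integral>\<^sup>+y. ennreal (c * exp (- U (xs + y)) * norm y powr q) \<partial>lborel)"
proof -
  have "J q = (\<integral>\<^sup>+x. ennreal (c * exp (- U x) * norm (x - xs) powr q) \<partial>lborel)"
    unfolding J_def M_def using c by (subst nn_integral_density) (auto simp: ennreal_mult)
  also have "\<dots> = ennreal (1 ^ DIM('a)) * (\<integral>\<^sup>+y. ennreal (c * exp (- U (xs + 1 *\<^sub>R y)) * norm (xs + 1 *\<^sub>R y - xs) powr q) \<partial>lborel)"
    by (intro nn_integral_lborel_affine) auto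
  finally show ?thesis by simp
qed

text \<open>Shrinking towards \<open>xs\<close> by \<open>t\<close> raises the density by at least
  \<open>1 + m * (1 - t\<^sup>2) / 2 * (norm y)\<^sup>2\<close>, while the change of variables costs
  the power of \<open>t\<close> coming from the Jacobian and from the weight. Differentiated at
  \<open>t = 1\<close>, this replaces an integration by parts.\<close>

lemma moment_scaling:
  assumes t: "0 < t" "t < 1" and q: "0 \<le> q"
  shows "J q + ennreal (m * (1 - t\<^sup>2) / 2) * J (q + 2) \<le> ennreal (t powr - (q + real DIM('a))) * J q"
proof -
  let ?d = "real DIM('a)"
  have t2: "t\<^sup>2 \<le> 1" using t by (simp add: power_le_one)
  have "J q + ennreal (m * (1 - t\<^sup>2) / 2) * J (q + 2)
      = (\<integral>\<^sup>+y. ennreal (c * exp (- U (xs + y)) * norm y powr q)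
          + ennreal (m * (1 - t\<^sup>2) / 2) * ennreal (c * exp (- U (xs + y)) * norm y powr (q + 2)) \<partial>lborel)"
    unfolding moment_eq by (subst nn_integral_add) (simp_all add: nn_integral_cmult)
  also have "\<dots> \<le> (\<integral>\<^sup>+y. ennreal (c * exp (- U (xs + t *\<^sub>R y)) * norm y powr q) \<partial>lborel)"
  proof (intro nn_integral_mono)
    fix y :: 'a
    define r where "r = m * (1 - t\<^sup>2) / 2 * (norm y)\<^sup>2"
    have r: "0 \<le> r" using t2 m_pos by (simp add: r_def)
    have p: "norm y powr (q + 2) = norm y powr q * (norm y)\<^sup>2"
      by (simp add: powr_add)
    have "exp (- U (xs + y)) * (1 + r) \<le> exp (- U (xs + y)) * exp r"
      by (intro mult_left_mono) auto
    also have "\<dots> = exp (- (U (xs + y) - r))" by (simp add: exp_add[symmetric])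
    also have "\<dots> \<le> exp (- U (xs + t *\<^sub>R y))"
      using potential_contract[OF xs t, of y] by (simp add: r_def)
    finally have e: "c * norm y powr q * (exp (- U (xs + y)) * (1 + r)) \<le> c * norm y powr q * exp (- U (xs + t *\<^sub>R y))"
      using c by (intro mult_left_mono) auto
    have "ennreal (c * exp (- U (xs + y)) * norm y powr q)
          + ennreal (m * (1 - t\<^sup>2) / 2) * ennreal (c * exp (- U (xs + y)) * norm y powr (q + 2))
        = ennreal (c * exp (- U (xs + y)) * norm y powr q + m * (1 - t\<^sup>2) / 2 * (c * exp (- U (xs + y)) * norm y powr (q + 2)))"
      using c t2 m_pos by (simp add: ennreal_mult[symmetric])
    also have "\<dots> = ennreal (c * norm y powr q * (exp (- U (xs + y)) * (1 + r)))"
      by (simp add: p r_def algebra_simps)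
    also have "\<dots> \<le> ennreal (c * norm y powr q * exp (- U (xs + t *\<^sub>R y)))"
      using e by (rule ennreal_leI)
    finally show "ennreal (c * exp (- U (xs + y)) * norm y powr q)
          + ennreal (m * (1 - t\<^sup>2) / 2) * ennreal (c * exp (- U (xs + y)) * norm y powr (q + 2))
        \<le> ennreal (c * exp (- U (xs + t *\<^sub>R y)) * norm y powr q)" by (simp add: mult_ac)
  qed
  also have "\<dots> = (\<integral>\<^sup>+y. ennreal (t powr - q) * ennreal (c * exp (- U (xs + t *\<^sub>R y)) * norm (t *\<^sub>R y) powr q) \<partial>lborel)"
    using t c by (intro nn_integral_cong)
      (simp add: ennreal_mult[symmetric] powr_mult powr_minus field_simps)
  also have "\<dots> = ennreal (t powr - q) * (\<integral>\<^sup>+y. ennreal (c * exp (- U (xs + t *\<^sub>R y)) * norm (xs + t *\<^sub>R y - xs) powr q) \<partial>lborel)"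
    by (simp add: nn_integral_cmult)
  also have "\<dots> = ennreal (t powr - (q + ?d)) * (ennreal (t ^ DIM('a)) * (\<integral>\<^sup>+y. ennreal (c * exp (- U (xs + t *\<^sub>R y)) * norm (xs + t *\<^sub>R y - xs) powr q) \<partial>lborel))"
  proof -
    have "t powr - q = t powr - (q + ?d) * t ^ DIM('a)"
      using t by (simp add: powr_realpow[symmetric] powr_add[symmetric])
    then show ?thesis using t by (simp add: ennreal_mult mult.assoc)
  qed
  also have "\<dots> = ennreal (t powr - (q + ?d)) * (\<integral>\<^sup>+x. ennreal (c * exp (- U x) * norm (x - xs) powr q) \<partial>lborel)"
    using t by (subst nn_integral_lborel_affine[of _ t xs]) auto
  also have "\<dots> = ennreal (t powr - (q + ?d)) * J q"
    unfolding J_def M_def using c by (subst nn_integral_density) (auto simp: ennreal_mult)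
  finally show ?thesis .
qed

text \<open>The choice \<open>t = 1/2\<close> in \<open>moment_scaling\<close> shows finiteness of
  the next moment; only then may the inequality be read between reals and differentiated at
  \<open>t = 1\<close>.\<close>

lemma moment_step:
  assumes q: "0 \<le> q" and fin: "J q < \<infinity>"
  shows "J (q + 2) < \<infinity>" and "m * enn2real (J (q + 2)) \<le> (q + real DIM('a)) * enn2real (J q)"
proof -
  define n where "n = q + real DIM('a)"
  define a b where "a = enn2real (J q)" and "b = enn2real (J (q + 2))"
  have "ennreal (m * (1 - (1/2)\<^sup>2) / 2) * J (q + 2) \<le> ennreal ((1/2) powr - n) * J q"
    unfolding n_def
    by (rule order_trans[OF add_increasing[OF zero_le order_refl] moment_scaling[of "1/2" q]]) (use q in auto)
  also have "\<dots> < \<infinity>" using fin by (simp add: ennreal_mult_less_top)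
  finally show fin2: "J (q + 2) < \<infinity>"
    using m_pos by (auto simp: ennreal_mult_less_top power2_eq_square)
  have J: "J q = ennreal a" "J (q + 2) = ennreal b"
    using fin fin2 by (simp_all add: a_def b_def)
  have ab: "0 \<le> a" "0 \<le> b" by (simp_all add: a_def b_def)
  \<comment> \<open>Nonnegative on the open unit interval and zero at 1, so its derivative
    \<open>m * b - n * a\<close> at 1 cannot be positive.\<close>
  define f where "f t = a * (t powr - n - 1) - m * b / 2 * (1 - t\<^sup>2)" for t
  have f: "0 \<le> f t" if t: "0 < t" "t < 1" for t
  proof -
    have t2: "t\<^sup>2 \<le> 1" using t by (simp add: power_le_one)
    have "ennreal (a + m * (1 - t\<^sup>2) / 2 * b) \<le> ennreal (t powr - n * a)"
      using moment_scaling[OF t q] ab t2 m_pos unfolding J n_def[symmetric]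
      by (simp add: ennreal_mult[symmetric] flip: ennreal_plus)
    then have "a + m * (1 - t\<^sup>2) / 2 * b \<le> t powr - n * a"
      using ab by (simp add: ennreal_le_iff)
    then show ?thesis by (simp add: f_def algebra_simps)
  qed
  have "(f has_real_derivative (m * b - n * a)) (at 1)"
    unfolding f_def by (auto intro!: derivative_eq_intros simp: algebra_simps)
  then have "\<not> 0 < m * b - n * a"
  proof (intro notI)
    assume "(f has_real_derivative (m * b - n * a)) (at 1)" "0 < m * b - n * a"
    then obtain d where d: "0 < d" "\<And>h. 0 < h \<Longrightarrow> h < d \<Longrightarrow> f (1 - h) < f 1"
      using DERIV_pos_inc_left by blast
    define h where "h = min (d / 2) (1 / 2)"
    have "f (1 - h) < f 1" using d by (auto simp: h_def)
    moreover have "0 \<le> f (1 - h)" using d by (intro f) (auto simp: h_def min_def)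
    ultimately show False by (simp add: f_def)
  qed
  then show "m * enn2real (J (q + 2)) \<le> (q + real DIM('a)) * enn2real (J q)"
    by (simp add: a_def b_def n_def)
qed

text \<open>An inequality and not an equality, because \<open>0 powr 0 = 0\<close> makes the
  integrand vanish at \<open>xs\<close>.\<close>

lemma moment_zero_le: "J 0 \<le> 1"
proof -
  interpret prob_space M by (rule M)
  have "J 0 \<le> (\<integral>\<^sup>+x. 1 \<partial>M)" unfolding J_def by (intro nn_integral_mono) auto
  then show ?thesis using emeasure_space_1 by simp
qed

lemma moment_le_of_pointwise:
  assumes "\<And>r. 0 \<le> r \<Longrightarrow> k * r powr p \<le> \<alpha> * r powr q + \<beta>" and "0 \<le> k" "0 \<le> \<alpha>" "0 \<le> \<beta>"
  shows "ennreal k * J p \<le> ennreal \<alpha> * J q + ennreal \<beta>"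
proof -
  interpret prob_space M by (rule M)
  have [simp]: "sets M = sets borel" by (simp add: M_def)
  have [measurable_cong]: "sets M = sets borel" by (simp add: M_def)
  have "ennreal k * J p = (\<integral>\<^sup>+x. ennreal (k * norm (x - xs) powr p) \<partial>M)"
    unfolding J_def using assms by (simp add: nn_integral_cmult[symmetric] ennreal_mult)
  also have "\<dots> \<le> (\<integral>\<^sup>+x. ennreal (\<alpha> * norm (x - xs) powr q) + ennreal \<beta> \<partial>M)"
    using assms by (intro nn_integral_mono) (auto simp flip: ennreal_plus intro!: ennreal_leI)
  also have "\<dots> = ennreal \<alpha> * J q + ennreal \<beta>"
    unfolding J_def using assms emeasure_space_1
    by (subst nn_integral_add) (auto simp: nn_integral_cmult[symmetric] ennreal_mult)
  finally show ?thesis .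
qed

text \<open>Induction in steps of 2 by \<open>moment_step\<close>; exponents up to 2 are dominated
  pointwise by the exponents 2 and 0.\<close>

lemma moment_finite: "0 \<le> q \<Longrightarrow> J q < \<infinity>"
proof -
  have "0 \<le> q \<Longrightarrow> q \<le> 2 * real n \<Longrightarrow> J q < \<infinity>" for n
  proof (induction n arbitrary: q)
    case 0
    then have "q = 0" by simp
    then show ?case using moment_zero_le by (auto simp: less_top intro: le_less_trans)
  next
    case (Suc n)
    show ?case
    proof (cases "q \<le> 2")
      case True
      have "J (0 + 2) < \<infinity>" using moment_zero_le by (intro moment_step) (auto intro: le_less_trans)
      moreover have "ennreal 1 * J q \<le> ennreal 1 * J 2 + ennreal 1"
      proof (rule moment_le_of_pointwise)
        fix r :: real assume r: "0 \<le> r"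
        show "1 * r powr q \<le> 1 * r powr 2 + 1"
        proof (cases "r \<le> 1")
          case True
          then have "r powr q \<le> 1" using powr_mono2[of q r 1] r Suc.prems by simp
          then show ?thesis using powr_ge_zero[of r 2] by linarith
        next
          case False
          then have "r powr q \<le> r powr 2" using \<open>q \<le> 2\<close> by (intro powr_mono) auto
          then show ?thesis by simp
        qed
      qed auto
      ultimately show ?thesis by (auto simp: less_top[symmetric] top_unique)
    next
      case False
      then have "J ((q - 2) + 2) < \<infinity>"
        using Suc.prems by (intro moment_step Suc.IH) auto
      then show ?thesis by simp
    qed
  qed
  moreover obtain n where "q \<le> 2 * real n"
  proof -
    obtain n where "q / 2 \<le> real n" using real_arch_simple by blast
    then show ?thesis using that[of n] by simp
  qed
  ultimately show "0 \<le> q \<Longrightarrow> J q < \<infinity>" by blast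
qed

text \<open>Source of the dimension factor of the theorem: the recursion of
  \<open>moment_step\<close> gains \<open>(d + p - 2) / m\<close> for \<open>p \<ge> 2\<close>, and
  for smaller \<open>p\<close> the second moment \<open>d / m\<close> is interpolated.\<close>

lemma moment_bound:
  fixes p :: real
  assumes p: "1 \<le> p"
  shows "J p \<le> ennreal (((real DIM('a) + max (p - 2) 0) / m) powr (p / 2))"
proof -
  have K2: "enn2real (J 2) \<le> real DIM('a) / m"
  proof -
    have "m * enn2real (J (0 + 2)) \<le> (0 + real DIM('a)) * enn2real (J 0)"
      using moment_zero_le by (intro moment_step) (auto intro: le_less_trans)
    also have "\<dots> \<le> (0 + real DIM('a)) * 1"
      using enn2real_mono[of "J 0" 1] moment_zero_le by (intro mult_left_mono) auto
    finally show ?thesis using m_pos by (simp add: field_simps)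
  qed
  have fin: "J p = ennreal (enn2real (J p))" if "0 \<le> p" for p
    using moment_finite[OF that] by simp
  have D: "0 < real DIM('a)" by simp
  show ?thesis
  proof (cases "2 \<le> p")
    case True
    define K where "K = (real DIM('a) + (p - 2)) / m"
    have K: "0 < K" using D True m_pos by (simp add: K_def divide_pos_pos add_pos_nonneg)
    \<comment> \<open>Young in place of Hoelder: the recursion bounds \<open>J p\<close> by
      \<open>K * J (p - 2)\<close>, and the share \<open>1 - 2 / p\<close> of \<open>J p\<close>,
      finite by \<open>moment_finite\<close>, is absorbed on the left.\<close>
    have "ennreal K * J (p - 2) \<le> ennreal (1 - 2 / p) * J p + ennreal (2 / p * K powr (p / 2))"
    proof (rule moment_le_of_pointwise)
      fix r :: real assume r: "0 \<le> r"
      show "K * r powr (p - 2) \<le> (1 - 2 / p) * r powr p + 2 / p * K powr (p / 2)"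
      proof (cases "r = 0")
        case False
        have "(r powr p) powr (1 - 2 / p) * (K powr (p / 2)) powr (2 / p) \<le> (1 - 2 / p) * r powr p + 2 / p * K powr (p / 2)"
          using False r K True by (intro Youngs_inequality_0) auto
        moreover have "(r powr p) powr (1 - 2 / p) = r powr (p - 2)"
          using True by (simp add: powr_powr right_diff_distrib)
        moreover have "(K powr (p / 2)) powr (2 / p) = K" using K True by (simp add: powr_powr)
        ultimately show ?thesis by (simp add: mult.commute)
      qed (use True in auto)
    qed (use K True in auto)
    then have "ennreal (K * enn2real (J (p - 2))) \<le> ennreal ((1 - 2 / p) * enn2real (J p) + 2 / p * K powr (p / 2))"
      using fin[of p] fin[of "p - 2"] K True
      by (simp add: ennreal_mult' ennreal_plus)
    then have 1: "K * enn2real (J (p - 2)) \<le> (1 - 2 / p) * enn2real (J p) + 2 / p * K powr (p / 2)"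
      using True by (subst (asm) ennreal_le_iff) auto
    have "m * enn2real (J ((p - 2) + 2)) \<le> ((p - 2) + real DIM('a)) * enn2real (J (p - 2))"
      using True by (intro moment_step moment_finite) auto
    then have "enn2real (J p) \<le> K * enn2real (J (p - 2))"
      using m_pos by (simp add: K_def field_simps)
    then have "2 / p * enn2real (J p) \<le> 2 / p * K powr (p / 2)" using 1 by (simp add: left_diff_distrib)
    then have "enn2real (J p) \<le> K powr (p / 2)" using True by (simp add: divide_right_mono field_simps)
    then have "ennreal (enn2real (J p)) \<le> ennreal (K powr (p / 2))" by (rule ennreal_leI)
    moreover have "max (p - 2) 0 = p - 2" using True by simp
    ultimately show ?thesis using fin[of p] True unfolding K_def by simp
  next
    case False
    define K where "K = real DIM('a) / m"
    have K: "0 < K" using D m_pos by (simp add: K_def)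
    \<comment> \<open>The tangent at \<open>K\<close> of the concave function with exponent
      \<open>p / 2\<close>, applied to the squared distance; with \<open>J 2 \<le> K\<close> its two
      terms add up to \<open>K powr (p / 2)\<close>.\<close>
    have "ennreal 1 * J p \<le> ennreal (p / 2 * K powr (p / 2 - 1)) * J 2 + ennreal ((1 - p / 2) * K powr (p / 2))"
    proof (rule moment_le_of_pointwise)
      fix r :: real assume r: "0 \<le> r"
      show "1 * r powr p \<le> p / 2 * K powr (p / 2 - 1) * r powr 2 + (1 - p / 2) * K powr (p / 2)"
      proof (cases "r = 0")
        case False
        have "(K powr (p / 2 - 1) * r powr 2) powr (p / 2) * (K powr (p / 2)) powr (1 - p / 2)
            \<le> p / 2 * (K powr (p / 2 - 1) * r powr 2) + (1 - p / 2) * K powr (p / 2)"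
          using False r K \<open>\<not> 2 \<le> p\<close> p by (intro Youngs_inequality_0) auto
        moreover have "(K powr (p / 2 - 1) * r powr 2) powr (p / 2) * (K powr (p / 2)) powr (1 - p / 2) = r powr p"
        proof -
          have "(K powr (p / 2 - 1) * r powr 2) powr (p / 2) = K powr ((p / 2 - 1) * (p / 2)) * r powr p"
          proof -
            have "(r powr 2) powr (p / 2) = r powr p" by (simp only: powr_powr) simp
            then show ?thesis using K r by (simp add: powr_mult powr_powr del: powr_numeral)
          qed
          moreover have "(K powr (p / 2)) powr (1 - p / 2) = K powr - ((p / 2 - 1) * (p / 2))"
            by (simp add: powr_powr algebra_simps)
          ultimately show ?thesis using K by (simp add: powr_minus)
        qed
        ultimately show ?thesis by (simp add: mult.assoc)
      qed (use p False in auto)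
    qed (use p False in auto)
    also have "\<dots> \<le> ennreal (p / 2 * K powr (p / 2 - 1)) * ennreal K + ennreal ((1 - p / 2) * K powr (p / 2))"
    proof (intro add_right_mono mult_left_mono)
      show "J 2 \<le> ennreal K" using ennreal_leI[OF K2] fin[of 2] by (simp add: K_def)
    qed simp
    also have "\<dots> = ennreal (p / 2 * (K powr (p / 2 - 1) * K) + (1 - p / 2) * K powr (p / 2))"
      using K p False by (simp add: ennreal_mult'[symmetric] ennreal_plus[symmetric] mult.assoc del: ennreal_plus)
    also have "K powr (p / 2 - 1) * K = K powr (p / 2)"
      using K by (simp add: powr_diff)
    finally show ?thesis using False by (simp add: K_def max_def algebra_simps)
  qed
qed

end

end

section \<open>Invariance of the Gibbs measure\<close>

lemma strongly_convex_smooth_square: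
  "strongly_convex_smooth (\<lambda>x::'a::euclidean_space. (norm x)\<^sup>2 / 2) (\<lambda>x. x) 1 1"
proof
  fix x :: 'a
  have "((\<lambda>x. (x \<bullet> x) / 2) has_derivative (\<lambda>h. h \<bullet> x)) (at x)"
    by (auto intro!: derivative_eq_intros simp: inner_commute)
  then show "GDERIV (\<lambda>x. (norm x)\<^sup>2 / 2) x :> x"
    by (simp add: gderiv_def power2_norm_eq_inner)
qed (auto simp: power2_norm_eq_inner)

lemma std_gaussian_moment:
  assumes "1 \<le> p"
  shows "(\<integral>\<^sup>+v. ennreal (norm v powr p) \<partial>(std_gaussian :: 'a::euclidean_space measure))
    \<le> ennreal ((real DIM('a) + max (p - 2) 0) powr (p / 2))"
proof -
  interpret strongly_convex_smooth "\<lambda>x::'a. (norm x)\<^sup>2 / 2" "\<lambda>x. x" 1 1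
    by (rule strongly_convex_smooth_square)
  show ?thesis
    using moment_bound[of 0 "gauss_const TYPE('a)" p] assms gauss_const_pos[where 'a='a] prob_space_std_gaussian
    unfolding std_gaussian_eq by simp
qed

context strongly_convex_smooth
begin

section \<open>Normalisation and moments of the Gibbs measure\<close>

definition total_mass :: ennreal where
  "total_mass = (\<integral>\<^sup>+x. ennreal (exp (- U x)) \<partial>lborel)"

text \<open>Strong convexity at the minimiser dominates the weight by a Gaussian of variance
  \<open>1 / m\<close>, whose mass is finite by scaling the standard one with
  \<open>sqrt m\<close>.\<close>

lemma total_mass_finite: "total_mass < \<infinity>"
proof -
  obtain xs where xs: "g xs = 0" using ex_critical by blast
  define k where "k = gauss_const TYPE('a)"
  have k: "0 < k" by (simp add: k_def gauss_const_pos)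
  define t where "t = sqrt m"
  have t: "0 < t" "t\<^sup>2 = m" using m_pos by (auto simp: t_def)
  define f where "f x = ennreal (exp (- U xs) / k * (k * exp (- ((norm (t *\<^sub>R x))\<^sup>2 / 2))))" for x :: 'a
  have "total_mass = ennreal (1 ^ DIM('a)) * (\<integral>\<^sup>+y. ennreal (exp (- U (xs + 1 *\<^sub>R y))) \<partial>lborel)"
    unfolding total_mass_def by (intro nn_integral_lborel_affine) auto
  also have "\<dots> = (\<integral>\<^sup>+y. ennreal (exp (- U (xs + y))) \<partial>lborel)" by simp
  also have "\<dots> \<le> (\<integral>\<^sup>+y. f y \<partial>lborel)"
  proof (intro nn_integral_mono)
    fix y :: 'a
    have "exp (- U (xs + y)) \<le> exp (- U xs - m / 2 * (norm y)\<^sup>2)"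
      using strong_convexity[of xs y] by (simp add: xs)
    also have "\<dots> = exp (- U xs) / k * (k * exp (- ((norm (t *\<^sub>R y))\<^sup>2 / 2)))"
      using k t by (simp add: power_mult_distrib mult_exp_exp)
    finally show "ennreal (exp (- U (xs + y))) \<le> f y" unfolding f_def by (rule ennreal_leI)
  qed
  also have "\<dots> = ennreal (exp (- U xs) / k) * (\<integral>\<^sup>+y. ennreal (k * exp (- ((norm ((0::'a) + t *\<^sub>R y))\<^sup>2 / 2))) \<partial>lborel)"
  proof -
    have fx: "f y = ennreal (exp (- U xs) / k) * ennreal (k * exp (- ((norm ((0::'a) + t *\<^sub>R y))\<^sup>2 / 2)))" for y
      using k by (simp add: f_def ennreal_mult[symmetric])
    show ?thesis unfolding fx by (intro nn_integral_cmult) measurable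
  qed
  also have "\<dots> < \<infinity>"
  proof -
    have "1 = (\<integral>\<^sup>+y. ennreal (k * exp (- ((norm y)\<^sup>2 / 2))) \<partial>(lborel :: 'a measure))"
      using prob_space.emeasure_space_1[OF prob_space_std_gaussian[where 'a='a]]
      unfolding std_gaussian_eq k_def by (simp add: emeasure_density)
    also have "\<dots> = ennreal (t ^ DIM('a)) * (\<integral>\<^sup>+y. ennreal (k * exp (- ((norm ((0::'a) + t *\<^sub>R y))\<^sup>2 / 2))) \<partial>lborel)"
      using t by (intro nn_integral_lborel_affine) auto
    finally have "(\<integral>\<^sup>+y. ennreal (k * exp (- ((norm ((0::'a) + t *\<^sub>R y))\<^sup>2 / 2))) \<partial>lborel) \<noteq> \<infinity>"
      using t by (auto simp: ennreal_mult_top)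
    then show ?thesis by (simp add: ennreal_mult_less_top less_top)
  qed
  finally show ?thesis .
qed

lemma total_mass_pos: "total_mass \<noteq> 0"
proof
  assume "total_mass = 0"
  then have "AE x in lborel. ennreal (exp (- U x)) = 0"
    unfolding total_mass_def by (subst (asm) nn_integral_0_iff_AE) auto
  then have "AE x in (lborel :: 'a measure). False" by simp
  then have "(UNIV :: 'a set) \<in> null_sets lborel"
    by (subst (asm) AE_iff_null) auto
  then show False using null_setsD1 by fastforce
qed

definition Zu :: real where "Zu = enn2real total_mass"

lemma Zu_pos: "0 < Zu"
  using total_mass_pos total_mass_finite by (simp add: Zu_def enn2real_positive_iff zero_less_iff_neq_zero)

lemma total_mass_eq: "total_mass = ennreal Zu"
  using total_mass_finite by (simp add: Zu_def)

definition pos :: "'a measure" where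
  "pos = density lborel (\<lambda>x. ennreal (1 / Zu * exp (- U x)))"

lemma sets_pos [simp, measurable_cong]: "sets pos = sets borel"
  by (simp add: pos_def)

lemma prob_space_pos: "prob_space pos"
proof
  have "emeasure pos (space pos) = (\<integral>\<^sup>+x. ennreal (1 / Zu) * ennreal (exp (- U x)) \<partial>lborel)"
    unfolding pos_def using Zu_pos by (simp add: emeasure_density ennreal_mult[symmetric])
  also have "\<dots> = ennreal (1 / Zu) * total_mass"
    by (simp add: nn_integral_cmult total_mass_def)
  also have "\<dots> = 1" using Zu_pos by (simp add: total_mass_eq ennreal_mult[symmetric])
  finally show "emeasure pos (space pos) = 1" .
qed

lemma gibbs_eq_pair: "gibbs U = pos \<Otimes>\<^sub>M std_gaussian"
  and gibbs_eq_density: "gibbs U = density lborel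
    (\<lambda>z. ennreal (gauss_const TYPE('a) / Zu * exp (- (U (fst z) + (norm (snd z))\<^sup>2 / 2))))"
proof -
  define k where "k = gauss_const TYPE('a)"
  have k: "0 < k" by (simp add: k_def gauss_const_pos)
  have ee: "exp (- (a + b)) = exp (- a) * exp (- b)" for a b :: real
    by (simp add: exp_add[symmetric])
  have 1: "pos \<Otimes>\<^sub>M (std_gaussian :: 'a measure) = density lborel (\<lambda>z. ennreal (k / Zu * exp (- (U (fst z) + (norm (snd z))\<^sup>2 / 2))))"
  proof -
    have "pos \<Otimes>\<^sub>M (std_gaussian :: 'a measure) = density (lborel \<Otimes>\<^sub>M lborel)
        (\<lambda>(x, y). ennreal (1 / Zu * exp (- U x)) * ennreal (gauss_const TYPE('a) * exp (- ((norm y)\<^sup>2 / 2))))"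
      unfolding pos_def std_gaussian_eq
      by (intro pair_measure_density)
        (auto intro: lborel.sigma_finite_measure_axioms prob_space_imp_sigma_finite
          simp: std_gaussian_eq[symmetric] prob_space_std_gaussian)
    also have "\<dots> = density lborel (\<lambda>z. ennreal (k / Zu * exp (- (U (fst z) + (norm (snd z))\<^sup>2 / 2))))"
      unfolding lborel_prod using Zu_pos k
      by (intro arg_cong[where f = "density lborel"] ext)
        (simp add: case_prod_beta ennreal_mult[symmetric] k_def[symmetric] mult_exp_exp)
    finally show ?thesis .
  qed
  have w: "gibbs_weight U z = exp (- (U (fst z) + (norm (snd z))\<^sup>2 / 2))" for z
    by (simp add: gibbs_weight_def case_prod_beta)
  have "prob_space (pos \<Otimes>\<^sub>M (std_gaussian :: 'a measure))"
  proof -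
    interpret pos: prob_space pos by (rule prob_space_pos)
    interpret pair_prob_space pos "std_gaussian :: 'a measure" ..
    show ?thesis by unfold_locales
  qed
  then have "1 = emeasure (pos \<Otimes>\<^sub>M (std_gaussian :: 'a measure)) (space (pos \<Otimes>\<^sub>M (std_gaussian :: 'a measure)))"
    by (simp add: prob_space.emeasure_space_1)
  also have "\<dots> = (\<integral>\<^sup>+z. ennreal (k / Zu) * ennreal (gibbs_weight U z) \<partial>lborel)"
    unfolding 1 w using k Zu_pos by (simp add: emeasure_density ennreal_mult[symmetric])
  also have "\<dots> = ennreal (k / Zu) * (\<integral>\<^sup>+z. ennreal (gibbs_weight U z) \<partial>lborel)"
    unfolding w by (intro nn_integral_cmult) auto
  \<comment> \<open>The normalising integral of \<open>gibbs_weight\<close> is not computed; it is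
    read off from the product of two probability measures having mass one.\<close>
  finally have N: "ennreal (k / Zu) * (\<integral>\<^sup>+z. ennreal (gibbs_weight U z) \<partial>lborel) = 1" by simp
  have "(\<integral>\<^sup>+z. ennreal (gibbs_weight U z) \<partial>lborel) = ennreal (Zu / k)"
  proof -
    have "(\<integral>\<^sup>+z. ennreal (gibbs_weight U z) \<partial>lborel) = ennreal (Zu / k) * (ennreal (k / Zu) * (\<integral>\<^sup>+z. ennreal (gibbs_weight U z) \<partial>lborel))"
      using k Zu_pos by (simp add: mult.assoc[symmetric] ennreal_mult[symmetric])
    then show ?thesis unfolding N by simp
  qed
  moreover have "(LINT w|lborel. gibbs_weight U w) = enn2real (\<integral>\<^sup>+z. ennreal (gibbs_weight U z) \<partial>lborel)"
    unfolding w by (intro integral_eq_nn_integral) auto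
  ultimately have Z: "(LINT w|lborel. gibbs_weight U w) = Zu / k"
    using k Zu_pos by simp
  show 2: "gibbs U = density lborel
    (\<lambda>z. ennreal (gauss_const TYPE('a) / Zu * exp (- (U (fst z) + (norm (snd z))\<^sup>2 / 2))))"
  proof -
    have wk: "gibbs_weight U z / (Zu / k) = k / Zu * exp (- (U (fst z) + (norm (snd z))\<^sup>2 / 2))" for z
      unfolding w using k Zu_pos by simp
    show ?thesis unfolding gibbs_def Z unfolding wk unfolding k_def ..
  qed
  show "gibbs U = pos \<Otimes>\<^sub>M std_gaussian" unfolding 1 2 k_def ..
qed

lemma sets_gibbs [simp, measurable_cong]: "sets (gibbs U) = sets borel"
  by (simp add: gibbs_def)

lemma space_gibbs [simp]: "space (gibbs U) = UNIV"
  by (simp add: gibbs_def)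

lemma prob_space_gibbs: "prob_space (gibbs U)"
proof -
  interpret pos: prob_space pos by (rule prob_space_pos)
  interpret pair_prob_space pos "std_gaussian :: 'a measure" ..
  show ?thesis unfolding gibbs_eq_pair by unfold_locales
qed

lemma nn_integral_gibbs:
  assumes [measurable]: "F \<in> borel_measurable borel"
  shows "(\<integral>\<^sup>+z. F z \<partial>gibbs U) = (\<integral>\<^sup>+x. \<integral>\<^sup>+v. F (x, v) \<partial>std_gaussian \<partial>pos)"
proof -
  have "F \<in> borel_measurable (pos \<Otimes>\<^sub>M std_gaussian)"
    using assms by (simp add: gibbs_eq_pair[symmetric])
  then show ?thesis
    unfolding gibbs_eq_pair by (rule std_gaussian.nn_integral_fst[symmetric])
qed

lemma gibbs_moment_snd:
  assumes "1 \<le> p"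
  shows "(\<integral>\<^sup>+z. ennreal (norm (snd z) powr p) \<partial>gibbs U) \<le> ennreal ((real DIM('a) + max (p - 2) 0) powr (p / 2))"
proof -
  interpret pos: prob_space pos by (rule prob_space_pos)
  show ?thesis
    using std_gaussian_moment[OF assms, where 'a='a] pos.emeasure_space_1
    by (subst nn_integral_gibbs) auto
qed

lemma gibbs_moment_fst:
  assumes "1 \<le> p" "g xs = 0"
  shows "(\<integral>\<^sup>+z. ennreal (norm (fst z - xs) powr p) \<partial>gibbs U) \<le> ennreal (((real DIM('a) + max (p - 2) 0) / m) powr (p / 2))"
proof -
  have "(\<integral>\<^sup>+z. ennreal (norm (fst z - xs) powr p) \<partial>gibbs U) = (\<integral>\<^sup>+x. ennreal (norm (x - xs) powr p) \<partial>pos)"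
    using std_gaussian.emeasure_space_1[where 'a='a] by (subst nn_integral_gibbs) auto
  also have "\<dots> \<le> ennreal (((real DIM('a) + max (p - 2) 0) / m) powr (p / 2))"
    unfolding pos_def using assms Zu_pos prob_space_pos
    by (intro moment_bound) (auto simp: pos_def)
  finally show ?thesis .
qed

end

context obabo
begin

section \<open>Invariance under Verlet steps, their limit, and the refreshment\<close>

lemma nn_integral_verlet:
  assumes [measurable]: "F \<in> borel_measurable borel"
  shows "(\<integral>\<^sup>+z. F (verlet h z) \<partial>lborel) = (\<integral>\<^sup>+z. F z \<partial>lborel)"
proof -
  define A where "A z = (fst z, snd z + (- ((h / 2) *\<^sub>R g (fst z))))" for z :: "'a \<times> 'a"
  define B where "B z = (fst z + h *\<^sub>R snd z, snd z)" for z :: "'a \<times> 'a"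
  have [measurable]: "A \<in> borel_measurable borel" "B \<in> borel_measurable borel"
    unfolding A_def B_def
    by (intro borel_measurable_continuous_onI continuous_intros continuous_on_compose2[OF continuous_g]; simp)+
  have A: "(\<integral>\<^sup>+z. H (A z) \<partial>lborel) = (\<integral>\<^sup>+z. H z \<partial>lborel)" if "H \<in> borel_measurable borel" for H
    unfolding A_def using that by (intro nn_integral_shear_snd) auto
  have B: "(\<integral>\<^sup>+z. H (B z) \<partial>lborel) = (\<integral>\<^sup>+z. H z \<partial>lborel)" if "H \<in> borel_measurable borel" for H
    unfolding B_def using that by (intro nn_integral_shear_fst) auto
  \<comment> \<open>Kick, drift, kick: three shears, whatever the regularity of
    \<open>g\<close>.\<close>
  have "verlet h z = A (B (A z))" for z
    by (simp add: verlet_def Let_def A_def B_def)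
  then have "(\<integral>\<^sup>+z. F (verlet h z) \<partial>lborel) = (\<integral>\<^sup>+z. (\<lambda>z. F (A (B z))) (A z) \<partial>lborel)" by simp
  also have "\<dots> = (\<integral>\<^sup>+z. F (A (B z)) \<partial>lborel)" by (intro A) measurable
  also have "\<dots> = (\<integral>\<^sup>+z. F (A z) \<partial>lborel)" using B[of "\<lambda>z. F (A z)"] by simp
  also have "\<dots> = (\<integral>\<^sup>+z. F z \<partial>lborel)" by (intro A) measurable
  finally show ?thesis .
qed

lemma nn_integral_flow:
  assumes "F \<in> borel_measurable borel"
  shows "(\<integral>\<^sup>+z. F (flow k h z) \<partial>lborel) = (\<integral>\<^sup>+z. F z \<partial>lborel)"
  using assms
proof (induction k arbitrary: h F)
  case 0
  then show ?case by (simp add: nn_integral_verlet)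
next
  case (Suc k)
  note [measurable] = Suc.prems
  have "(\<integral>\<^sup>+z. F (flow (Suc k) h z) \<partial>lborel) = (\<integral>\<^sup>+z. (\<lambda>z. F (flow k (h / 2) z)) (flow k (h / 2) z) \<partial>lborel)"
    by simp
  also have "\<dots> = (\<integral>\<^sup>+z. F (flow k (h / 2) z) \<partial>lborel)" by (intro Suc.IH) measurable
  also have "\<dots> = (\<integral>\<^sup>+z. F z \<partial>lborel)" by (intro Suc.IH) measurable
  finally show ?case .
qed

definition gibbs_dens :: "'a \<times> 'a \<Rightarrow> real" where
  "gibbs_dens z = gauss_const TYPE('a) / Zu * exp (- energy z)"

lemma gibbs_dens_nonneg: "0 \<le> gibbs_dens z"
  using Zu_pos gauss_const_pos[where 'a='a] by (simp add: gibbs_dens_def)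

lemma measurable_energy [measurable]: "energy \<in> borel_measurable borel"
  unfolding energy_def[abs_def] by measurable

lemma measurable_gibbs_dens [measurable]: "gibbs_dens \<in> borel_measurable borel"
  unfolding gibbs_dens_def[abs_def] by measurable

lemma gibbs_density: "gibbs U = density lborel (\<lambda>z. ennreal (gibbs_dens z))"
  by (simp add: gibbs_eq_density gibbs_dens_def energy_def)

text \<open>The approximations preserve Lebesgue measure and asymptotically the energy, so Fatou's lemma
  on open sets gives one inequality between probability measures, which forces equality.\<close>

lemma distr_gibbs_Flow: "distr (gibbs U) borel Flow = gibbs U"
proof -
  interpret G: prob_space "gibbs U" by (rule prob_space_gibbs)
  define D where "D = distr (gibbs U) borel Flow"
  have [measurable]: "Flow \<in> measurable (gibbs U) borel" by measurable
  interpret D: prob_space D unfolding D_def by (rule G.prob_space_distr) measurable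
  have [simp]: "sets D = sets borel" "space D = UNIV" by (simp_all add: D_def)
  have op: "emeasure D S \<le> emeasure (gibbs U) S" if "open S" for S
  proof -
    have [measurable]: "S \<in> sets borel" using that by simp
    have "emeasure D S = (\<integral>\<^sup>+z. indicator S z \<partial>D)" by simp
    also have "\<dots> = (\<integral>\<^sup>+z. indicator S (Flow z) \<partial>gibbs U)"
      unfolding D_def by (subst nn_integral_distr) auto
    also have "\<dots> = (\<integral>\<^sup>+z. ennreal (gibbs_dens z) * indicator S (Flow z) \<partial>lborel)"
      unfolding gibbs_density by (subst nn_integral_density) auto
    also have "\<dots> \<le> (\<integral>\<^sup>+z. liminf (\<lambda>k. ennreal (gibbs_dens (flow k \<delta> z)) * indicator S (flow k \<delta> z)) \<partial>lborel)"
    proof (intro nn_integral_mono)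
      fix z
      show "ennreal (gibbs_dens z) * indicator S (Flow z)
          \<le> liminf (\<lambda>k. ennreal (gibbs_dens (flow k \<delta> z)) * indicator S (flow k \<delta> z))"
      proof (cases "Flow z \<in> S")
        case True
        have "(\<lambda>k. gibbs_dens (flow k \<delta> z)) \<longlonglongrightarrow> gibbs_dens z"
          unfolding gibbs_dens_def by (intro tendsto_intros flow_energy_tendsto)
        then have l: "(\<lambda>k. ennreal (gibbs_dens (flow k \<delta> z))) \<longlonglongrightarrow> ennreal (gibbs_dens z)"
          by (rule tendsto_ennrealI)
        have "\<forall>\<^sub>F k in sequentially. flow k \<delta> z \<in> S"
          using flow_tendsto \<open>open S\<close> True by (rule topological_tendstoD)
        then have "\<forall>\<^sub>F k in sequentially. ennreal (gibbs_dens (flow k \<delta> z))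
            = ennreal (gibbs_dens (flow k \<delta> z)) * indicator S (flow k \<delta> z)"
          by (rule eventually_mono) auto
        then have "(\<lambda>k. ennreal (gibbs_dens (flow k \<delta> z)) * indicator S (flow k \<delta> z)) \<longlonglongrightarrow> ennreal (gibbs_dens z)"
          using l by (rule Lim_transform_eventually[rotated])
        then have "liminf (\<lambda>k. ennreal (gibbs_dens (flow k \<delta> z)) * indicator S (flow k \<delta> z)) = ennreal (gibbs_dens z)"
          by (intro lim_imp_Liminf) auto
        then show ?thesis using True by simp
      qed simp
    qed
    also have "\<dots> \<le> liminf (\<lambda>k. \<integral>\<^sup>+z. ennreal (gibbs_dens (flow k \<delta> z)) * indicator S (flow k \<delta> z) \<partial>lborel)"
      by (intro nn_integral_liminf) measurable
    also have "\<dots> = liminf (\<lambda>k. \<integral>\<^sup>+z. ennreal (gibbs_dens z) * indicator S z \<partial>lborel)"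
      by (subst nn_integral_flow[where F = "\<lambda>z. ennreal (gibbs_dens z) * indicator S z"]) auto
    also have "\<dots> = emeasure (gibbs U) S"
      unfolding gibbs_density by (simp add: Liminf_const emeasure_density)
    finally show ?thesis .
  qed
  \<comment> \<open>Outer regularity extends the inequality from open to Borel sets; applied to a
    set and to its complement it becomes an equality, both total masses being one.\<close>
  have le: "emeasure D B \<le> emeasure (gibbs U) B" if B: "B \<in> sets borel" for B
  proof -
    have "emeasure D B \<le> (INF S\<in>{S. B \<subseteq> S \<and> open S}. emeasure (gibbs U) S)"
    proof (rule INF_greatest)
      fix S assume "S \<in> {S. B \<subseteq> S \<and> open S}"
      then have S: "B \<subseteq> S" "open S" by auto
      then have "emeasure D B \<le> emeasure D S" by (intro emeasure_mono) auto
      then show "emeasure D B \<le> emeasure (gibbs U) S" using op[OF S(2)] by simp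
    qed
    also have "\<dots> = emeasure (gibbs U) B"
      using B by (subst outer_regular[of "gibbs U" B]) auto
    finally show ?thesis .
  qed
  show ?thesis
    unfolding D_def[symmetric]
  proof (rule measure_eqI)
    fix A assume "A \<in> sets D"
    then have A: "A \<in> sets borel" "- A \<in> sets borel" by (auto simp: borel_comp)
    have 1: "measure D A \<le> measure (gibbs U) A"
      using le[OF A(1)] by (simp add: D.emeasure_eq_measure G.emeasure_eq_measure)
    have 2: "measure D (- A) \<le> measure (gibbs U) (- A)"
      using le[OF A(2)] by (simp add: D.emeasure_eq_measure G.emeasure_eq_measure)
    have "measure D (- A) = 1 - measure D A" "measure (gibbs U) (- A) = 1 - measure (gibbs U) A"
      using D.prob_compl[of A] G.prob_compl[of A] A by (simp_all add: Compl_eq_Diff_UNIV)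
    then show "emeasure D A = emeasure (gibbs U) A"
      using 1 2 by (simp add: D.emeasure_eq_measure G.emeasure_eq_measure)
  qed simp
qed

lemma nn_integral_gibbs_Flow:
  assumes [measurable]: "F \<in> borel_measurable borel"
  shows "(\<integral>\<^sup>+z. F (Flow z) \<partial>gibbs U) = (\<integral>\<^sup>+z. F z \<partial>gibbs U)"
  by (subst (2) distr_gibbs_Flow[symmetric]) (simp add: nn_integral_distr)

definition ou :: "'a \<times> 'a \<Rightarrow> 'a \<Rightarrow> 'a \<times> 'a" where
  "ou z w = (fst z, \<eta> *\<^sub>R snd z + \<sigma> *\<^sub>R w)"

lemma measurable_ou [measurable (raw)]:
  assumes [measurable]: "f \<in> borel_measurable M" "h \<in> borel_measurable M"
  shows "(\<lambda>x. ou (f x) (h x)) \<in> borel_measurable M"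
  unfolding ou_def by measurable

text \<open>For fixed position, refreshment is the first coordinate of a rotation of two independent
  Gaussians, since \<open>\<sigma>\<^sup>2 + \<eta>\<^sup>2 = 1\<close>.\<close>

lemma nn_integral_gibbs_ou:
  assumes [measurable]: "F \<in> borel_measurable borel"
  shows "(\<integral>\<^sup>+z. \<integral>\<^sup>+w. F (ou z w) \<partial>std_gaussian \<partial>gibbs U) = (\<integral>\<^sup>+z. F z \<partial>gibbs U)"
proof -
  have "(\<integral>\<^sup>+v. \<integral>\<^sup>+w. F (x, \<eta> *\<^sub>R v + \<sigma> *\<^sub>R w) \<partial>std_gaussian \<partial>std_gaussian) = (\<integral>\<^sup>+v. F (x, v) \<partial>std_gaussian)" for x
    using sigma_pos sigma_sq by (intro nn_integral_std_gaussian_rotate) auto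
  then show ?thesis
    by (subst (1 2) nn_integral_gibbs) (simp_all add: ou_def)
qed

text \<open>Identifies the explicit recursion with the factorisation; in terms of the half-kicked
  momentum \<open>p\<close>, the new position is one drift and the second gradient is the closing
  half kick.\<close>

lemma obabo_step_eq: "obabo_step \<delta> \<gamma> U z (w, w') = ou (verlet \<delta> (ou z w)) w'"
proof -
  have \<sigma>: "sqrt (1 - (eta \<delta> \<gamma>)\<^sup>2) = \<sigma>" by (simp add: \<sigma>_def \<eta>_def)
  define p where "p = \<eta> *\<^sub>R snd z + \<sigma> *\<^sub>R w - (\<delta> / 2) *\<^sub>R g (fst z)"
  have x: "fst z + \<delta> *\<^sub>R (\<eta> *\<^sub>R snd z + \<sigma> *\<^sub>R w) - (\<delta>\<^sup>2 / 2) *\<^sub>R g (fst z) = fst z + \<delta> *\<^sub>R p"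
    by (simp add: p_def algebra_simps power2_eq_square)
  have v: "\<eta>\<^sup>2 *\<^sub>R snd z - (\<delta> * \<eta> / 2) *\<^sub>R (g (fst z) + g1) + \<sigma> *\<^sub>R (\<eta> *\<^sub>R w + w')
      = \<eta> *\<^sub>R (p - (\<delta> / 2) *\<^sub>R g1) + \<sigma> *\<^sub>R w'" for g1
    by (simp add: p_def algebra_simps power2_eq_square)
  show ?thesis
    unfolding obabo_step_def Let_def case_prod_beta fst_conv snd_conv \<eta>_def[symmetric] grad_eq
    unfolding \<sigma>_def[symmetric] x v
    by (simp add: ou_def verlet_def Let_def p_def)
qed

lemma measurable_verlet [measurable]: "verlet h \<in> borel_measurable borel"
  using continuous_verlet by (rule borel_measurable_continuous_onI)

end

section \<open>The transition operator\<close>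

text \<open>Stands in for Minkowski's inequality below. A zero argument is treated apart by
  \<open>c powr p \<le> c\<close> on the unit interval, the rest by convexity on the open
  half-line.\<close>

lemma powr_convex_comb:
  fixes p :: real
  assumes p: "1 \<le> p" and ab: "0 \<le> a" "0 \<le> b" "a + b = 1" and xy: "0 \<le> x" "0 \<le> y"
  shows "(a * x + b * y) powr p \<le> a * x powr p + b * y powr p"
proof -
  have le: "c powr p \<le> c" if "0 \<le> c" "c \<le> 1" for c :: real
  proof (cases "c = 0")
    case False
    then show ?thesis using powr_mono'[of 1 p c] that p by simp
  qed simp
  have zero: "(c * z) powr p \<le> c * z powr p" if "0 \<le> c" "c \<le> 1" "0 \<le> z" for c z :: real
    using mult_right_mono[OF le[OF that(1,2)], of "z powr p"] that by (simp add: powr_mult)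
  show ?thesis
  proof (cases "x = 0 \<or> y = 0")
    case True
    then show ?thesis using zero[of a x] zero[of b y] ab xy p by auto
  next
    case False
    then have "x \<in> {0<..}" "y \<in> {0<..}" using xy by auto
    then have "((1 - b) * x + b * y) powr p \<le> (1 - b) * x powr p + b * y powr p"
      using convex_onD[OF powr_convex[OF p], of b x y] ab by simp
    moreover have "1 - b = a" using ab by simp
    ultimately show ?thesis by metis
  qed
qed

context obabo
begin

text \<open>One step with its two noises as arguments, so that synchronous coupling means equal
  arguments.\<close>

definition stp :: "'a \<times> 'a \<Rightarrow> 'a \<Rightarrow> 'a \<Rightarrow> 'a \<times> 'a" where
  "stp z w w' = ou (verlet \<delta> (ou z w)) w'"

lemma measurable_stp [measurable (raw)]:
  assumes [measurable]: "f \<in> borel_measurable M" "h \<in> borel_measurable M" "k \<in> borel_measurable M"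
  shows "(\<lambda>x. stp (f x) (h x) (k x)) \<in> borel_measurable M"
  unfolding stp_def by measurable

lemma fst_stp: "fst (stp z w w') = fst z + (\<delta> * \<eta>) *\<^sub>R snd z + (\<delta> * \<sigma>) *\<^sub>R w - (\<delta>\<^sup>2 / 2) *\<^sub>R g (fst z)"
  and snd_stp: "snd (stp z w w') = \<eta>\<^sup>2 *\<^sub>R snd z - (\<delta> * \<eta> / 2) *\<^sub>R (g (fst z) + g (fst (stp z w w')))
    + (\<eta> * \<sigma>) *\<^sub>R w + \<sigma> *\<^sub>R w'"
  by (simp_all add: stp_def ou_def verlet_def Let_def algebra_simps power2_eq_square)

definition "\<rho> = sqrt (1 - \<delta> * \<kappa>)"

lemma rho_pos: "0 < \<rho>" and rho_lt_1: "\<rho> < 1" and rho_sq: "\<rho>\<^sup>2 = 1 - \<delta> * \<kappa>"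
  and one_minus_rho_ge: "\<delta> * \<kappa> / 2 \<le> 1 - \<rho>"
proof -
  have dk: "0 < \<delta> * \<kappa>" "\<delta> * \<kappa> \<le> 1 / 1000" using delta_pos kappa_pos delta_kappa_le by auto
  then show 1: "0 < \<rho>" and 2: "\<rho> < 1" and 3: "\<rho>\<^sup>2 = 1 - \<delta> * \<kappa>" by (simp_all add: \<rho>_def)
  have "(1 - \<rho>) * (1 + \<rho>) = \<delta> * \<kappa>" using 3 by (simp add: algebra_simps power2_eq_square)
  moreover have "(1 - \<rho>) * (1 + \<rho>) \<le> (1 - \<rho>) * 2" using 2 by (intro mult_left_mono) auto
  ultimately show "\<delta> * \<kappa> / 2 \<le> 1 - \<rho>" by simp
qed

text \<open>The noise cancels in the difference of the two new states, which leaves exactly the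
  situation of \<open>step_contraction_aux\<close>.\<close>

lemma stp_contraction: "nb (stp z w w' - stp z' w w') \<le> \<rho> * nb (z - z')"
proof -
  define x v w0 where "x = fst z - fst z'" and "v = snd z - snd z'" and "w0 = g (fst z) - g (fst z')"
  define y y' where "y = fst (stp z w w')" and "y' = fst (stp z' w w')"
  define w1 where "w1 = g y - g y'"
  have x1: "y - y' = x + (\<delta> * \<eta>) *\<^sub>R v - (\<delta>\<^sup>2 / 2) *\<^sub>R w0"
    by (simp add: y_def y'_def fst_stp x_def v_def w0_def algebra_simps)
  have v1: "snd (stp z w w') - snd (stp z' w w') = \<eta>\<^sup>2 *\<^sub>R v - (\<delta> * \<eta> / 2) *\<^sub>R (w0 + w1)"
    unfolding snd_stp y_def[symmetric] y'_def[symmetric] w1_def v_def w0_def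
    by (simp add: algebra_simps)
  have "(nb (y - y', \<eta>\<^sup>2 *\<^sub>R v - (\<delta> * \<eta> / 2) *\<^sub>R (w0 + w1)))\<^sup>2 \<le> (1 - \<delta> * \<kappa>) * (nb (x, v))\<^sup>2"
    unfolding x1
  proof (rule step_contraction_aux)
    show "m * (norm x)\<^sup>2 \<le> x \<bullet> w0" "(norm w0)\<^sup>2 \<le> L * (x \<bullet> w0)" "norm w0 \<le> L * norm x"
      unfolding x_def w0_def by (rule mono cocoercive lip)+
    show "m * (norm (x + (\<delta> * \<eta>) *\<^sub>R v - (\<delta>\<^sup>2 / 2) *\<^sub>R w0))\<^sup>2 \<le> (x + (\<delta> * \<eta>) *\<^sub>R v - (\<delta>\<^sup>2 / 2) *\<^sub>R w0) \<bullet> w1"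
      "(norm w1)\<^sup>2 \<le> L * ((x + (\<delta> * \<eta>) *\<^sub>R v - (\<delta>\<^sup>2 / 2) *\<^sub>R w0) \<bullet> w1)"
      "norm w1 \<le> L * norm (x + (\<delta> * \<eta>) *\<^sub>R v - (\<delta>\<^sup>2 / 2) *\<^sub>R w0)"
      unfolding x1[symmetric] w1_def by (rule mono cocoercive lip)+
  qed
  moreover have s: "stp z w w' - stp z' w w' = (y - y', \<eta>\<^sup>2 *\<^sub>R v - (\<delta> * \<eta> / 2) *\<^sub>R (w0 + w1))"
    using v1 by (simp add: prod_eq_iff y_def y'_def)
  moreover have zz: "z - z' = (x, v)" by (simp add: prod_eq_iff x_def v_def)
  ultimately have "(nb (stp z w w' - stp z' w w'))\<^sup>2 \<le> (\<rho> * nb (z - z'))\<^sup>2"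
    unfolding power_mult_distrib rho_sq s zz by simp
  then show ?thesis by (rule power2_le_imp_le) (simp add: rho_pos less_imp_le)
qed

text \<open>The transition operator on nonnegative extended functions, where no integrability has to
  be carried along.\<close>

definition P :: "('a \<times> 'a \<Rightarrow> ennreal) \<Rightarrow> 'a \<times> 'a \<Rightarrow> ennreal" where
  "P F z = (\<integral>\<^sup>+w. \<integral>\<^sup>+w'. F (stp z w w') \<partial>std_gaussian \<partial>std_gaussian)"

lemma measurable_P [measurable]:
  assumes [measurable]: "F \<in> borel_measurable borel"
  shows "P F \<in> borel_measurable borel"
  unfolding P_def[abs_def] by measurable

text \<open>Turns the invariance equation for \<open>bind\<close> into an identity of integrals.
  Joint measurability of \<open>stp\<close> in state and noise makes the kernel measurable.\<close>

lemma nn_integral_invariant: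
  assumes inv: "invariant_prob (obabo_kernel \<delta> \<gamma> U) \<mu>" and F: "F \<in> borel_measurable borel"
  shows "(\<integral>\<^sup>+z. F z \<partial>\<mu>) = (\<integral>\<^sup>+z. P F z \<partial>\<mu>)"
proof -
  note F[measurable]
  interpret prob_space \<mu> using inv by (simp add: invariant_prob_def)
  have [measurable_cong, simp]: "sets \<mu> = sets borel" using inv by (simp add: invariant_prob_def)
  have [measurable]: "case_prod (obabo_step \<delta> \<gamma> U) \<in> measurable (\<mu> \<Otimes>\<^sub>M (std_gaussian \<Otimes>\<^sub>M std_gaussian)) borel"
  proof -
    have "case_prod (obabo_step \<delta> \<gamma> U) = (\<lambda>x. stp (fst x) (fst (snd x)) (snd (snd x)))"
      by (auto simp: fun_eq_iff stp_def obabo_step_eq)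
    then show ?thesis by simp
  qed
  have K: "obabo_kernel \<delta> \<gamma> U \<in> measurable \<mu> (subprob_algebra borel)"
    unfolding obabo_kernel_def[abs_def]
  proof (rule measurable_distr2)
    show "(\<lambda>z. std_gaussian \<Otimes>\<^sub>M std_gaussian) \<in> measurable \<mu> (subprob_algebra (std_gaussian \<Otimes>\<^sub>M std_gaussian))"
      by (intro measurable_const) (simp add: space_subprob_algebra std_gaussian_pair.P.subprob_space_axioms)
  qed measurable
  have "(\<integral>\<^sup>+z. F z \<partial>\<mu>) = (\<integral>\<^sup>+z. F z \<partial>(\<mu> \<bind> obabo_kernel \<delta> \<gamma> U))"
    using inv by (simp add: invariant_prob_def)
  also have "\<dots> = (\<integral>\<^sup>+z. \<integral>\<^sup>+y. F y \<partial>obabo_kernel \<delta> \<gamma> U z \<partial>\<mu>)"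
    using K F by (rule nn_integral_bind[rotated])
  also have "\<dots> = (\<integral>\<^sup>+z. P F z \<partial>\<mu>)"
  proof (intro nn_integral_cong)
    fix z
    have e: "obabo_step \<delta> \<gamma> U z = (\<lambda>x. stp z (fst x) (snd x))"
      by (auto simp: fun_eq_iff stp_def obabo_step_eq)
    have "(\<integral>\<^sup>+y. F y \<partial>obabo_kernel \<delta> \<gamma> U z) = (\<integral>\<^sup>+x. F (stp z (fst x) (snd x)) \<partial>(std_gaussian \<Otimes>\<^sub>M std_gaussian))"
      unfolding obabo_kernel_def e by (subst nn_integral_distr) auto
    also have "\<dots> = P F z"
      unfolding P_def by (subst std_gaussian.nn_integral_fst[symmetric]) auto
    finally show "(\<integral>\<^sup>+y. F y \<partial>obabo_kernel \<delta> \<gamma> U z) = P F z" .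
  qed
  finally show ?thesis .
qed

section \<open>Finite moments of the invariant measure\<close>

lemma stp_zero_bound: "\<exists>a b. 0 \<le> a \<and> 0 \<le> b \<and> (\<forall>w w'. nb (stp 0 w w') \<le> a + b * norm w + b * norm w')"
proof -
  define A where "A = \<delta>\<^sup>2 / 2 * norm (g 0)"
  have n1: "norm (fst (stp 0 w w')) \<le> \<delta> * \<sigma> * norm w + A" for w w'
    unfolding fst_stp A_def using delta_pos sigma_pos
    by (intro order_trans[OF norm_triangle_ineq4]) auto
  define B where "B = \<delta> * \<eta> / 2"
  have B: "0 \<le> B" using delta_pos eta_pos by (simp add: B_def)
  have n2: "norm (snd (stp 0 w w')) \<le> B * (2 * norm (g 0) + L * (\<delta> * \<sigma> * norm w + A)) + \<eta> * \<sigma> * norm w + \<sigma> * norm w'" for w w'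
  proof -
    define y where "y = fst (stp 0 w w')"
    have "norm (g y) \<le> norm (g 0) + L * norm y"
      using norm_triangle_ineq2[of "g y" "g 0"] lip[of y 0] by simp
    also have "\<dots> \<le> norm (g 0) + L * (\<delta> * \<sigma> * norm w + A)"
      using n1 L_pos by (simp add: y_def)
    finally have "norm (g 0 + g y) \<le> 2 * norm (g 0) + L * (\<delta> * \<sigma> * norm w + A)"
      using norm_triangle_ineq[of "g 0" "g y"] by linarith
    then have *: "norm (B *\<^sub>R (g 0 + g y)) \<le> B * (2 * norm (g 0) + L * (\<delta> * \<sigma> * norm w + A))"
      using B by (simp add: mult_left_mono)
    have "snd (stp 0 w w') = (- (B *\<^sub>R (g 0 + g y)) + (\<eta> * \<sigma>) *\<^sub>R w) + \<sigma> *\<^sub>R w'"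
      unfolding snd_stp y_def[symmetric] by (simp add: B_def)
    then have "norm (snd (stp 0 w w')) \<le> norm (B *\<^sub>R (g 0 + g y)) + norm ((\<eta> * \<sigma>) *\<^sub>R w) + norm (\<sigma> *\<^sub>R w')"
      by (metis norm_triangle_mono norm_triangle_ineq norm_minus_cancel order_refl)
    then show ?thesis using * eta_pos sigma_pos by simp
  qed
  define a b where "a = A + B * (2 * norm (g 0) + L * A) / \<omega>"
    and "b = \<delta> * \<sigma> + (B * (L * (\<delta> * \<sigma>)) + \<eta> * \<sigma> + \<sigma>) / \<omega>"
  have pos: "0 \<le> a" "0 \<le> b" "\<sigma> / \<omega> \<le> b"
    using delta_pos sigma_pos eta_pos omega_pos L_pos B
    by (auto simp: a_def b_def A_def divide_right_mono add_divide_distrib)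
  have "nb (stp 0 w w') \<le> a + b * norm w + b * norm w'" for w w'
  proof -
    have "nb (stp 0 w w') \<le> norm (fst (stp 0 w w')) + norm (snd (stp 0 w w')) / \<omega>" by (rule nb_le)
    also have "\<dots> \<le> (\<delta> * \<sigma> * norm w + A) + (B * (2 * norm (g 0) + L * (\<delta> * \<sigma> * norm w + A)) + \<eta> * \<sigma> * norm w + \<sigma> * norm w') / \<omega>"
      using n1 n2 omega_pos by (intro add_mono divide_right_mono) auto
    also have "\<dots> = a + (b - \<sigma> / \<omega>) * norm w + \<sigma> / \<omega> * norm w'"
      by (simp add: a_def b_def algebra_simps add_divide_distrib)
    also have "\<dots> \<le> a + b * norm w + b * norm w'"
      using pos sigma_pos omega_pos by (intro add_mono mult_right_mono) auto
    finally show ?thesis .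
  qed
  then show ?thesis using pos by blast
qed

lemma stp_zero_moment:
  assumes p: "1 \<le> p"
  shows "(\<integral>\<^sup>+w. \<integral>\<^sup>+w'. ennreal (nb (stp 0 w w') powr p) \<partial>std_gaussian \<partial>std_gaussian) < \<infinity>"
proof -
  obtain a b where ab: "0 \<le> a" "0 \<le> b" "\<And>w w'. nb (stp 0 w w') \<le> a + b * norm w + b * norm w'"
    using stp_zero_bound by blast
  have pt: "nb (stp 0 w w') powr p \<le> (3 * a) powr p + (3 * b) powr p * norm w powr p + (3 * b) powr p * norm w' powr p" for w w'
  proof -
    define M where "M = max (3 * a) (max (3 * b * norm w) (3 * b * norm w'))"
    have "nb (stp 0 w w') \<le> M" using ab(3)[of w w'] by (simp add: M_def)
    then have "nb (stp 0 w w') powr p \<le> M powr p" using p by (intro powr_mono2) auto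
    also have "\<dots> \<le> (3 * a) powr p + (3 * b * norm w) powr p + (3 * b * norm w') powr p"
      by (simp add: M_def max_def)
    finally show ?thesis using ab by (simp add: powr_mult)
  qed
  define N where "N = (\<integral>\<^sup>+v. ennreal (norm v powr p) \<partial>(std_gaussian :: 'a measure))"
  have N: "N < \<infinity>" unfolding N_def using std_gaussian_moment[OF p, where 'a='a] by (rule le_less_trans) simp
  let ?A = "ennreal ((3 * a) powr p)" and ?B = "ennreal ((3 * b) powr p)"
  have "(\<integral>\<^sup>+w. \<integral>\<^sup>+w'. ennreal (nb (stp 0 w w') powr p) \<partial>std_gaussian \<partial>std_gaussian)
      \<le> (\<integral>\<^sup>+w. \<integral>\<^sup>+w'. ((?A + ?B * ennreal (norm w powr p)) + ?B * ennreal (norm w' powr p)) \<partial>(std_gaussian :: 'a measure) \<partial>(std_gaussian :: 'a measure))"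
    using pt by (intro nn_integral_mono) (simp add: ennreal_mult[symmetric] ennreal_plus[symmetric] ennreal_leI del: ennreal_plus)
  also have "\<dots> = (?A + ?B * N) + ?B * N"
    using std_gaussian.emeasure_space_1[where 'a='a]
    by (simp add: nn_integral_add nn_integral_cmult N_def[symmetric])
  also have "\<dots> < \<infinity>" using N by (simp add: ennreal_mult_less_top)
  finally show ?thesis .
qed

text \<open>A contraction inequality for the moment itself would be void if the moment were
  infinite. It is therefore derived for truncated moments, iterated there, and the truncation is
  removed by Fatou.\<close>

lemma invariant_moment_finite:
  assumes inv: "invariant_prob (obabo_kernel \<delta> \<gamma> U) \<mu>" and p: "1 \<le> p"
  shows "(\<integral>\<^sup>+z. ennreal (nb z powr p) \<partial>\<mu>) < \<infinity>"
proof -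
  interpret prob_space \<mu> using inv by (simp add: invariant_prob_def)
  have [measurable_cong, simp]: "sets \<mu> = sets borel" using inv by (simp add: invariant_prob_def)
  \<comment> \<open>Any number strictly between \<rho> and 1 serves. If the noise term is below
    \<open>(r - \<rho>) * nb z\<close> the step still contracts by \<open>r\<close>; otherwise the
    noise dominates and the new norm is at most \<open>c\<close> times it.\<close>
  define r where "r = sqrt \<rho>"
  have r: "0 < r" "r < 1" "\<rho> < r"
  proof -
    show "0 < r" "r < 1" using rho_pos rho_lt_1 by (auto simp: r_def)
    have "\<rho> * \<rho> < \<rho> * 1" using rho_pos rho_lt_1 by (intro mult_strict_left_mono) auto
    then show "\<rho> < r" unfolding r_def using rho_pos by (intro real_less_rsqrt) (simp add: power2_eq_square)
  qed
  define c where "c = r / (r - \<rho>)"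
  have c: "0 \<le> c" using r by (simp add: c_def)
  define C where "C = (\<integral>\<^sup>+w. \<integral>\<^sup>+w'. ennreal (c powr p) * ennreal (nb (stp 0 w w') powr p) \<partial>std_gaussian \<partial>std_gaussian)"
  have Cfin: "C < \<infinity>"
    unfolding C_def using stp_zero_moment[OF p] by (simp add: nn_integral_cmult ennreal_mult_less_top)
  \<comment> \<open>Truncation at \<open>R\<close> is not homogeneous, hence the extra scale
    \<open>s\<close>: each use of invariance multiplies \<open>s\<close> by \<open>r\<close> and
    leaves \<open>R\<close> alone.\<close>
  define N where "N R s = (\<integral>\<^sup>+z. ennreal (min (s * nb z) R powr p) \<partial>\<mu>)" for R s
  have step: "N R s \<le> N R (r * s) + ennreal (s powr p) * C" if R: "0 \<le> R" and s: "0 \<le> s" for R s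
  proof -
    have pt: "min (s * nb (stp z w w')) R powr p \<le> min (r * s * nb z) R powr p + s powr p * (c powr p * nb (stp 0 w w') powr p)" for z w w'
    proof -
      define \<xi> where "\<xi> = nb (stp 0 w w')"
      have \<xi>: "0 \<le> \<xi>" by (simp add: \<xi>_def)
      have "nb (stp z w w') \<le> nb (stp z w w' - stp 0 w w') + nb (stp 0 w w')"
        using nb_triangle[of "stp z w w' - stp 0 w w'" "stp 0 w w'"] by simp
      then have le: "nb (stp z w w') \<le> \<rho> * nb z + \<xi>"
        using stp_contraction[of z w w' 0] by (simp add: \<xi>_def)
      have e: "s powr p * (c powr p * \<xi> powr p) = (s * (c * \<xi>)) powr p"
        using c \<xi> s by (simp add: powr_mult)
      show ?thesis
      proof (cases "\<xi> \<le> (r - \<rho>) * nb z")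
        case True
        then have "nb (stp z w w') \<le> r * nb z" using le by (simp add: left_diff_distrib)
        then have "s * nb (stp z w w') \<le> s * (r * nb z)" using s by (intro mult_left_mono)
        then have "min (s * nb (stp z w w')) R powr p \<le> min (r * s * nb z) R powr p"
          using p R s by (intro powr_mono2) (auto simp: mult_ac)
        then show ?thesis by (simp add: add_increasing2)
      next
        case False
        then have "nb z \<le> \<xi> / (r - \<rho>)" using r by (simp add: field_simps)
        then have "\<rho> * nb z + \<xi> \<le> \<rho> * (\<xi> / (r - \<rho>)) + \<xi>"
          using rho_pos by (intro add_right_mono mult_left_mono) auto
        also have "\<dots> = c * \<xi>" using r by (simp add: c_def field_simps)
        finally have "s * nb (stp z w w') \<le> s * (c * \<xi>)" using le s by (intro mult_left_mono) auto
        then have "min (s * nb (stp z w w')) R powr p \<le> (s * (c * \<xi>)) powr p"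
          using p R s by (intro powr_mono2) auto
        then show ?thesis unfolding \<xi>_def[symmetric] e by (simp add: add_increasing)
      qed
    qed
    have "N R s = (\<integral>\<^sup>+z. P (\<lambda>z. ennreal (min (s * nb z) R powr p)) z \<partial>\<mu>)"
      unfolding N_def by (rule nn_integral_invariant[OF inv]) measurable
    also have "\<dots> \<le> (\<integral>\<^sup>+z. (ennreal (min (r * s * nb z) R powr p) + ennreal (s powr p) * C) \<partial>\<mu>)"
    proof (rule nn_integral_mono)
      fix z
      have "P (\<lambda>z. ennreal (min (s * nb z) R powr p)) z
        \<le> (\<integral>\<^sup>+w. \<integral>\<^sup>+w'. (ennreal (min (r * s * nb z) R powr p)
            + ennreal (s powr p) * (ennreal (c powr p) * ennreal (nb (stp 0 w w') powr p))) \<partial>std_gaussian \<partial>std_gaussian)"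
        unfolding P_def using pt
        by (intro nn_integral_mono) (simp add: ennreal_mult[symmetric] ennreal_plus[symmetric] ennreal_leI del: ennreal_plus)
      also have "\<dots> = ennreal (min (r * s * nb z) R powr p) + ennreal (s powr p) * C"
        using std_gaussian.emeasure_space_1[where 'a='a]
        by (simp add: nn_integral_add nn_integral_cmult C_def)
      finally show "P (\<lambda>z. ennreal (min (s * nb z) R powr p)) z \<le> ennreal (min (r * s * nb z) R powr p) + ennreal (s powr p) * C" .
    qed
    also have "\<dots> = N R (r * s) + ennreal (s powr p) * C"
      unfolding N_def using emeasure_space_1 by (simp add: nn_integral_add)
    finally show ?thesis .
  qed
  define q where "q = r powr p"
  have q: "0 \<le> q" "q < 1" using r p powr_less_mono2[of p r 1] by (auto simp: q_def)
  have iter: "N R 1 \<le> N R (r ^ n) + ennreal (\<Sum>k<n. q ^ k) * C" if R: "0 \<le> R" for R n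
  proof (induction n)
    case (Suc n)
    have st: "N R (r ^ n) \<le> N R (r * r ^ n) + ennreal ((r ^ n) powr p) * C"
      using R r by (intro step) auto
    have pq: "(r ^ n) powr p = q ^ n"
    proof -
      have "(r ^ n) powr p = (r powr real n) powr p" using r by (simp only: powr_realpow)
      also have "\<dots> = (r powr p) powr real n" by (simp only: powr_powr mult.commute)
      also have "\<dots> = q ^ n" unfolding q_def using r by (intro powr_realpow) auto
      finally show ?thesis .
    qed
    have "N R 1 \<le> N R (r ^ n) + ennreal (\<Sum>k<n. q ^ k) * C" by (rule Suc)
    also have "\<dots> \<le> (N R (r * r ^ n) + ennreal (q ^ n) * C) + ennreal (\<Sum>k<n. q ^ k) * C"
      using st unfolding pq by (rule add_right_mono)
    also have "\<dots> = N R (r ^ Suc n) + ennreal (\<Sum>k<Suc n. q ^ k) * C"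
    proof -
      have e: "ennreal (\<Sum>k<Suc n. q ^ k) = ennreal (\<Sum>k<n. q ^ k) + ennreal (q ^ n)"
        using q by (simp add: sum_nonneg)
      show ?thesis unfolding e distrib_right by (simp add: add_ac)
    qed
    finally show ?case .
  qed (simp add: N_def)
  have geo: "(\<Sum>k<n. q ^ k) \<le> 1 / (1 - q)" for n
    using q by (simp add: sum_gp_strict divide_right_mono)
  define B where "B = ennreal (1 / (1 - q)) * C"
  have trunc: "N R 1 \<le> B" if R: "0 \<le> R" for R
  proof -
    \<comment> \<open>At fixed \<open>R\<close> the rescaled truncated functions are bounded by
      \<open>R powr p\<close> and tend to 0 pointwise, so the starting term disappears and only the
      geometric series of noise terms is left.\<close>
    have "(\<lambda>n. N R (r ^ n)) \<longlonglongrightarrow> (\<integral>\<^sup>+z. 0 \<partial>\<mu>)"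
      unfolding N_def
    proof (rule nn_integral_dominated_convergence[where w = "\<lambda>_. ennreal (R powr p)"])
      show "AE z in \<mu>. ennreal (min (r ^ n * nb z) R powr p) \<le> ennreal (R powr p)" for n
        using p R r by (intro AE_I2 ennreal_leI powr_mono2) auto
      show "(\<integral>\<^sup>+z. ennreal (R powr p) \<partial>\<mu>) < \<infinity>" using emeasure_space_1 by simp
      show "AE z in \<mu>. (\<lambda>n. ennreal (min (r ^ n * nb z) R powr p)) \<longlonglongrightarrow> 0"
      proof (intro AE_I2)
        fix z
        have "(\<lambda>n. min (r ^ n * nb z) R powr p) \<longlonglongrightarrow> min (0 * nb z) R powr p"
          using r p R by (intro tendsto_powr2 tendsto_min tendsto_mult LIMSEQ_realpow_zero tendsto_const always_eventually allI) auto
        then have "(\<lambda>n. ennreal (min (r ^ n * nb z) R powr p)) \<longlonglongrightarrow> ennreal (min (0 * nb z) R powr p)"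
          by (rule tendsto_ennrealI)
        then show "(\<lambda>n. ennreal (min (r ^ n * nb z) R powr p)) \<longlonglongrightarrow> 0" using R by simp
      qed
    qed measurable
    then have "(\<lambda>n. N R (r ^ n)) \<longlonglongrightarrow> 0" by simp
    then have "(\<lambda>n. N R (r ^ n) + B) \<longlonglongrightarrow> 0 + B"
      by (intro tendsto_add tendsto_const)
    moreover have "N R 1 \<le> N R (r ^ n) + B" for n
    proof -
      have "N R 1 \<le> N R (r ^ n) + ennreal (\<Sum>k<n. q ^ k) * C" by (rule iter[OF R])
      also have "\<dots> \<le> N R (r ^ n) + B"
        unfolding B_def using geo[of n] by (intro add_left_mono mult_right_mono ennreal_leI) auto
      finally show ?thesis .
    qed
    ultimately show ?thesis by (intro LIMSEQ_le_const[where X = "\<lambda>n. N R (r ^ n) + B"]) auto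
  qed
  have "(\<integral>\<^sup>+z. ennreal (nb z powr p) \<partial>\<mu>) = (\<integral>\<^sup>+z. liminf (\<lambda>n. ennreal (min (1 * nb z) (real n) powr p)) \<partial>\<mu>)"
  proof (intro nn_integral_cong)
    fix z
    obtain n0 where n0: "nb z \<le> real n0" using real_arch_simple by blast
    have "(\<lambda>n. ennreal (min (1 * nb z) (real n) powr p)) \<longlonglongrightarrow> ennreal (nb z powr p)"
    proof (rule tendsto_eventually)
      show "\<forall>\<^sub>F n in sequentially. ennreal (min (1 * nb z) (real n) powr p) = ennreal (nb z powr p)"
        using eventually_ge_at_top[of n0] by eventually_elim (use n0 in \<open>simp add: min_def\<close>)
    qed
    then show "ennreal (nb z powr p) = liminf (\<lambda>n. ennreal (min (1 * nb z) (real n) powr p))"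
      by (intro lim_imp_Liminf[symmetric]) auto
  qed
  also have "\<dots> \<le> liminf (\<lambda>n. N (real n) 1)"
    unfolding N_def by (intro nn_integral_liminf) measurable
  also have "\<dots> \<le> B"
    by (intro Liminf_le always_eventually allI trunc) auto
  also have "B < \<infinity>" using Cfin by (simp add: B_def ennreal_mult_less_top)
  finally show ?thesis .
qed

end

section \<open>The Wasserstein bound\<close>

lemma measure_eqI_nn_integral:
  assumes "sets M = sets N" "\<And>F. F \<in> borel_measurable M \<Longrightarrow> (\<integral>\<^sup>+x. F x \<partial>M) = (\<integral>\<^sup>+x. F x \<partial>N)"
  shows "M = N"
proof (rule measure_eqI)
  fix A assume "A \<in> sets M"
  then show "emeasure M A = emeasure N A"
    using assms(2)[of "indicator A"] assms(1) by simp
qed (rule assms(1))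

lemma pair_in_couplings:
  fixes \<mu> \<nu> :: "'b::second_countable_topology measure"
  assumes "prob_space \<mu>" "prob_space \<nu>" and sets: "sets \<mu> = sets borel" "sets \<nu> = sets borel"
  shows "\<mu> \<Otimes>\<^sub>M \<nu> \<in> couplings \<mu> \<nu>"
proof -
  interpret M: prob_space \<mu> by fact
  interpret N: prob_space \<nu> by fact
  interpret pair_prob_space \<mu> \<nu> ..
  note sets[measurable_cong]
  have [simp]: "sets (\<mu> \<Otimes>\<^sub>M \<nu>) = sets borel"
    unfolding borel_prod[symmetric] by (rule sets_pair_measure_cong[OF sets])
  have [measurable_cong]: "sets (\<mu> \<Otimes>\<^sub>M \<nu>) = sets borel" by simp
  have 1: "distr (\<mu> \<Otimes>\<^sub>M \<nu>) borel fst = \<mu>"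
  proof (rule measure_eqI_nn_integral)
    fix F :: "'b \<Rightarrow> ennreal" assume "F \<in> borel_measurable (distr (\<mu> \<Otimes>\<^sub>M \<nu>) borel fst)"
    then have F[measurable]: "F \<in> borel_measurable borel" by simp
    have "(\<integral>\<^sup>+x. F x \<partial>distr (\<mu> \<Otimes>\<^sub>M \<nu>) borel fst) = (\<integral>\<^sup>+z. F (fst z) \<partial>(\<mu> \<Otimes>\<^sub>M \<nu>))"
      by (subst nn_integral_distr) auto
    also have "\<dots> = (\<integral>\<^sup>+x. \<integral>\<^sup>+y. F x \<partial>\<nu> \<partial>\<mu>)"
      by (subst N.nn_integral_fst[symmetric]) auto
    finally show "(\<integral>\<^sup>+x. F x \<partial>distr (\<mu> \<Otimes>\<^sub>M \<nu>) borel fst) = (\<integral>\<^sup>+x. F x \<partial>\<mu>)"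
      by (simp add: N.emeasure_space_1)
  qed (simp add: sets)
  have 2: "distr (\<mu> \<Otimes>\<^sub>M \<nu>) borel snd = \<nu>"
  proof (rule measure_eqI_nn_integral)
    fix F :: "'b \<Rightarrow> ennreal" assume "F \<in> borel_measurable (distr (\<mu> \<Otimes>\<^sub>M \<nu>) borel snd)"
    then have F[measurable]: "F \<in> borel_measurable borel" by simp
    have "(\<integral>\<^sup>+x. F x \<partial>distr (\<mu> \<Otimes>\<^sub>M \<nu>) borel snd) = (\<integral>\<^sup>+z. F (snd z) \<partial>(\<mu> \<Otimes>\<^sub>M \<nu>))"
      by (subst nn_integral_distr) auto
    also have "\<dots> = (\<integral>\<^sup>+x. \<integral>\<^sup>+y. F y \<partial>\<nu> \<partial>\<mu>)"
      by (subst N.nn_integral_fst[symmetric]) auto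
    finally show "(\<integral>\<^sup>+x. F x \<partial>distr (\<mu> \<Otimes>\<^sub>M \<nu>) borel snd) = (\<integral>\<^sup>+x. F x \<partial>\<nu>)"
      by (simp add: M.emeasure_space_1)
  qed (simp add: sets)
  show ?thesis unfolding couplings_def using 1 2 P.prob_space_axioms by simp
qed

lemma nn_integral_coupling:
  assumes "\<Gamma> \<in> couplings \<mu> \<nu>" and [measurable]: "F \<in> borel_measurable borel"
  shows "(\<integral>\<^sup>+z. F (fst z) \<partial>\<Gamma>) = (\<integral>\<^sup>+x. F x \<partial>\<mu>)" "(\<integral>\<^sup>+z. F (snd z) \<partial>\<Gamma>) = (\<integral>\<^sup>+x. F x \<partial>\<nu>)"
proof -
  have G: "sets \<Gamma> = sets borel" "distr \<Gamma> borel fst = \<mu>" "distr \<Gamma> borel snd = \<nu>"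
    using assms by (auto simp: couplings_def)
  note G(1)[measurable_cong]
  show "(\<integral>\<^sup>+z. F (fst z) \<partial>\<Gamma>) = (\<integral>\<^sup>+x. F x \<partial>\<mu>)"
    unfolding G(2)[symmetric] by (subst nn_integral_distr) auto
  show "(\<integral>\<^sup>+z. F (snd z) \<partial>\<Gamma>) = (\<integral>\<^sup>+x. F x \<partial>\<nu>)"
    unfolding G(3)[symmetric] by (subst nn_integral_distr) auto
qed

context obabo
begin

section \<open>Size and moments of the discretisation error\<close>

definition xs :: 'a where "xs = (SOME x. g x = 0)"

lemma g_xs: "g xs = 0"
  unfolding xs_def using ex_critical by (rule someI_ex)

text \<open>Twice this function dominates \<open>psi \<delta>\<close>. The coefficient
  \<open>\<delta> * L / 2\<close> is chosen to reproduce the last factor of \<open>K3\<close> in the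
  moments.\<close>

definition size_fun :: "'a \<times> 'a \<Rightarrow> real" where
  "size_fun z = norm (snd z) + \<delta> * L / 2 * norm (fst z - xs)"

lemma size_fun_nonneg: "0 \<le> size_fun z"
  using delta_pos L_pos by (simp add: size_fun_def)

lemma measurable_size_fun [measurable]: "size_fun \<in> borel_measurable borel"
  unfolding size_fun_def[abs_def] by measurable

lemma norm_g_le: "norm (g x) \<le> L * norm (x - xs)"
  using lip[of x xs] by (simp add: g_xs)

lemma Flow_error: "nb (ou (Flow y) w - ou (verlet \<delta> y) w) \<le> 6 / 5 * \<omega> * \<delta>\<^sup>2 * size_fun y"
proof -
  define e where "e = Flow y - verlet \<delta> y"
  have "ou (Flow y) w - ou (verlet \<delta> y) w = (fst e, \<eta> *\<^sub>R snd e)"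
    by (simp add: ou_def e_def scaleR_diff_right)
  then have "nb (ou (Flow y) w - ou (verlet \<delta> y) w) \<le> norm (fst e) + norm (\<eta> *\<^sub>R snd e) / \<omega>"
    using nb_le[of "(fst e, \<eta> *\<^sub>R snd e)"] by simp
  also have "\<dots> \<le> norm (fst e) + norm (snd e) / \<omega>"
    using eta_pos eta_lt_1 omega_pos by (intro add_left_mono divide_right_mono) (auto simp: mult_left_le_one_le)
  also have "\<dots> = nu e / \<omega>" using omega_pos by (simp add: nu_def add_divide_distrib)
  also have "\<dots> \<le> (3 / 5 * L * \<delta>\<^sup>2 * psi \<delta> y) / \<omega>"
    unfolding e_def using omega_pos by (intro divide_right_mono Flow_verlet_diff) auto
  also have "\<dots> = 3 / 5 * \<omega> * \<delta>\<^sup>2 * psi \<delta> y"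
  proof -
    have e: "L / \<omega> = \<omega>" using omega_mult omega_pos by (simp add: field_simps)
    have "(3 / 5 * L * \<delta>\<^sup>2 * psi \<delta> y) / \<omega> = 3 / 5 * (L / \<omega>) * \<delta>\<^sup>2 * psi \<delta> y" by simp
    then show ?thesis unfolding e .
  qed
  also have "\<dots> \<le> 3 / 5 * \<omega> * \<delta>\<^sup>2 * (2 * size_fun y)"
  proof (rule mult_left_mono)
    have "\<delta> * norm (g (fst y)) \<le> \<delta> * (L * norm (fst y - xs))"
      using norm_g_le delta_pos by (intro mult_left_mono) auto
    then show "psi \<delta> y \<le> 2 * size_fun y"
      by (simp add: psi_def size_fun_def algebra_simps) (smt (verit) norm_ge_zero)
  qed (use omega_pos in auto)
  finally show ?thesis by simp
qed

definition "dim_p p = real DIM('a) + max (p - 2) 0"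

definition "A_p p = sqrt (dim_p p) * (1 + \<delta> * L / (2 * sqrt m))"

lemma dim_p_pos: "0 < dim_p p"
proof -
  have "0 < real DIM('a)" by simp
  then show ?thesis unfolding dim_p_def by (intro add_pos_nonneg) auto
qed

lemma A_p_pos: "0 < A_p p"
  using dim_p_pos delta_pos L_pos m_pos by (simp add: A_p_def add_pos_nonneg)

text \<open>The triangle inequality for moments in disguise: the sum is written as
  \<open>1 + \<beta>\<close> times a convex combination with weights
  \<open>1 / (1 + \<beta>)\<close> and \<open>\<beta> / (1 + \<beta>)\<close>, and both terms,
  rescaled by \<open>sqrt m\<close> in position, have the same moment bound.\<close>

lemma size_fun_moment:
  assumes p: "1 \<le> p"
  shows "(\<integral>\<^sup>+z. ennreal (size_fun z powr p) \<partial>gibbs U) \<le> ennreal (A_p p powr p)"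
proof -
  define \<beta> where "\<beta> = \<delta> * L / (2 * sqrt m)"
  have \<beta>: "0 < \<beta>" using delta_pos L_pos m_pos by (simp add: \<beta>_def)
  define c1 c2 where "c1 = (1 + \<beta>) powr p * (1 / (1 + \<beta>))"
    and "c2 = (1 + \<beta>) powr p * (\<beta> / (1 + \<beta>)) * sqrt m powr p"
  have c: "0 \<le> c1" "0 \<le> c2" using \<beta> by (auto simp: c1_def c2_def)
  have pt: "size_fun z powr p \<le> c1 * norm (snd z) powr p + c2 * norm (fst z - xs) powr p" for z
  proof -
    define V Y where "V = norm (snd z)" and "Y = sqrt m * norm (fst z - xs)"
    have VY: "0 \<le> V" "0 \<le> Y" using m_pos by (auto simp: V_def Y_def)
    have k: "V + \<beta> * Y = k * (1 / k * V + \<beta> / k * Y)" if "k \<noteq> 0" for k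
      using that by (simp add: distrib_left)
    have "size_fun z = V + \<beta> * Y" using m_pos by (simp add: size_fun_def V_def Y_def \<beta>_def)
    also have "\<dots> = (1 + \<beta>) * (1 / (1 + \<beta>) * V + \<beta> / (1 + \<beta>) * Y)"
      using \<beta> by (intro k) auto
    finally have "size_fun z powr p = (1 + \<beta>) powr p * (1 / (1 + \<beta>) * V + \<beta> / (1 + \<beta>) * Y) powr p"
      using \<beta> VY by (simp add: powr_mult)
    also have "\<dots> \<le> (1 + \<beta>) powr p * (1 / (1 + \<beta>) * V powr p + \<beta> / (1 + \<beta>) * Y powr p)"
      using \<beta> VY p by (intro mult_left_mono powr_convex_comb) (auto simp: field_simps)
    also have "\<dots> = c1 * V powr p + c2 * norm (fst z - xs) powr p"
      using m_pos by (simp add: c1_def c2_def Y_def powr_mult distrib_left)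
    finally show ?thesis by (simp add: V_def)
  qed
  define D where "D = dim_p p"
  have D: "0 < D" using dim_p_pos by (simp add: D_def)
  have "(\<integral>\<^sup>+z. ennreal (size_fun z powr p) \<partial>gibbs U)
      \<le> (\<integral>\<^sup>+z. ennreal c1 * ennreal (norm (snd z) powr p) + ennreal c2 * ennreal (norm (fst z - xs) powr p) \<partial>gibbs U)"
    using pt c by (intro nn_integral_mono) (simp add: ennreal_mult[symmetric] ennreal_plus[symmetric] ennreal_leI del: ennreal_plus)
  also have "\<dots> = ennreal c1 * (\<integral>\<^sup>+z. ennreal (norm (snd z) powr p) \<partial>gibbs U)
      + ennreal c2 * (\<integral>\<^sup>+z. ennreal (norm (fst z - xs) powr p) \<partial>gibbs U)"
    by (simp add: nn_integral_add nn_integral_cmult)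
  also have "\<dots> \<le> ennreal c1 * ennreal (D powr (p / 2)) + ennreal c2 * ennreal ((D / m) powr (p / 2))"
    unfolding D_def dim_p_def using gibbs_moment_snd[OF p] gibbs_moment_fst[OF p g_xs]
    by (intro add_mono mult_left_mono) auto
  also have "\<dots> = ennreal (c1 * D powr (p / 2) + c2 * (D / m) powr (p / 2))"
    using c by (simp add: ennreal_mult)
  also have "c1 * D powr (p / 2) + c2 * (D / m) powr (p / 2) = (1 + \<beta>) powr p * D powr (p / 2)"
  proof -
    have s: "sqrt m powr p = m powr (p / 2)"
      using m_pos by (simp add: powr_half_sqrt[symmetric] powr_powr)
    have "c2 * (D / m) powr (p / 2) = (1 + \<beta>) powr p * (\<beta> / (1 + \<beta>)) * D powr (p / 2)"
      using m_pos D unfolding c2_def s by (simp add: powr_divide)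
    then have "c1 * D powr (p / 2) + c2 * (D / m) powr (p / 2)
        = (1 + \<beta>) powr p * D powr (p / 2) * (1 / (1 + \<beta>) + \<beta> / (1 + \<beta>))"
      unfolding c1_def by (simp only: distrib_left mult_ac)
    also have "1 / (1 + \<beta>) + \<beta> / (1 + \<beta>) = 1" using \<beta> by (simp add: field_simps)
    finally show ?thesis by simp
  qed
  also have "(1 + \<beta>) powr p * D powr (p / 2) = A_p p powr p"
    unfolding A_p_def D_def[symmetric] \<beta>_def[symmetric] using D \<beta>
    by (simp add: powr_mult powr_half_sqrt[symmetric] powr_powr)
  finally show ?thesis .
qed

definition cost :: "real \<Rightarrow> (('a \<times> 'a) \<times> ('a \<times> 'a)) measure \<Rightarrow> ennreal" where
  "cost p \<Gamma> = (\<integral>\<^sup>+z. ennreal (nb (fst z - snd z) powr p) \<partial>\<Gamma>)"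

text \<open>The fixed point of
  \<open>e = \<rho> * e + 6 / 5 * \<omega> * \<delta>\<^sup>2 * A_p p\<close>: contraction followed
  by one local error.\<close>

definition "err_p p = 6 / 5 * \<omega> * \<delta>\<^sup>2 * A_p p / (1 - \<rho>)"

lemma err_p_nonneg: "0 \<le> err_p p"
  using omega_pos A_p_pos[of p] rho_lt_1 by (simp add: err_p_def)

lemma nn_integral_gibbs_exact_step:
  assumes [measurable]: "F \<in> borel_measurable borel"
  shows "(\<integral>\<^sup>+z. \<integral>\<^sup>+w. \<integral>\<^sup>+w'. F (ou (Flow (ou z w)) w') \<partial>std_gaussian \<partial>std_gaussian \<partial>gibbs U) = (\<integral>\<^sup>+z. F z \<partial>gibbs U)"
proof -
  define H where "H y = (\<integral>\<^sup>+w'. F (ou y w') \<partial>std_gaussian)" for y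
  have [measurable]: "H \<in> borel_measurable borel" unfolding H_def[abs_def] by measurable
  have "(\<integral>\<^sup>+z. \<integral>\<^sup>+w. H (Flow (ou z w)) \<partial>std_gaussian \<partial>gibbs U) = (\<integral>\<^sup>+z. H (Flow z) \<partial>gibbs U)"
    by (rule nn_integral_gibbs_ou[of "\<lambda>y. H (Flow y)"]) measurable
  also have "\<dots> = (\<integral>\<^sup>+z. H z \<partial>gibbs U)" by (rule nn_integral_gibbs_Flow) measurable
  also have "\<dots> = (\<integral>\<^sup>+z. F z \<partial>gibbs U)" unfolding H_def by (rule nn_integral_gibbs_ou) measurable
  finally show ?thesis by (simp add: H_def)
qed

text \<open>The first component moves by the exact dynamics, which preserves the Gibbs measure, the
  second by the chain, which preserves \<mu>, both with the same noises. So the marginals do not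
  change while the cost contracts.\<close>

lemma coupling_step:
  assumes inv: "invariant_prob (obabo_kernel \<delta> \<gamma> U) \<mu>" and p: "1 \<le> p"
    and G: "\<Gamma> \<in> couplings (gibbs U) \<mu>"
  shows "\<exists>\<Gamma>'\<in>couplings (gibbs U) \<mu>. cost p \<Gamma>' \<le> ennreal \<rho> * cost p \<Gamma> + ennreal ((1 - \<rho>) * err_p p powr p)"
proof -
  have \<Gamma>: "prob_space \<Gamma>" "sets \<Gamma> = sets borel" using G by (auto simp: couplings_def)
  interpret \<Gamma>: prob_space \<Gamma> by (rule \<Gamma>)
  note \<Gamma>(2)[measurable_cong]
  have sets_\<mu>: "sets \<mu> = sets borel" using inv by (simp add: invariant_prob_def)
  note sets_\<mu>[measurable_cong]
  define N where "N = (std_gaussian :: 'a measure) \<Otimes>\<^sub>M (std_gaussian :: 'a measure)"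
  interpret N: prob_space N unfolding N_def by (rule std_gaussian_pair.P.prob_space_axioms)
  interpret pair_prob_space \<Gamma> N ..
  have [measurable_cong]: "sets N = sets (borel \<Otimes>\<^sub>M borel)" unfolding N_def by (intro sets_pair_measure_cong) auto
  define T1 where "T1 x = ou (Flow (ou (fst (fst x)) (fst (snd x)))) (snd (snd x))" for x :: "(('a \<times> 'a) \<times> ('a \<times> 'a)) \<times> ('a \<times> 'a)"
  define T2 where "T2 x = stp (snd (fst x)) (fst (snd x)) (snd (snd x))" for x :: "(('a \<times> 'a) \<times> ('a \<times> 'a)) \<times> ('a \<times> 'a)"
  have [measurable]: "T1 \<in> borel_measurable (\<Gamma> \<Otimes>\<^sub>M N)" "T2 \<in> borel_measurable (\<Gamma> \<Otimes>\<^sub>M N)"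
    unfolding T1_def[abs_def] T2_def[abs_def] by measurable
  define \<Gamma>' where "\<Gamma>' = distr (\<Gamma> \<Otimes>\<^sub>M N) borel (\<lambda>x. (T1 x, T2 x))"
  have int: "(\<integral>\<^sup>+x. f x \<partial>(\<Gamma> \<Otimes>\<^sub>M N)) = (\<integral>\<^sup>+z. \<integral>\<^sup>+w. \<integral>\<^sup>+w'. f (z, (w, w')) \<partial>std_gaussian \<partial>std_gaussian \<partial>\<Gamma>)"
    if [measurable]: "f \<in> borel_measurable (\<Gamma> \<Otimes>\<^sub>M N)" for f
  proof -
    have "(\<integral>\<^sup>+x. f x \<partial>(\<Gamma> \<Otimes>\<^sub>M N)) = (\<integral>\<^sup>+z. \<integral>\<^sup>+y. f (z, y) \<partial>N \<partial>\<Gamma>)"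
      by (rule N.nn_integral_fst[symmetric]) measurable
    also have "\<dots> = (\<integral>\<^sup>+z. \<integral>\<^sup>+w. \<integral>\<^sup>+w'. f (z, (w, w')) \<partial>std_gaussian \<partial>std_gaussian \<partial>\<Gamma>)"
    proof (rule nn_integral_cong)
      fix z assume "z \<in> space \<Gamma>"
      then have "(\<lambda>y. f (z, y)) \<in> borel_measurable (std_gaussian \<Otimes>\<^sub>M std_gaussian)"
        unfolding N_def[symmetric] by (rule measurable_compose[OF measurable_Pair1']) measurable
      then show "(\<integral>\<^sup>+y. f (z, y) \<partial>N) = (\<integral>\<^sup>+w. \<integral>\<^sup>+w'. f (z, (w, w')) \<partial>std_gaussian \<partial>std_gaussian)"
        unfolding N_def by (rule std_gaussian.nn_integral_fst[symmetric])
    qed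
    finally show ?thesis .
  qed
  have "\<Gamma>' \<in> couplings (gibbs U) \<mu>"
    unfolding couplings_def
  proof (intro CollectI conjI)
    show "prob_space \<Gamma>'" unfolding \<Gamma>'_def by (intro P.prob_space_distr) measurable
    show "sets \<Gamma>' = sets borel" by (simp add: \<Gamma>'_def)
    then have [measurable_cong]: "sets \<Gamma>' = sets borel" .
    show "distr \<Gamma>' borel fst = gibbs U"
    proof (rule measure_eqI_nn_integral)
      fix F :: "'a \<times> 'a \<Rightarrow> ennreal" assume "F \<in> borel_measurable (distr \<Gamma>' borel fst)"
      then have [measurable]: "F \<in> borel_measurable borel" by simp
      define H where "H z = (\<integral>\<^sup>+w. \<integral>\<^sup>+w'. F (ou (Flow (ou z w)) w') \<partial>std_gaussian \<partial>std_gaussian)" for z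
      have [measurable]: "H \<in> borel_measurable borel" unfolding H_def[abs_def] by measurable
      have "(\<integral>\<^sup>+x. F x \<partial>distr \<Gamma>' borel fst) = (\<integral>\<^sup>+x. F (T1 x) \<partial>(\<Gamma> \<Otimes>\<^sub>M N))"
        unfolding \<Gamma>'_def by (simp add: nn_integral_distr)
      also have "\<dots> = (\<integral>\<^sup>+z. H (fst z) \<partial>\<Gamma>)"
        by (subst int) (measurable, simp add: T1_def H_def)
      also have "\<dots> = (\<integral>\<^sup>+z. H z \<partial>gibbs U)" by (rule nn_integral_coupling(1)[OF G]) measurable
      also have "\<dots> = (\<integral>\<^sup>+z. F z \<partial>gibbs U)" unfolding H_def by (rule nn_integral_gibbs_exact_step) measurable
      finally show "(\<integral>\<^sup>+x. F x \<partial>distr \<Gamma>' borel fst) = (\<integral>\<^sup>+z. F z \<partial>gibbs U)" .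
    qed simp
    show "distr \<Gamma>' borel snd = \<mu>"
    proof (rule measure_eqI_nn_integral)
      fix F :: "'a \<times> 'a \<Rightarrow> ennreal" assume "F \<in> borel_measurable (distr \<Gamma>' borel snd)"
      then have F[measurable]: "F \<in> borel_measurable borel" by simp
      have "(\<integral>\<^sup>+x. F x \<partial>distr \<Gamma>' borel snd) = (\<integral>\<^sup>+x. F (T2 x) \<partial>(\<Gamma> \<Otimes>\<^sub>M N))"
        unfolding \<Gamma>'_def by (simp add: nn_integral_distr)
      also have "\<dots> = (\<integral>\<^sup>+z. P F (snd z) \<partial>\<Gamma>)"
        by (subst int) (measurable, simp add: T2_def P_def)
      also have "\<dots> = (\<integral>\<^sup>+z. P F z \<partial>\<mu>)" by (rule nn_integral_coupling(2)[OF G]) measurable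
      also have "\<dots> = (\<integral>\<^sup>+z. F z \<partial>\<mu>)" by (rule nn_integral_invariant[OF inv F, symmetric])
      finally show "(\<integral>\<^sup>+x. F x \<partial>distr \<Gamma>' borel snd) = (\<integral>\<^sup>+z. F z \<partial>\<mu>)" .
    qed (simp add: sets_\<mu>)
  qed
  moreover have "cost p \<Gamma>' \<le> ennreal \<rho> * cost p \<Gamma> + ennreal ((1 - \<rho>) * err_p p powr p)"
  proof -
    \<comment> \<open>Dividing the local error by \<open>1 - \<rho>\<close> exhibits contraction
      plus error as a convex combination; convexity then gives a bound on the cost itself, without
      taking roots.\<close>
    define b where "b = 6 / 5 * \<omega> * \<delta>\<^sup>2 / (1 - \<rho>)"
    have b: "0 \<le> b" using omega_pos rho_lt_1 by (simp add: b_def)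
    define c where "c = (1 - \<rho>) * b powr p"
    have c: "0 \<le> c" using rho_lt_1 by (simp add: c_def)
    have pt: "nb (ou (Flow (ou z w)) w' - stp z' w w') powr p
        \<le> \<rho> * nb (z - z') powr p + c * size_fun (ou z w) powr p" for z z' w w'
    proof -
      define E where "E = b * size_fun (ou z w)"
      have E: "0 \<le> E" using b size_fun_nonneg by (simp add: E_def)
      have "nb (ou (Flow (ou z w)) w' - stp z' w w') \<le> nb (ou (Flow (ou z w)) w' - stp z w w') + nb (stp z w w' - stp z' w w')"
        using nb_triangle[of "ou (Flow (ou z w)) w' - stp z w w'" "stp z w w' - stp z' w w'"] by simp
      also have "\<dots> \<le> 6 / 5 * \<omega> * \<delta>\<^sup>2 * size_fun (ou z w) + \<rho> * nb (z - z')"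
        unfolding stp_def[of z] using stp_contraction[of z w w' z'] Flow_error[of "ou z w" w'] by (intro add_mono) (simp_all add: stp_def)
      also have "\<dots> = \<rho> * nb (z - z') + (1 - \<rho>) * E"
      proof -
        have k: "r * (X / r) = X" if "r \<noteq> 0" for r X :: real using that by simp
        have "(1 - \<rho>) * b = 6 / 5 * \<omega> * \<delta>\<^sup>2" unfolding b_def by (rule k) (use rho_lt_1 in simp)
        then have "(1 - \<rho>) * E = 6 / 5 * \<omega> * \<delta>\<^sup>2 * size_fun (ou z w)"
          by (simp only: E_def mult.assoc[symmetric])
        then show ?thesis by simp
      qed
      finally have "nb (ou (Flow (ou z w)) w' - stp z' w w') powr p \<le> (\<rho> * nb (z - z') + (1 - \<rho>) * E) powr p"
        using p by (intro powr_mono2) auto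
      also have "\<dots> \<le> \<rho> * nb (z - z') powr p + (1 - \<rho>) * E powr p"
        using rho_pos rho_lt_1 E p by (intro powr_convex_comb) auto
      also have "(1 - \<rho>) * E powr p = c * size_fun (ou z w) powr p"
        using b size_fun_nonneg by (simp add: E_def c_def powr_mult)
      finally show ?thesis .
    qed
    define S where "S z = (\<integral>\<^sup>+w. ennreal (size_fun (ou z w) powr p) \<partial>std_gaussian)" for z
    have [measurable]: "S \<in> borel_measurable borel" unfolding S_def[abs_def] by measurable
    have "cost p \<Gamma>' = (\<integral>\<^sup>+x. ennreal (nb (T1 x - T2 x) powr p) \<partial>(\<Gamma> \<Otimes>\<^sub>M N))"
      unfolding cost_def \<Gamma>'_def by (subst nn_integral_distr) auto
    also have "\<dots> = (\<integral>\<^sup>+z. \<integral>\<^sup>+w. \<integral>\<^sup>+w'. ennreal (nb (ou (Flow (ou (fst z) w)) w' - stp (snd z) w w') powr p) \<partial>std_gaussian \<partial>std_gaussian \<partial>\<Gamma>)"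
      by (subst int) (measurable, simp add: T1_def T2_def)
    also have "\<dots> \<le> (\<integral>\<^sup>+z. \<integral>\<^sup>+w. \<integral>\<^sup>+w'. (ennreal \<rho> * ennreal (nb (fst z - snd z) powr p)
        + ennreal c * ennreal (size_fun (ou (fst z) w) powr p)) \<partial>(std_gaussian :: 'a measure) \<partial>std_gaussian \<partial>\<Gamma>)"
      using pt c rho_pos by (intro nn_integral_mono) (simp add: ennreal_mult[symmetric] ennreal_plus[symmetric] ennreal_leI del: ennreal_plus)
    also have "\<dots> = (\<integral>\<^sup>+z. (ennreal \<rho> * ennreal (nb (fst z - snd z) powr p) + ennreal c * S (fst z)) \<partial>\<Gamma>)"
      using std_gaussian.emeasure_space_1[where 'a='a]
      by (simp add: nn_integral_add nn_integral_cmult S_def)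
    also have "\<dots> = ennreal \<rho> * cost p \<Gamma> + ennreal c * (\<integral>\<^sup>+z. S (fst z) \<partial>\<Gamma>)"
      by (simp add: nn_integral_add nn_integral_cmult cost_def)
    \<comment> \<open>The local error is evaluated along the Gibbs component, after a refreshment
      that leaves its law unchanged; no moment of the invariant measure enters it.\<close>
    also have "(\<integral>\<^sup>+z. S (fst z) \<partial>\<Gamma>) = (\<integral>\<^sup>+z. S z \<partial>gibbs U)" by (rule nn_integral_coupling(1)[OF G]) measurable
    also have "\<dots> = (\<integral>\<^sup>+z. ennreal (size_fun z powr p) \<partial>gibbs U)"
      unfolding S_def by (rule nn_integral_gibbs_ou[of "\<lambda>z. ennreal (size_fun z powr p)"]) measurable
    also have "ennreal \<rho> * cost p \<Gamma> + ennreal c * \<dots> \<le> ennreal \<rho> * cost p \<Gamma> + ennreal c * ennreal (A_p p powr p)"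
      by (intro add_left_mono mult_left_mono size_fun_moment p) auto
    also have "ennreal c * ennreal (A_p p powr p) = ennreal ((1 - \<rho>) * err_p p powr p)"
    proof -
      have "err_p p = b * A_p p" by (simp add: err_p_def b_def)
      then show ?thesis using b A_p_pos[of p] c by (simp add: c_def ennreal_mult[symmetric] powr_mult mult_ac)
    qed
    finally show ?thesis .
  qed
  ultimately show ?thesis by blast
qed

lemma nb_diff: "nb (z - z') \<le> nb z + nb z'"
proof -
  have "nb (- z') = nb z'"
  proof -
    have "(fst (- z') + (1 / \<gamma>) *\<^sub>R snd (- z'), sqrt (1 / L - 1 / \<gamma>\<^sup>2) *\<^sub>R snd (- z'))
      = - (fst z' + (1 / \<gamma>) *\<^sub>R snd z', sqrt (1 / L - 1 / \<gamma>\<^sup>2) *\<^sub>R snd z')"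
      by simp
    then show ?thesis unfolding nb_def using norm_minus_cancel by metis
  qed
  then show ?thesis using nb_triangle[of z "- z'"] by simp
qed

lemma gibbs_nb_moment_finite:
  assumes p: "1 \<le> p"
  shows "(\<integral>\<^sup>+z. ennreal (nb z powr p) \<partial>gibbs U) < \<infinity>"
proof -
  interpret G: prob_space "gibbs U" by (rule prob_space_gibbs)
  define c where "c = (3 / \<omega>) powr p"
  have pt: "nb z powr p \<le> (3 powr p * norm (fst z - xs) powr p + (3 * norm xs) powr p) + c * norm (snd z) powr p" for z
  proof -
    define M where "M = max (3 * norm (fst z - xs)) (max (3 * norm xs) (3 / \<omega> * norm (snd z)))"
    have "norm (fst z) \<le> norm (fst z - xs) + norm xs"
      using norm_triangle_ineq[of "fst z - xs" xs] by simp
    then have "nb z \<le> norm (fst z - xs) + norm xs + norm (snd z) / \<omega>"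
      using nb_le[of z] by simp
    also have "\<dots> \<le> M" by (simp add: M_def)
    finally have "nb z powr p \<le> M powr p" using p by (intro powr_mono2) auto
    also have "\<dots> \<le> (3 * norm (fst z - xs)) powr p + (3 * norm xs) powr p + (3 / \<omega> * norm (snd z)) powr p"
      by (simp add: M_def max_def)
    also have "\<dots> = (3 powr p * norm (fst z - xs) powr p + (3 * norm xs) powr p) + c * norm (snd z) powr p"
      unfolding c_def using omega_pos by (subst (1 3) powr_mult) auto
    finally show ?thesis .
  qed
  have "(\<integral>\<^sup>+z. ennreal (nb z powr p) \<partial>gibbs U) \<le>
     (\<integral>\<^sup>+z. ((ennreal (3 powr p) * ennreal (norm (fst z - xs) powr p) + ennreal ((3 * norm xs) powr p))
        + ennreal c * ennreal (norm (snd z) powr p)) \<partial>gibbs U)"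
    using pt by (intro nn_integral_mono) (simp add: c_def ennreal_mult[symmetric] ennreal_plus[symmetric] ennreal_leI del: ennreal_plus)
  also have "\<dots> = (ennreal (3 powr p) * (\<integral>\<^sup>+z. ennreal (norm (fst z - xs) powr p) \<partial>gibbs U) + ennreal ((3 * norm xs) powr p))
        + ennreal c * (\<integral>\<^sup>+z. ennreal (norm (snd z) powr p) \<partial>gibbs U)"
    using G.emeasure_space_1 by (simp add: nn_integral_add nn_integral_cmult)
  also have "\<dots> < \<infinity>"
    using gibbs_moment_snd[OF p] gibbs_moment_fst[OF p g_xs]
    by (auto simp: ennreal_mult_less_top less_top intro: le_less_trans)
  finally show ?thesis .
qed

lemma ex_coupling_finite_cost:
  assumes inv: "invariant_prob (obabo_kernel \<delta> \<gamma> U) \<mu>" and p: "1 \<le> p"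
  shows "\<exists>\<Gamma>\<in>couplings (gibbs U) \<mu>. cost p \<Gamma> < \<infinity>"
proof -
  have \<mu>: "prob_space \<mu>" "sets \<mu> = sets borel" using inv by (auto simp: invariant_prob_def)
  have G: "gibbs U \<Otimes>\<^sub>M \<mu> \<in> couplings (gibbs U) \<mu>"
    using \<mu> prob_space_gibbs by (intro pair_in_couplings) auto
  then have [measurable_cong]: "sets (gibbs U \<Otimes>\<^sub>M \<mu>) = sets borel" by (simp add: couplings_def)
  have pt: "nb (z - z') powr p \<le> 2 powr p * nb z powr p + 2 powr p * nb z' powr p" for z z'
  proof -
    have "nb (z - z') \<le> max (2 * nb z) (2 * nb z')" using nb_diff[of z z'] by simp
    then have "nb (z - z') powr p \<le> (max (2 * nb z) (2 * nb z')) powr p" using p by (intro powr_mono2) auto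
    also have "\<dots> \<le> (2 * nb z) powr p + (2 * nb z') powr p" by (simp add: max_def)
    finally show ?thesis by (simp add: powr_mult)
  qed
  have "cost p (gibbs U \<Otimes>\<^sub>M \<mu>) \<le> (\<integral>\<^sup>+z. (ennreal (2 powr p) * ennreal (nb (fst z) powr p) + ennreal (2 powr p) * ennreal (nb (snd z) powr p)) \<partial>(gibbs U \<Otimes>\<^sub>M \<mu>))"
    unfolding cost_def using pt by (intro nn_integral_mono) (simp add: ennreal_mult[symmetric] ennreal_plus[symmetric] ennreal_leI del: ennreal_plus)
  also have "\<dots> = ennreal (2 powr p) * (\<integral>\<^sup>+z. ennreal (nb (fst z) powr p) \<partial>(gibbs U \<Otimes>\<^sub>M \<mu>))
      + ennreal (2 powr p) * (\<integral>\<^sup>+z. ennreal (nb (snd z) powr p) \<partial>(gibbs U \<Otimes>\<^sub>M \<mu>))"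
    by (simp add: nn_integral_add nn_integral_cmult)
  also have "\<dots> = ennreal (2 powr p) * (\<integral>\<^sup>+z. ennreal (nb z powr p) \<partial>gibbs U)
      + ennreal (2 powr p) * (\<integral>\<^sup>+z. ennreal (nb z powr p) \<partial>\<mu>)"
    using nn_integral_coupling[OF G, of "\<lambda>z. ennreal (nb z powr p)"] by simp
  also have "\<dots> < \<infinity>"
    using gibbs_nb_moment_finite[OF p] invariant_moment_finite[OF inv p]
    by (simp add: ennreal_mult_less_top)
  finally show ?thesis using G by blast
qed

text \<open>Iteration of \<open>coupling_step\<close> from the product coupling, whose cost is
  finite by the moment bounds. The margin \<epsilon> absorbs the decaying initial cost.\<close>

lemma ex_coupling_small_cost:
  assumes inv: "invariant_prob (obabo_kernel \<delta> \<gamma> U) \<mu>" and p: "1 \<le> p" and \<epsilon>: "0 < \<epsilon>"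
  shows "\<exists>\<Gamma>\<in>couplings (gibbs U) \<mu>. cost p \<Gamma> \<le> ennreal (err_p p powr p + \<epsilon>)"
proof -
  obtain \<Gamma>0 where \<Gamma>0: "\<Gamma>0 \<in> couplings (gibbs U) \<mu>" "cost p \<Gamma>0 < \<infinity>"
    using ex_coupling_finite_cost[OF inv p] by blast
  define C where "C = enn2real (cost p \<Gamma>0)"
  define e where "e = err_p p powr p"
  have C: "cost p \<Gamma>0 = ennreal C" "0 \<le> C" using \<Gamma>0 by (auto simp: C_def)
  have e: "0 \<le> e" by (simp add: e_def)
  have it: "\<exists>\<Gamma>\<in>couplings (gibbs U) \<mu>. cost p \<Gamma> \<le> ennreal (\<rho> ^ n * C + e)" for n
  proof (induction n)
    case 0
    have "cost p \<Gamma>0 \<le> ennreal (\<rho> ^ 0 * C + e)" unfolding C(1) using e by (intro ennreal_leI) simp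
    then show ?case using \<Gamma>0 by blast
  next
    case (Suc n)
    then obtain \<Gamma> where \<Gamma>: "\<Gamma> \<in> couplings (gibbs U) \<mu>" "cost p \<Gamma> \<le> ennreal (\<rho> ^ n * C + e)" by blast
    obtain \<Gamma>' where \<Gamma>': "\<Gamma>' \<in> couplings (gibbs U) \<mu>" "cost p \<Gamma>' \<le> ennreal \<rho> * cost p \<Gamma> + ennreal ((1 - \<rho>) * e)"
      unfolding e_def using coupling_step[OF inv p \<Gamma>(1)] by blast
    have "cost p \<Gamma>' \<le> ennreal \<rho> * ennreal (\<rho> ^ n * C + e) + ennreal ((1 - \<rho>) * e)"
      by (rule order_trans[OF \<Gamma>'(2)]) (intro add_right_mono mult_left_mono \<Gamma>(2), simp)
    also have "\<dots> = ennreal (\<rho> * (\<rho> ^ n * C + e) + (1 - \<rho>) * e)"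
      using rho_pos rho_lt_1 C(2) e by (simp add: ennreal_mult[symmetric] ennreal_plus[symmetric] del: ennreal_plus)
    also have "\<rho> * (\<rho> ^ n * C + e) + (1 - \<rho>) * e = \<rho> ^ Suc n * C + e" by (simp add: algebra_simps)
    finally show ?case using \<Gamma>' by blast
  qed
  have "(\<lambda>n. \<rho> ^ n * C) \<longlonglongrightarrow> 0 * C"
    using rho_pos rho_lt_1 by (intro tendsto_mult LIMSEQ_realpow_zero tendsto_const) auto
  then have "\<forall>\<^sub>F n in sequentially. \<rho> ^ n * C < \<epsilon>" using \<epsilon> by (intro order_tendstoD) auto
  then obtain n where "\<rho> ^ n * C < \<epsilon>" by (auto dest: eventually_happens)
  then have "ennreal (\<rho> ^ n * C + e) \<le> ennreal (e + \<epsilon>)" by (intro ennreal_leI) simp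
  then show ?thesis using it[of n] unfolding e_def by (meson order_trans)
qed

lemma wasserstein_bound_aux:
  assumes inv: "invariant_prob (obabo_kernel \<delta> \<gamma> U) \<mu>" and p: "1 \<le> p"
  shows "wasserstein p (gibbs U) \<mu> \<le> ennreal (sqrt 2 * max 1 \<omega> * err_p p)"
proof -
  define k where "k = sqrt 2 * max 1 \<omega>"
  have k: "0 \<le> k" by (simp add: k_def)
  define c where "c = (INF \<Gamma>\<in>couplings (gibbs U) \<mu>. \<integral>\<^sup>+ z. ennreal (dist (fst z) (snd z) powr p) \<partial>\<Gamma>)"
  have "c \<le> ennreal (k powr p * err_p p powr p)"
  proof (rule ennreal_le_epsilon)
    fix \<epsilon> :: real assume \<epsilon>: "0 < \<epsilon>"
    define \<epsilon>' where "\<epsilon>' = \<epsilon> / (k powr p + 1)"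
    have \<epsilon>': "0 < \<epsilon>'" using \<epsilon> by (simp add: \<epsilon>'_def add_nonneg_pos)
    have ke: "k powr p * \<epsilon>' \<le> \<epsilon>"
    proof -
      have "k powr p * \<epsilon>' \<le> (k powr p + 1) * \<epsilon>'" using \<epsilon>' by (intro mult_right_mono) auto
      also have "\<dots> = \<epsilon>"
      proof -
        have "k powr p + 1 \<noteq> 0" using powr_ge_zero[of k p] by linarith
        then show ?thesis by (simp add: \<epsilon>'_def)
      qed
      finally show ?thesis .
    qed
    obtain \<Gamma> where \<Gamma>: "\<Gamma> \<in> couplings (gibbs U) \<mu>" "cost p \<Gamma> \<le> ennreal (err_p p powr p + \<epsilon>')"
      using ex_coupling_small_cost[OF inv p \<epsilon>'] by blast
    have [measurable_cong]: "sets \<Gamma> = sets borel" using \<Gamma> by (simp add: couplings_def)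
    have "c \<le> (\<integral>\<^sup>+ z. ennreal (dist (fst z) (snd z) powr p) \<partial>\<Gamma>)"
      unfolding c_def using \<Gamma>(1) by (rule INF_lower)
    also have "\<dots> \<le> (\<integral>\<^sup>+ z. ennreal (k powr p) * ennreal (nb (fst z - snd z) powr p) \<partial>\<Gamma>)"
    proof (rule nn_integral_mono)
      fix z :: "('a \<times> 'a) \<times> ('a \<times> 'a)"
      have "dist (fst z) (snd z) powr p \<le> (k * nb (fst z - snd z)) powr p"
        using norm_le_nb[of "fst z - snd z"] p by (intro powr_mono2) (auto simp: dist_norm k_def)
      then show "ennreal (dist (fst z) (snd z) powr p) \<le> ennreal (k powr p) * ennreal (nb (fst z - snd z) powr p)"
        using k by (simp add: powr_mult ennreal_mult[symmetric] ennreal_leI)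
    qed
    also have "\<dots> = ennreal (k powr p) * cost p \<Gamma>"
      unfolding cost_def by (intro nn_integral_cmult) measurable
    also have "\<dots> \<le> ennreal (k powr p) * ennreal (err_p p powr p + \<epsilon>')"
      by (intro mult_left_mono \<Gamma>(2)) auto
    also have "\<dots> = ennreal (k powr p * err_p p powr p + k powr p * \<epsilon>')"
      using \<epsilon>' by (simp add: ennreal_mult[symmetric] distrib_left)
    also have "\<dots> \<le> ennreal (k powr p * err_p p powr p + \<epsilon>)"
      using ke by (intro ennreal_leI) simp
    also have "\<dots> = ennreal (k powr p * err_p p powr p) + ennreal \<epsilon>"
      using \<epsilon> by simp
    finally show "c \<le> ennreal (k powr p * err_p p powr p) + ennreal \<epsilon>" .
  qed
  then have c: "c \<le> ennreal ((k * err_p p) powr p)"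
    using k err_p_nonneg[of p] by (simp add: powr_mult)
  then have fin: "c \<noteq> top" by (auto simp: top_unique)
  have "enn2real c \<le> (k * err_p p) powr p"
    using enn2real_mono[OF c] by simp
  then have "enn2real c powr (1 / p) \<le> ((k * err_p p) powr p) powr (1 / p)"
    using p by (intro powr_mono2) auto
  also have "\<dots> = k * err_p p" using k err_p_nonneg[of p] p by (simp add: powr_powr)
  finally have "ennreal (enn2real c powr (1 / p)) \<le> ennreal (k * err_p p)" by (rule ennreal_leI)
  then show ?thesis
    unfolding wasserstein_def c_def[symmetric] Let_def k_def using fin by simp
qed

section \<open>Comparison with the explicit constants\<close>

lemma K1_eq: "K1 L = sqrt 3 * max \<omega> (1 / \<omega>)"
  using L_pos by (simp add: K1_def \<omega>_def powr_half_sqrt powr_minus_divide)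

lemma K3_ge: "L * (1 + \<delta> * L / (2 * sqrt m)) \<le> K3 m L \<delta>"
proof -
  have "0 \<le> exp (L * \<delta>\<^sup>2) * (\<delta> / 6 + \<delta>\<^sup>2 * L / 24)"
    using delta_pos L_pos by simp
  then have "L * 1 \<le> L * (1 + exp (L * \<delta>\<^sup>2) * (\<delta> / 6 + \<delta>\<^sup>2 * L / 24))"
    using L_pos by (intro mult_left_mono) auto
  then show ?thesis
    unfolding K3_def using delta_pos L_pos m_pos by (intro mult_right_mono) (auto simp: add_nonneg_nonneg)
qed

lemma err_p_le: "err_p p \<le> 12 / 5 * \<omega> * \<delta> * A_p p / \<kappa>"
proof -
  have "err_p p \<le> 6 / 5 * \<omega> * \<delta>\<^sup>2 * A_p p / (\<delta> * \<kappa> / 2)"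
    unfolding err_p_def using one_minus_rho_ge omega_pos A_p_pos[of p] delta_pos kappa_pos rho_lt_1
    by (intro divide_left_mono) auto
  also have "\<dots> = 12 / 5 * \<omega> * \<delta> * A_p p / \<kappa>"
    using delta_pos kappa_pos by (simp add: power2_eq_square)
  finally show ?thesis .
qed

text \<open>Absorbs the loss between Euclidean and modified norm: one \<omega> is left from the
  local error, while \<open>K1\<close> and \<open>K3\<close> offer
  \<open>max \<omega> (1 / \<omega>)\<close> and \<open>L\<close>.\<close>

lemma max_omega: "max 1 \<omega> * \<omega> \<le> max \<omega> (1 / \<omega>) * L"
proof (cases "\<omega> \<le> 1")
  case True
  have "1 / \<omega> * L = \<omega>" using omega_mult omega_pos by (simp add: field_simps)
  moreover have "1 / \<omega> * L \<le> max \<omega> (1 / \<omega>) * L" using L_pos by (intro mult_right_mono) auto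
  moreover have mx: "max 1 \<omega> = 1" using True by simp
  ultimately show ?thesis unfolding mx by simp
next
  case False
  have "1 * L \<le> \<omega> * L" using False L_pos by (intro mult_right_mono) auto
  also have "\<dots> \<le> max \<omega> (1 / \<omega>) * L" using L_pos by (intro mult_right_mono) auto
  finally have "L \<le> max \<omega> (1 / \<omega>) * L" by simp
  moreover have mx: "max 1 \<omega> = \<omega>" using False by simp
  ultimately show ?thesis unfolding mx omega_mult by simp
qed

theorem wasserstein_bound:
  assumes inv: "invariant_prob (obabo_kernel \<delta> \<gamma> U) \<mu>" and p: "1 \<le> p"
  shows "wasserstein p (gibbs U) \<mu> \<le>
    ennreal (\<delta> * sqrt (real DIM('a) + max (p - 2) 0) * (2 * K1 L * K3 m L \<delta> / \<kappa>))"
proof (rule order_trans[OF wasserstein_bound_aux[OF inv p]], rule ennreal_leI)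
  define B where "B = 1 + \<delta> * L / (2 * sqrt m)"
  define D where "D = sqrt (dim_p p)"
  have pos: "0 \<le> B" "0 \<le> D" "0 \<le> max 1 \<omega>"
    using delta_pos L_pos m_pos dim_p_pos[of p] by (auto simp: B_def D_def)
  \<comment> \<open>Squared, this is 11.52 against 12; the \<open>sqrt 3\<close> is the one inside
    \<open>K1\<close>.\<close>
  have s: "sqrt 2 * (12 / 5) \<le> 2 * sqrt 3"
    by (rule power2_le_imp_le) (auto simp: power_mult_distrib power_divide)
  have "sqrt 2 * max 1 \<omega> * err_p p \<le> sqrt 2 * max 1 \<omega> * (12 / 5 * \<omega> * \<delta> * A_p p / \<kappa>)"
    using err_p_le by (intro mult_left_mono) auto
  also have "\<dots> = (sqrt 2 * (12 / 5)) * ((max 1 \<omega> * \<omega>) * (\<delta> * D * B / \<kappa>))"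
    unfolding A_p_def B_def[symmetric] D_def[symmetric] by simp
  also have "\<dots> \<le> (2 * sqrt 3) * ((max \<omega> (1 / \<omega>) * L) * (\<delta> * D * B / \<kappa>))"
    using pos delta_pos kappa_pos omega_pos
    by (intro mult_mono[OF s mult_right_mono[OF max_omega]]) auto
  also have "\<dots> = \<delta> * D * (2 * K1 L * (L * B) / \<kappa>)"
    unfolding K1_eq by simp
  also have "\<dots> \<le> \<delta> * D * (2 * K1 L * K3 m L \<delta> / \<kappa>)"
    using K3_ge pos delta_pos kappa_pos omega_pos
    by (intro mult_left_mono divide_right_mono) (auto simp: K1_eq B_def le_max_iff_disj)
  finally show "sqrt 2 * max 1 \<omega> * err_p p \<le> \<delta> * sqrt (real DIM('a) + max (p - 2) 0) * (2 * K1 L * K3 m L \<delta> / \<kappa>)"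
    by (simp add: D_def dim_p_def)
qed

end

section \<open>Maximal couplings\<close>

lemma measure_decompose:
  assumes "finite_measure M" "A \<in> sets M" "Y \<in> sets M"
  shows "measure M A = measure M (A \<inter> Y) + measure M (A - Y)"
proof -
  interpret finite_measure M by fact
  have "measure M ((A \<inter> Y) \<union> (A - Y)) = measure M (A \<inter> Y) + measure M (A - Y)"
    using assms by (intro finite_measure_Union) auto
  then show ?thesis by (simp add: Int_Diff_Un)
qed

text \<open>Used three times for the maximal coupling: for the positive part, the negative part and
  the common part of two laws.\<close>

lemma ex_prob_space_scaled_diff:
  assumes M: "finite_measure M" and N: "finite_measure N" and sets: "sets N = sets M"
    and le: "\<And>A. A \<in> sets M \<Longrightarrow> measure N A \<le> measure M A"
    and r: "0 < r" "r = measure M (space M) - measure N (space M)"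
  shows "\<exists>D. prob_space D \<and> sets D = sets M \<and> (\<forall>A\<in>sets M. emeasure D A = ennreal ((measure M A - measure N A) / r))"
proof -
  interpret M: finite_measure M by fact
  interpret N: finite_measure N by fact
  define D where "D = scale_measure (ennreal (1 / r)) (diff_measure M N)"
  have D: "emeasure D A = ennreal ((measure M A - measure N A) / r)" if "A \<in> sets M" for A
  proof -
    have "emeasure (diff_measure M N) A = emeasure M A - emeasure N A"
      using that sets le M N
      by (intro emeasure_diff_measure) (auto simp: M.emeasure_eq_measure N.emeasure_eq_measure)
    also have "\<dots> = ennreal (measure M A - measure N A)"
      by (simp add: M.emeasure_eq_measure N.emeasure_eq_measure ennreal_minus)
    finally show ?thesis using r le[OF that] by (simp add: D_def ennreal_mult[symmetric])
  qed
  have "sets D = sets M" by (simp add: D_def)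
  moreover have "prob_space D"
  proof
    have "space D = space M" using \<open>sets D = sets M\<close> by (rule sets_eq_imp_space_eq)
    then show "emeasure D (space D) = 1" using D[of "space M"] r by simp
  qed
  ultimately show ?thesis using D by blast
qed

text \<open>On a Hahn set \<open>Y\<close> the first measure dominates, off \<open>Y\<close> the
  second. The excess \<open>r\<close> is the same on both sides, and the one-sided hypothesis tested
  on \<open>- Y\<close> gives \<open>r \<le> \<epsilon>\<close>. The cases \<open>r = 0\<close> and
  \<open>r = 1\<close> are separate because \<open>r\<close> and \<open>1 - r\<close> become
  denominators.\<close>

lemma ex_maximal_coupling:
  fixes M N :: "'b::{t2_space, second_countable_topology} measure"
  assumes M: "prob_space M" "sets M = sets borel" and N: "prob_space N" "sets N = sets borel"
    and le: "\<And>A. A \<in> sets borel \<Longrightarrow> measure N A \<le> measure M A + \<epsilon>"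
  shows "\<exists>\<Gamma>\<in>couplings M N. emeasure \<Gamma> {z. fst z \<noteq> snd z} \<le> ennreal \<epsilon>"
proof -
  interpret M: prob_space M by fact
  interpret N: prob_space N by fact
  have spM: "space M = UNIV" and spN: "space N = UNIV"
    using M(2) N(2) sets_eq_imp_space_eq[of M borel] sets_eq_imp_space_eq[of N borel] by auto
  have neq [measurable]: "{z :: 'b \<times> 'b. fst z \<noteq> snd z} \<in> sets borel"
  proof -
    have "{z :: 'b \<times> 'b. fst z \<noteq> snd z} = {(x, y) |x y. x \<noteq> y}" by auto
    then have "open {z :: 'b \<times> 'b. fst z \<noteq> snd z}" by (simp only: open_diagonal_complement)
    then show ?thesis by (rule borel_open)
  qed
  have "\<exists>Y\<in>sets M. Y \<subseteq> UNIV \<and> (\<forall>X\<in>sets M. X \<subseteq> Y \<longrightarrow> N X \<le> M X) \<and> (\<forall>X\<in>sets M. X \<subseteq> UNIV \<longrightarrow> X \<inter> Y = {} \<longrightarrow> M X \<le> N X)"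
    using M(2) N(2) by (intro unsigned_Hahn_decomposition) auto
  then obtain Y where Y: "Y \<in> sets borel" "\<And>X. X \<in> sets borel \<Longrightarrow> X \<subseteq> Y \<Longrightarrow> N X \<le> M X"
    "\<And>X. X \<in> sets borel \<Longrightarrow> X \<inter> Y = {} \<Longrightarrow> M X \<le> N X"
    using M(2) by auto
  define m n where "m = measure M" and "n = measure N"
  have yM: "n X \<le> m X" if "X \<in> sets borel" "X \<subseteq> Y" for X
    using Y(2)[OF that] by (simp add: m_def n_def M.emeasure_eq_measure N.emeasure_eq_measure)
  have yN: "m X \<le> n X" if "X \<in> sets borel" "X \<inter> Y = {}" for X
    using Y(3)[OF that] by (simp add: m_def n_def M.emeasure_eq_measure N.emeasure_eq_measure)
  have nn: "0 \<le> m (A - Y)" "0 \<le> n (A \<inter> Y)" for A by (simp_all add: m_def n_def)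
  have yC: "m (A - Y) \<le> n (A - Y)" if "A \<in> sets borel" for A
    using that Y(1) by (intro yN) auto
  have dM: "m A = m (A \<inter> Y) + m (A - Y)" and dN: "n A = n (A \<inter> Y) + n (A - Y)" if "A \<in> sets borel" for A
    unfolding m_def n_def using that Y(1) M N
    by (auto intro!: measure_decompose M.finite_measure_axioms N.finite_measure_axioms)
  define r where "r = m Y - n Y"
  have m1: "m UNIV = 1" "n UNIV = 1" using M.prob_space N.prob_space by (auto simp: m_def n_def spM spN)
  have mY: "m Y + m (- Y) = 1" "n Y + n (- Y) = 1"
    using dM[of UNIV] dN[of UNIV] m1 by (auto simp: Compl_eq_Diff_UNIV)
  have r': "r = n (- Y) - m (- Y)" using mY by (simp add: r_def)
  have r\<epsilon>: "r \<le> \<epsilon>" using le[of "- Y"] Y(1) unfolding r' m_def n_def by (simp add: borel_comp)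
  have r0: "0 \<le> r" using yM[of Y] Y(1) by (simp add: r_def)
  have r1: "r \<le> 1" using mY measure_nonneg[of M "- Y"] measure_nonneg[of N Y] unfolding r_def m_def n_def by linarith
  consider "r = 0" | "r = 1" | "0 < r" "r < 1" using r0 r1 by linarith
  then show ?thesis
  proof cases
    case 1
    have "m A = n A" if A: "A \<in> sets borel" for A
    proof -
      have "m Y = m (Y \<inter> A) + m (Y - A)" "n Y = n (Y \<inter> A) + n (Y - A)"
        unfolding m_def n_def using A Y(1) M N
        by (auto intro!: measure_decompose M.finite_measure_axioms N.finite_measure_axioms)
      moreover have "n (Y \<inter> A) \<le> m (Y \<inter> A)" "n (Y - A) \<le> m (Y - A)" using A Y(1) by (auto intro!: yM)
      moreover have "m (- Y) = m (- Y \<inter> A) + m (- Y - A)" "n (- Y) = n (- Y \<inter> A) + n (- Y - A)"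
        unfolding m_def n_def using A Y(1) M N
        by (auto intro!: measure_decompose M.finite_measure_axioms N.finite_measure_axioms simp: borel_comp)
      moreover have "m (- Y \<inter> A) \<le> n (- Y \<inter> A)" "m (- Y - A) \<le> n (- Y - A)"
        using A Y(1) by (auto intro!: yN sets.Int sets.Diff borel_comp)
      ultimately have "m (Y \<inter> A) = n (Y \<inter> A)" "m (- Y \<inter> A) = n (- Y \<inter> A)"
        using 1 r' unfolding r_def by linarith+
      moreover have "A \<inter> Y = Y \<inter> A" "A - Y = - Y \<inter> A" by auto
      ultimately show ?thesis using dM[OF A] dN[OF A] by simp
    qed
    then have MN: "M = N" using M N by (intro measure_eqI) (auto simp: m_def n_def M.emeasure_eq_measure N.emeasure_eq_measure)
    note M(2)[measurable_cong]
    define \<Gamma> where "\<Gamma> = distr M borel (\<lambda>x. (x, x))"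
    have "distr \<Gamma> borel fst = M" "distr \<Gamma> borel snd = N"
      unfolding \<Gamma>_def MN[symmetric] using M(2)
      by (auto simp: distr_distr comp_def intro!: distr_id2)
    moreover have "prob_space \<Gamma>" unfolding \<Gamma>_def by (intro M.prob_space_distr) measurable
    ultimately have "\<Gamma> \<in> couplings M N" by (simp add: couplings_def \<Gamma>_def)
    moreover have "emeasure \<Gamma> {z. fst z \<noteq> snd z} = 0"
      unfolding \<Gamma>_def by (subst emeasure_distr) auto
    ultimately show ?thesis by (intro bexI[of _ \<Gamma>]) auto
  next
    case 2
    have G: "M \<Otimes>\<^sub>M N \<in> couplings M N" using M N by (intro pair_in_couplings)
    have "emeasure (M \<Otimes>\<^sub>M N) {z. fst z \<noteq> snd z} \<le> 1"
      using G by (intro prob_space.emeasure_le_1) (simp add: couplings_def)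
    also have "1 \<le> ennreal \<epsilon>" using ennreal_leI[OF r\<epsilon>] 2 by simp
    finally show ?thesis using G by (intro bexI[of _ "M \<Otimes>\<^sub>M N"])
  next
    case 3
    define MY NY where "MY = density M (indicator Y)" and "NY = density N (indicator Y)"
    define MC NC where "MC = density M (indicator (- Y))" and "NC = density N (indicator (- Y))"
    have em: "emeasure (density M (indicator B)) A = ennreal (m (A \<inter> B))" if "A \<in> sets borel" "B \<in> sets borel" for A B
    proof -
      have "emeasure (density M (indicator B)) A = (\<integral>\<^sup>+x. indicator B x * indicator A x \<partial>M)"
        using that M(2) by (intro emeasure_density) auto
      also have "\<dots> = (\<integral>\<^sup>+x. indicator (A \<inter> B) x \<partial>M)"
        by (intro nn_integral_cong) (auto simp: indicator_def)
      also have "\<dots> = ennreal (m (A \<inter> B))"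
        using that M(2) by (simp add: m_def M.emeasure_eq_measure)
      finally show ?thesis .
    qed
    have en: "emeasure (density N (indicator B)) A = ennreal (n (A \<inter> B))" if "A \<in> sets borel" "B \<in> sets borel" for A B
    proof -
      have "emeasure (density N (indicator B)) A = (\<integral>\<^sup>+x. indicator B x * indicator A x \<partial>N)"
        using that N(2) by (intro emeasure_density) auto
      also have "\<dots> = (\<integral>\<^sup>+x. indicator (A \<inter> B) x \<partial>N)"
        by (intro nn_integral_cong) (auto simp: indicator_def)
      also have "\<dots> = ennreal (n (A \<inter> B))"
        using that N(2) by (simp add: n_def N.emeasure_eq_measure)
      finally show ?thesis .
    qed
    have YC: "- Y \<in> sets borel" using Y(1) by (simp add: borel_comp)
    have sp: "space MY = UNIV" "space NY = UNIV" "space MC = UNIV" "space NC = UNIV"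
      by (simp_all add: MY_def NY_def MC_def NC_def spM spN)
    have st: "sets MY = sets borel" "sets NY = sets borel" "sets MC = sets borel" "sets NC = sets borel"
      by (simp_all add: MY_def NY_def MC_def NC_def M N)
    have meas: "measure MY A = m (A \<inter> Y)" "measure NY A = n (A \<inter> Y)"
      "measure MC A = m (A - Y)" "measure NC A = n (A - Y)" if "A \<in> sets borel" for A
      using that Y(1) YC em en
      by (simp_all add: measure_def MY_def NY_def MC_def NC_def Diff_eq m_def n_def)
    have fin: "finite_measure MY" "finite_measure NY" "finite_measure MC" "finite_measure NC"
      using em[of UNIV] en[of UNIV] Y(1) YC
      by (auto intro!: finite_measureI simp: MY_def NY_def MC_def NC_def spM spN)
    \<comment> \<open>\<open>P\<close> and \<open>Q\<close> are the normalised positive parts of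
      \<open>M - N\<close> and of \<open>N - M\<close>.\<close>
    obtain P where P: "prob_space P" "sets P = sets borel"
      "\<And>A. A \<in> sets borel \<Longrightarrow> emeasure P A = ennreal ((m (A \<inter> Y) - n (A \<inter> Y)) / r)"
    proof -
      have "\<exists>D. prob_space D \<and> sets D = sets MY \<and> (\<forall>A\<in>sets MY. emeasure D A = ennreal ((measure MY A - measure NY A) / r))"
        by (rule ex_prob_space_scaled_diff)
          (use fin st sp meas Y(1) yM 3 in \<open>auto simp: r_def\<close>)
      then show ?thesis using that st meas by auto
    qed
    obtain Q where Q: "prob_space Q" "sets Q = sets borel"
      "\<And>A. A \<in> sets borel \<Longrightarrow> emeasure Q A = ennreal ((n (A - Y) - m (A - Y)) / r)"
    proof -
      have "\<exists>D. prob_space D \<and> sets D = sets NC \<and> (\<forall>A\<in>sets NC. emeasure D A = ennreal ((measure NC A - measure MC A) / r))"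
        by (rule ex_prob_space_scaled_diff)
          (use fin st sp meas Y(1) yC 3 in \<open>auto simp: r' Compl_eq_Diff_UNIV\<close>)
      then show ?thesis using that st meas by auto
    qed
    interpret P: prob_space P by fact
    interpret Q: prob_space Q by fact
    define rP where "rP = scale_measure (ennreal r) P"
    have rP: "emeasure rP A = ennreal (m (A \<inter> Y) - n (A \<inter> Y))" if "A \<in> sets borel" for A
      using P(3)[OF that] 3 yM[of "A \<inter> Y"] that Y(1) by (simp add: rP_def ennreal_mult[symmetric])
    have mrP: "measure rP A = m (A \<inter> Y) - n (A \<inter> Y)" if "A \<in> sets borel" for A
      using rP[OF that] yM[of "A \<inter> Y"] that Y(1) by (simp add: measure_def)
    \<comment> \<open>The normalised minimum of the two measures: \<open>M\<close> without its
      excess over \<open>N\<close>.\<close>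
    obtain K where K: "prob_space K" "sets K = sets borel"
      "\<And>A. A \<in> sets borel \<Longrightarrow> emeasure K A = ennreal ((m A - (m (A \<inter> Y) - n (A \<inter> Y))) / (1 - r))"
    proof -
      have "\<exists>D. prob_space D \<and> sets D = sets M \<and> (\<forall>A\<in>sets M. emeasure D A = ennreal ((measure M A - measure rP A) / (1 - r)))"
      proof (rule ex_prob_space_scaled_diff)
        show "finite_measure M" by (rule M.finite_measure_axioms)
        show "finite_measure rP"
        proof (rule finite_measureI)
          have "sets rP = sets borel" by (simp add: rP_def P(2))
          from sets_eq_imp_space_eq[OF this] have "space rP = UNIV" by simp
          then show "emeasure rP (space rP) \<noteq> \<infinity>" using rP[of UNIV] by simp
        qed
        show "sets rP = sets M" using P(2) M(2) by (simp add: rP_def)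
        show "measure rP A \<le> measure M A" if "A \<in> sets M" for A
        proof -
          have A: "A \<in> sets borel" using that M(2) by simp
          show ?thesis
            using mrP[OF A] dM[OF A] nn[of A] unfolding m_def[symmetric] by simp
        qed
        show "1 - r = measure M (space M) - measure rP (space M)"
          using mrP[of UNIV] m1 unfolding spM m_def[symmetric] by (simp add: r_def)
      qed (use 3 in simp)
      then show ?thesis using that M(2) mrP by (auto simp: m_def)
    qed
    interpret K: prob_space K by fact
    define B where "B = measure_pmf (bernoulli_pmf (1 - r))"
    interpret B: prob_space B unfolding B_def by (rule prob_space_measure_pmf)
    interpret PQ: pair_prob_space P Q ..
    interpret KPQ: pair_prob_space K "P \<Otimes>\<^sub>M Q" ..
    interpret BK: pair_prob_space B "K \<Otimes>\<^sub>M (P \<Otimes>\<^sub>M Q)" ..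
    \<comment> \<open>Mixture: with probability \<open>1 - r\<close> both coordinates equal one
      sample of \<open>K\<close>, with probability \<open>r\<close> they are independent samples of
      \<open>P\<close> and \<open>Q\<close>. Only the second branch can leave the diagonal.\<close>
    define T :: "bool \<times> 'b \<times> 'b \<times> 'b \<Rightarrow> 'b \<times> 'b" where
      "T x = (if fst x then (fst (snd x), fst (snd x)) else snd (snd x))" for x
    have [measurable_cong]: "sets B = sets (count_space UNIV)" by (simp add: B_def)
    note K(2)[measurable_cong] P(2)[measurable_cong] Q(2)[measurable_cong]
    have setsPQ: "sets (P \<Otimes>\<^sub>M Q) = sets borel"
      unfolding borel_prod[symmetric] by (rule sets_pair_measure_cong[OF P(2) Q(2)])
    have pq: "(\<lambda>x. x) \<in> measurable (P \<Otimes>\<^sub>M Q) borel"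
      using setsPQ by (rule measurable_ident_sets)
    have T [measurable]: "T \<in> measurable (B \<Otimes>\<^sub>M (K \<Otimes>\<^sub>M (P \<Otimes>\<^sub>M Q))) borel"
    proof -
      have "(\<lambda>x. snd (snd x)) \<in> measurable (B \<Otimes>\<^sub>M (K \<Otimes>\<^sub>M (P \<Otimes>\<^sub>M Q))) borel"
        by (rule measurable_compose[OF _ pq]) measurable
      then show ?thesis unfolding T_def[abs_def] by measurable
    qed
    define \<Gamma> where "\<Gamma> = distr (B \<Otimes>\<^sub>M (K \<Otimes>\<^sub>M (P \<Otimes>\<^sub>M Q))) borel T"
    have int: "emeasure \<Gamma> S = ennreal (1 - r) * (\<integral>\<^sup>+x. indicator S (x, x) \<partial>K) + ennreal r * (\<integral>\<^sup>+y. \<integral>\<^sup>+z. indicator S (y, z) \<partial>Q \<partial>P)"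
      if S[measurable]: "S \<in> sets borel" for S
    proof -
      have [measurable]: "(\<lambda>y. indicator S y :: ennreal) \<in> borel_measurable (P \<Otimes>\<^sub>M Q)"
        by (rule measurable_compose[OF pq]) measurable
      have "emeasure \<Gamma> S = (\<integral>\<^sup>+z. indicator S z \<partial>\<Gamma>)" by (simp add: \<Gamma>_def)
      also have "\<dots> = (\<integral>\<^sup>+x. indicator S (T x) \<partial>(B \<Otimes>\<^sub>M (K \<Otimes>\<^sub>M (P \<Otimes>\<^sub>M Q))))"
        unfolding \<Gamma>_def by (subst nn_integral_distr) auto
      also have "\<dots> = (\<integral>\<^sup>+b. \<integral>\<^sup>+x. indicator S (T (b, x)) \<partial>(K \<Otimes>\<^sub>M (P \<Otimes>\<^sub>M Q)) \<partial>B)"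
        by (rule KPQ.P.nn_integral_fst[symmetric]) measurable
      also have "\<dots> = (\<integral>\<^sup>+x. indicator S (T (True, x)) \<partial>(K \<Otimes>\<^sub>M (P \<Otimes>\<^sub>M Q))) * ennreal (1 - r)
          + (\<integral>\<^sup>+x. indicator S (T (False, x)) \<partial>(K \<Otimes>\<^sub>M (P \<Otimes>\<^sub>M Q))) * ennreal r"
        unfolding B_def using 3 by (subst nn_integral_bernoulli_pmf) auto
      also have "(\<integral>\<^sup>+x. indicator S (T (True, x)) \<partial>(K \<Otimes>\<^sub>M (P \<Otimes>\<^sub>M Q))) = (\<integral>\<^sup>+x. indicator S (fst x, fst x) \<partial>(K \<Otimes>\<^sub>M (P \<Otimes>\<^sub>M Q)))"
        by (simp add: T_def)
      also have "\<dots> = (\<integral>\<^sup>+x. \<integral>\<^sup>+y. indicator S (x, x) \<partial>(P \<Otimes>\<^sub>M Q) \<partial>K)"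
        by (subst PQ.P.nn_integral_fst[symmetric]) auto
      also have "\<dots> = (\<integral>\<^sup>+x. indicator S (x, x) \<partial>K)"
        by (simp add: PQ.P.emeasure_space_1)
      also have "(\<integral>\<^sup>+x. indicator S (T (False, x)) \<partial>(K \<Otimes>\<^sub>M (P \<Otimes>\<^sub>M Q))) = (\<integral>\<^sup>+x. indicator S (snd x) \<partial>(K \<Otimes>\<^sub>M (P \<Otimes>\<^sub>M Q)))"
        by (simp add: T_def)
      also have "\<dots> = (\<integral>\<^sup>+x. \<integral>\<^sup>+y. indicator S y \<partial>(P \<Otimes>\<^sub>M Q) \<partial>K)"
        by (subst PQ.P.nn_integral_fst[symmetric]) (auto intro!: measurable_compose[OF measurable_snd])
      also have "\<dots> = (\<integral>\<^sup>+y. indicator S y \<partial>(P \<Otimes>\<^sub>M Q))" by (simp add: K.emeasure_space_1)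
      also have "\<dots> = (\<integral>\<^sup>+y. \<integral>\<^sup>+z. indicator S (y, z) \<partial>Q \<partial>P)"
        by (rule Q.nn_integral_fst[symmetric]) measurable
      finally show ?thesis by (simp add: mult.commute)
    qed
    have sets\<Gamma>: "sets \<Gamma> = sets borel" by (simp add: \<Gamma>_def)
    have A1: "emeasure \<Gamma> (fst -` A) = emeasure M A" if A[measurable]: "A \<in> sets borel" for A
    proof -
      have vA: "fst -` A \<in> sets (borel :: ('b \<times> 'b) measure)"
        using measurable_sets[OF borel_measurable_fst_borel[OF measurable_ident] A] by simp
      have "emeasure \<Gamma> (fst -` A) = ennreal (1 - r) * (\<integral>\<^sup>+x. indicator A x \<partial>K) + ennreal r * (\<integral>\<^sup>+y. \<integral>\<^sup>+z. indicator A y \<partial>Q \<partial>P)"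
      proof -
        have i: "indicator (fst -` A) (x, y) = (indicator A x :: ennreal)" for x y
          by (simp add: indicator_def)
        show ?thesis by (simp only: int[OF vA] i)
      qed
      also have "\<dots> = ennreal (1 - r) * emeasure K A + ennreal r * emeasure P A"
      proof -
        have "(\<integral>\<^sup>+z. indicator A y \<partial>Q) = (indicator A y :: ennreal)" for y
          by (simp only: nn_integral_const Q.emeasure_space_1 mult_1_right)
        moreover have "A \<in> sets K" "A \<in> sets P" using K(2) P(2) A by auto
        ultimately show ?thesis by (simp only: nn_integral_indicator)
      qed
      also have "\<dots> = ennreal (m A - (m (A \<inter> Y) - n (A \<inter> Y))) + ennreal (m (A \<inter> Y) - n (A \<inter> Y))"
        using 3 K(3)[OF A] P(3)[OF A] yM[of "A \<inter> Y"] dM[OF A] Y(1) nn[of A]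
        by (simp add: ennreal_mult[symmetric])
      also have "\<dots> = ennreal (m A)"
        using yM[of "A \<inter> Y"] dM[OF A] Y(1) nn[of A]
        by (subst ennreal_plus[symmetric]) auto
      finally show ?thesis by (simp add: m_def M.emeasure_eq_measure)
    qed
    have A2: "emeasure \<Gamma> (snd -` A) = emeasure N A" if A[measurable]: "A \<in> sets borel" for A
    proof -
      have vA: "snd -` A \<in> sets (borel :: ('b \<times> 'b) measure)"
        using measurable_sets[OF borel_measurable_snd_borel[OF measurable_ident] A] by simp
      have "emeasure \<Gamma> (snd -` A) = ennreal (1 - r) * (\<integral>\<^sup>+x. indicator A x \<partial>K) + ennreal r * (\<integral>\<^sup>+y. \<integral>\<^sup>+z. indicator A z \<partial>Q \<partial>P)"
      proof -
        have i: "indicator (snd -` A) (x, y) = (indicator A y :: ennreal)" for x y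
          by (simp add: indicator_def)
        show ?thesis by (simp only: int[OF vA] i)
      qed
      also have "\<dots> = ennreal (1 - r) * emeasure K A + ennreal r * emeasure Q A"
      proof -
        have "A \<in> sets K" "A \<in> sets Q" using K(2) Q(2) A by auto
        then show ?thesis by (simp only: nn_integral_indicator nn_integral_const P.emeasure_space_1 mult_1_right)
      qed
      also have "\<dots> = ennreal (m A - (m (A \<inter> Y) - n (A \<inter> Y))) + ennreal (n (A - Y) - m (A - Y))"
        using 3 K(3)[OF A] Q(3)[OF A] yN[of "A - Y"] dM[OF A] Y(1) nn[of A]
        by (simp add: ennreal_mult[symmetric] Diff_Int_distrib2)
      also have "\<dots> = ennreal (n A)"
      proof -
        have "m (A - Y) \<le> n (A - Y)" using A Y(1) by (intro yN) auto
        then show ?thesis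
          using dM[OF A] dN[OF A] nn[of A]
          by (subst ennreal_plus[symmetric]) auto
      qed
      finally show ?thesis by (simp add: n_def N.emeasure_eq_measure)
    qed
    note sets\<Gamma>[measurable_cong]
    have "distr \<Gamma> borel fst = M"
    proof (rule measure_eqI)
      fix A assume "A \<in> sets (distr \<Gamma> borel fst)"
      then have A: "A \<in> sets borel" by simp
      then show "emeasure (distr \<Gamma> borel fst) A = emeasure M A"
        using A1[OF A] by (subst emeasure_distr) (auto simp: \<Gamma>_def)
    qed (simp add: M)
    moreover have "distr \<Gamma> borel snd = N"
    proof (rule measure_eqI)
      fix A assume "A \<in> sets (distr \<Gamma> borel snd)"
      then have A: "A \<in> sets borel" by simp
      then show "emeasure (distr \<Gamma> borel snd) A = emeasure N A"
        using A2[OF A] by (subst emeasure_distr) (auto simp: \<Gamma>_def)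
    qed (simp add: N)
    moreover have "prob_space \<Gamma>" unfolding \<Gamma>_def by (intro BK.P.prob_space_distr T)
    ultimately have "\<Gamma> \<in> couplings M N" using sets\<Gamma> by (simp add: couplings_def)
    moreover have "emeasure \<Gamma> {z. fst z \<noteq> snd z} \<le> ennreal \<epsilon>"
    proof -
      have "emeasure \<Gamma> {z. fst z \<noteq> snd z} \<le> ennreal (1 - r) * 0 + ennreal r * (\<integral>\<^sup>+y. \<integral>\<^sup>+z. 1 \<partial>Q \<partial>P)"
        unfolding int[OF neq] by (intro add_mono mult_left_mono nn_integral_mono) (auto simp: indicator_def)
      also have "\<dots> = ennreal r" by (simp add: P.emeasure_space_1 Q.emeasure_space_1)
      also have "\<dots> \<le> ennreal \<epsilon>" using r\<epsilon> by (rule ennreal_leI)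
      finally show ?thesis .
    qed
    ultimately show ?thesis by blast
  qed
qed

lemma tv_dist_le:
  fixes M N :: "'b::{t2_space, second_countable_topology} measure"
  assumes "prob_space M" "sets M = sets borel" "prob_space N" "sets N = sets borel"
    and "\<And>A. A \<in> sets borel \<Longrightarrow> measure N A \<le> measure M A + \<epsilon>" and "0 \<le> \<epsilon>"
  shows "tv_dist M N \<le> ennreal (2 * \<epsilon>)"
proof -
  obtain \<Gamma> where \<Gamma>: "\<Gamma> \<in> couplings M N" "emeasure \<Gamma> {z. fst z \<noteq> snd z} \<le> ennreal \<epsilon>"
    using ex_maximal_coupling[OF assms(1-5)] by blast
  have "tv_dist M N \<le> 2 * emeasure \<Gamma> {z. fst z \<noteq> snd z}"
    unfolding tv_dist_def using \<Gamma>(1) by (rule INF_lower)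
  also have "\<dots> \<le> 2 * ennreal \<epsilon>" using \<Gamma>(2) by (rule mult_left_mono) simp
  also have "\<dots> = ennreal (2 * \<epsilon>)" using assms(6) by (simp add: ennreal_mult)
  finally show ?thesis .
qed

section \<open>Regularisation by the noise\<close>

text \<open>The Cameron-Martin formula: the new weight is the quotient of the translated and the
  original density.\<close>

lemma nn_integral_gaussian_translate:
  fixes a :: "'a::euclidean_space"
  assumes [measurable]: "F \<in> borel_measurable borel"
  shows "(\<integral>\<^sup>+w. F (w + a) \<partial>std_gaussian) = (\<integral>\<^sup>+w. ennreal (exp (a \<bullet> w - (norm a)\<^sup>2 / 2)) * F w \<partial>std_gaussian)"
proof -
  define k where "k = gauss_const TYPE('a)"
  have k: "0 < k" using gauss_const_pos by (simp add: k_def)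
  define \<phi> where "\<phi> x = ennreal (k * exp (- ((norm x)\<^sup>2 / 2)))" for x :: 'a
  have [measurable]: "\<phi> \<in> borel_measurable borel" unfolding \<phi>_def[abs_def] by measurable
  have G: "std_gaussian = density lborel \<phi>" by (simp add: std_gaussian_eq \<phi>_def[abs_def] k_def)
  have int: "(\<integral>\<^sup>+w. H w \<partial>std_gaussian) = (\<integral>\<^sup>+w. \<phi> w * H w \<partial>lborel)" if "H \<in> borel_measurable borel" for H
    unfolding G using that by (intro nn_integral_density) auto
  have "(\<integral>\<^sup>+w. F (w + a) \<partial>std_gaussian) = (\<integral>\<^sup>+w. \<phi> w * F (w + a) \<partial>lborel)"
    by (rule int) measurable
  also have "\<dots> = ennreal (1 ^ DIM('a)) * (\<integral>\<^sup>+w. \<phi> (- a + 1 *\<^sub>R w) * F (- a + 1 *\<^sub>R w + a) \<partial>lborel)"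
    by (intro nn_integral_lborel_affine) auto
  also have "\<dots> = (\<integral>\<^sup>+w. \<phi> w * (ennreal (exp (a \<bullet> w - (norm a)\<^sup>2 / 2)) * F w) \<partial>lborel)"
  proof -
    have "\<phi> (- a + w) = \<phi> w * ennreal (exp (a \<bullet> w - (norm a)\<^sup>2 / 2))" for w
    proof -
      have "(norm (- a + w))\<^sup>2 = (norm w)\<^sup>2 + (norm a)\<^sup>2 - 2 * (a \<bullet> w)"
        unfolding power2_norm_eq_inner by (simp add: inner_diff_left inner_diff_right inner_commute)
      then have e: "- ((norm (- a + w))\<^sup>2 / 2) = - ((norm w)\<^sup>2 / 2) + (a \<bullet> w - (norm a)\<^sup>2 / 2)"
        by (simp only: diff_divide_distrib add_divide_distrib)
      show ?thesis unfolding \<phi>_def e exp_add using k by (simp add: ennreal_mult mult.assoc)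
    qed
    then show ?thesis by (simp add: mult.assoc)
  qed
  also have "\<dots> = (\<integral>\<^sup>+w. ennreal (exp (a \<bullet> w - (norm a)\<^sup>2 / 2)) * F w \<partial>std_gaussian)"
    by (rule int[symmetric]) measurable
  finally show ?thesis .
qed

lemma nn_integral_gaussian_exp:
  fixes a :: "'a::euclidean_space"
  shows "(\<integral>\<^sup>+w. ennreal (exp (a \<bullet> w - (norm a)\<^sup>2 / 2)) \<partial>std_gaussian) = 1"
  using nn_integral_gaussian_translate[of "\<lambda>_. 1" a] std_gaussian.emeasure_space_1[where 'a='a] by simp

lemma ennreal_enn2real_le_1: "(x :: ennreal) \<le> 1 \<Longrightarrow> ennreal (enn2real x) = x"
  by (rule ennreal_enn2real) (rule le_less_trans[OF _ ennreal_one_less_top])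

text \<open>The constant \<open>3/2\<close> is not optimal; linear growth in \<open>norm a\<close>, independently of the
  dimension, is what matters.\<close>

lemma gaussian_shift:
  fixes a :: "'a::euclidean_space"
  assumes f[measurable]: "f \<in> borel_measurable borel" and f1: "\<And>w. f w \<le> 1"
  shows "(\<integral>\<^sup>+w. f (w + a) \<partial>std_gaussian) \<le> (\<integral>\<^sup>+w. f w \<partial>std_gaussian) + ennreal (3 / 2 * norm a)"
proof -
  define t where "t = norm a"
  have one: "(\<integral>\<^sup>+w. 1 \<partial>(std_gaussian :: 'a measure)) = 1"
    using std_gaussian.emeasure_space_1[where 'a='a] by simp
  have I1: "(\<integral>\<^sup>+w. f (w + a) \<partial>std_gaussian) \<le> 1" "(\<integral>\<^sup>+w. f w \<partial>std_gaussian) \<le> 1"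
  proof -
    have "(\<integral>\<^sup>+w. h w \<partial>std_gaussian) \<le> 1" if "\<And>w. h w \<le> 1" for h :: "'a \<Rightarrow> ennreal"
      using nn_integral_mono[of "std_gaussian :: 'a measure" h "\<lambda>_. 1"] that by (simp only: one)
    then show "(\<integral>\<^sup>+w. f (w + a) \<partial>std_gaussian) \<le> 1" "(\<integral>\<^sup>+w. f w \<partial>std_gaussian) \<le> 1"
      using f1 by auto
  qed
  consider "t = 0" | "1 < t" | "0 < t" "t \<le> 1" using norm_ge_zero[of a] unfolding t_def by linarith
  then show ?thesis
  proof cases
    case 1
    then show ?thesis by (simp add: t_def)
  next
    case 2
    then have "(1::ennreal) \<le> ennreal (3 / 2 * norm a)" by (simp add: t_def flip: ennreal_1)
    then show ?thesis using order_trans[OF I1(1)] by (intro add_increasing) auto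
  next
    case 3
    define E where "E w = exp (a \<bullet> w - (norm a)\<^sup>2 / 2)" for w
    have [measurable]: "E \<in> borel_measurable borel" unfolding E_def[abs_def] by measurable
    define I F where "I = enn2real (\<integral>\<^sup>+w. f (w + a) \<partial>std_gaussian)" and "F = enn2real (\<integral>\<^sup>+w. f w \<partial>std_gaussian)"
    have IF: "(\<integral>\<^sup>+w. f (w + a) \<partial>std_gaussian) = ennreal I" "(\<integral>\<^sup>+w. f w \<partial>std_gaussian) = ennreal F" "0 \<le> I" "0 \<le> F"
      using I1 by (auto simp: I_def F_def ennreal_enn2real_le_1)
    have E2: "(\<integral>\<^sup>+w. ennreal ((E w)\<^sup>2) \<partial>std_gaussian) = ennreal (exp (t\<^sup>2))"
    proof -
      have e: "(E w)\<^sup>2 = exp (t\<^sup>2) * exp ((2 *\<^sub>R a) \<bullet> w - (norm (2 *\<^sub>R a))\<^sup>2 / 2)" for w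
        by (simp add: E_def t_def power2_eq_square mult_exp_exp)
      show ?thesis
        unfolding e using nn_integral_gaussian_exp[of "2 *\<^sub>R a"]
        by (simp add: ennreal_mult nn_integral_cmult)
    qed
    \<comment> \<open>The difference of the integrals is at most the mean of
      \<open>\<bar>E w - 1\<bar>\<close>, estimated by
      \<open>((E w - 1)\<^sup>2 / t + t) / 2\<close>, whose integral needs only the second moment of
      \<open>E\<close>. Subtracted terms are moved across, so that all integrals are of nonnegative
      functions.\<close>
    have pt: "ennreal (E w) * f w + ennreal (1 / t) * ennreal (E w) \<le> f w + (ennreal (1 / (2 * t)) * ennreal ((E w)\<^sup>2) + ennreal (1 / (2 * t) + t / 2))" for w
    proof -
      define r where "r = enn2real (f w)"
      have r: "f w = ennreal r" "0 \<le> r" "r \<le> 1"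
        using f1[of w] enn2real_mono[OF f1[of w]] by (auto simp: r_def ennreal_enn2real_le_1)
      have E0: "0 \<le> E w" by (simp add: E_def)
      define D where "D = E w - 1"
      have "r * D \<le> \<bar>D\<bar>" 
      proof -
        have "r * D \<le> r * \<bar>D\<bar>" using r by (intro mult_left_mono) auto
        also have "\<dots> \<le> 1 * \<bar>D\<bar>" using r by (intro mult_right_mono) auto
        finally show ?thesis by simp
      qed
      also have "\<bar>D\<bar> \<le> (D\<^sup>2 / t + t) / 2"
      proof -
        have "0 \<le> (\<bar>D\<bar> - t)\<^sup>2 / t" using 3 by simp
        also have "\<dots> = D\<^sup>2 / t + t - 2 * \<bar>D\<bar>" using 3 by (simp add: power2_diff field_simps power2_eq_square)
        finally show ?thesis by simp
      qed
      finally have "r * (E w - 1) \<le> ((E w - 1)\<^sup>2 / t + t) / 2" by (simp add: D_def)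
      moreover have "((E w - 1)\<^sup>2 / t + t) / 2 = 1 / (2 * t) * (E w)\<^sup>2 + (1 / (2 * t) + t / 2) - 1 / t * E w"
        using 3 by (simp add: power2_diff field_simps)
      ultimately have "E w * r + 1 / t * E w \<le> r + (1 / (2 * t) * (E w)\<^sup>2 + (1 / (2 * t) + t / 2))"
      proof -
        have "r * (E w - 1) = E w * r - r" by (simp add: right_diff_distrib mult.commute)
        then show ?thesis
          using \<open>r * (E w - 1) \<le> ((E w - 1)\<^sup>2 / t + t) / 2\<close>
            \<open>((E w - 1)\<^sup>2 / t + t) / 2 = 1 / (2 * t) * (E w)\<^sup>2 + (1 / (2 * t) + t / 2) - 1 / t * E w\<close>
          by linarith
      qed
      then show ?thesis
        unfolding r(1) using r(2) E0 3 by (simp add: ennreal_mult[symmetric] ennreal_plus[symmetric] ennreal_leI del: ennreal_plus)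
    qed
    have "ennreal I + ennreal (1 / t) = (\<integral>\<^sup>+w. (ennreal (E w) * f w + ennreal (1 / t) * ennreal (E w)) \<partial>std_gaussian)"
      unfolding IF(1)[symmetric] nn_integral_gaussian_translate[OF f]
      using nn_integral_gaussian_exp[of a] by (simp add: nn_integral_add nn_integral_cmult E_def)
    also have "\<dots> \<le> (\<integral>\<^sup>+w. (f w + (ennreal (1 / (2 * t)) * ennreal ((E w)\<^sup>2) + ennreal (1 / (2 * t) + t / 2))) \<partial>std_gaussian)"
      by (intro nn_integral_mono pt)
    also have "\<dots> = ennreal F + (ennreal (1 / (2 * t)) * ennreal (exp (t\<^sup>2)) + ennreal (1 / (2 * t) + t / 2))"
    proof -
      have "(\<integral>\<^sup>+w. ennreal (1 / (2 * t) + t / 2) \<partial>(std_gaussian :: 'a measure)) = ennreal (1 / (2 * t) + t / 2)"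
        by (simp only: nn_integral_const std_gaussian.emeasure_space_1 mult_1_right)
      then show ?thesis
        unfolding IF(2)[symmetric] E2[symmetric] by (simp add: nn_integral_add nn_integral_cmult)
    qed
    finally have "ennreal (I + 1 / t) \<le> ennreal (F + (1 / (2 * t) * exp (t\<^sup>2) + (1 / (2 * t) + t / 2)))"
      using IF 3 by (simp add: ennreal_mult[symmetric] ennreal_plus[symmetric] del: ennreal_plus)
    then have "I + 1 / t \<le> F + (1 / (2 * t) * exp (t\<^sup>2) + (1 / (2 * t) + t / 2))"
      using IF 3 by (subst (asm) ennreal_le_iff) auto
    \<comment> \<open>For \<open>t \<le> 1\<close> the bound
      \<open>exp (t\<^sup>2) \<le> 1 + 2 * t\<^sup>2\<close> makes the terms in \<open>1 / t\<close>
      cancel and leaves \<open>3 / 2 * t\<close>.\<close>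
    also have "\<dots> \<le> F + (1 / (2 * t) * (1 + 2 * t\<^sup>2) + (1 / (2 * t) + t / 2))"
    proof -
      have t2: "0 \<le> t\<^sup>2" "t\<^sup>2 \<le> 1" using 3 by (auto simp: power_le_one)
      then have "exp (t\<^sup>2) \<le> 1 + t\<^sup>2 + (t\<^sup>2)\<^sup>2" by (intro exp_bound)
      also have "(t\<^sup>2)\<^sup>2 \<le> t\<^sup>2" using t2 unfolding power2_eq_square[of "t\<^sup>2"]
        using mult_left_mono[OF t2(2) t2(1)] by (simp only: mult_1_right)
      finally show ?thesis using 3 by (intro add_left_mono add_right_mono mult_left_mono) auto
    qed
    also have "\<dots> = F + 1 / t + 3 / 2 * t" using 3 by (simp add: field_simps power2_eq_square)
    finally have "I \<le> F + 3 / 2 * t" by simp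
    then have "ennreal I \<le> ennreal (F + 3 / 2 * t)" by (rule ennreal_leI)
    then show ?thesis unfolding IF using IF 3 by (simp add: t_def)
  qed
qed

context obabo
begin

definition drift :: "'a \<times> 'a \<Rightarrow> 'a" where
  "drift z = fst z + (\<delta> * \<eta>) *\<^sub>R snd z - (\<delta>\<^sup>2 / 2) *\<^sub>R g (fst z)"

text \<open>Given the new position \<open>X\<close>, the new velocity is a function of \<open>X\<close> alone plus a Gaussian
  variable whose mean depends on the old position only; so both noises can be shifted separately.\<close>

lemma stp_eq:
  defines "\<Psi> \<equiv> \<lambda>X. (\<eta> / \<delta>) *\<^sub>R X - (\<delta> * \<eta> / 2) *\<^sub>R g X"
  shows "stp z w w' = (let X = drift z + (\<delta> * \<sigma>) *\<^sub>R w
    in (X, (- (\<eta> / \<delta>) *\<^sub>R fst z + \<sigma> *\<^sub>R w') + \<Psi> X))"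
proof -
  define X where "X = drift z + (\<delta> * \<sigma>) *\<^sub>R w"
  have X: "fst (stp z w w') = X" by (simp add: fst_stp X_def drift_def algebra_simps)
  have "(\<eta> / \<delta>) *\<^sub>R X = (\<eta> / \<delta>) *\<^sub>R fst z + \<eta>\<^sup>2 *\<^sub>R snd z - (\<delta> * \<eta> / 2) *\<^sub>R g (fst z) + (\<eta> * \<sigma>) *\<^sub>R w"
    unfolding X_def drift_def using delta_pos
    by (simp add: scaleR_add_right scaleR_diff_right power2_eq_square mult_ac)
  then have "snd (stp z w w') = (- (\<eta> / \<delta>) *\<^sub>R fst z + \<sigma> *\<^sub>R w') + \<Psi> X"
    unfolding snd_stp X \<Psi>_def by (simp add: scaleR_add_right)
  then show ?thesis using X by (simp add: Let_def X_def[symmetric] prod_eq_iff)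
qed

text \<open>8/5 is the 3/2 of \<open>gaussian_shift\<close> times 16/15, a rational bound for the
  \<open>sqrt 10 / 3\<close> that compares \<open>x + v / 3\<close> with the Euclidean norm; the
  last factor passes to \<open>nb\<close>.\<close>

definition "smooth_const = 8 / 5 * max (2 + 3 * \<delta>\<^sup>2 * L / 2) (3 * \<delta>) / (\<delta> * \<sigma>) * (sqrt 2 * max 1 \<omega>)"

lemma smooth_const_nonneg: "0 \<le> smooth_const"
  using delta_pos sigma_pos by (simp add: smooth_const_def le_max_iff_disj)

lemma P_le_1: "(\<And>z. f z \<le> 1) \<Longrightarrow> P f z \<le> 1"
proof -
  assume f: "\<And>z. f z \<le> 1"
  have "P f z \<le> (\<integral>\<^sup>+w. \<integral>\<^sup>+w'. 1 \<partial>(std_gaussian :: 'a measure) \<partial>(std_gaussian :: 'a measure))"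
    unfolding P_def using f by (intro nn_integral_mono) auto
  also have "\<dots> = 1" by (simp only: nn_integral_const std_gaussian.emeasure_space_1 mult_1_right)
  finally show ?thesis .
qed

text \<open>By \<open>stp_eq\<close>, changing the starting point amounts to translating the
  position noise by \<open>sx\<close> and the velocity noise by \<open>sv\<close>. The inner noise
  is shifted first, with the position held fixed, then the outer one.\<close>

lemma P_smoothing:
  assumes f[measurable]: "f \<in> borel_measurable borel" and f1: "\<And>z. f z \<le> 1"
  shows "P f z \<le> P f z' + ennreal (smooth_const * nb (z - z'))"
proof -
  define \<Psi> where "\<Psi> X = (\<eta> / \<delta>) *\<^sub>R X - (\<delta> * \<eta> / 2) *\<^sub>R g X" for X
  have [measurable]: "\<Psi> \<in> borel_measurable borel" unfolding \<Psi>_def[abs_def] by measurable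
  define h where "h X W = f (X, W + \<Psi> X)" for X W
  have [measurable]: "(\<lambda>x. h (u x) (v x)) \<in> borel_measurable M"
    if [measurable]: "u \<in> borel_measurable M" "v \<in> borel_measurable M" for u v and M :: "'z measure"
    unfolding h_def by measurable
  have h1: "h X W \<le> 1" for X W using f1 by (simp add: h_def)
  define b where "b z = - (\<eta> / \<delta>) *\<^sub>R fst z" for z :: "'a \<times> 'a"
  have Pf: "P f z = (\<integral>\<^sup>+w. \<integral>\<^sup>+w'. h (drift z + (\<delta> * \<sigma>) *\<^sub>R w) (b z + \<sigma> *\<^sub>R w') \<partial>std_gaussian \<partial>std_gaussian)" for z
    unfolding P_def stp_eq Let_def h_def b_def \<Psi>_def ..
  define sx sv where "sx = (1 / (\<delta> * \<sigma>)) *\<^sub>R (drift z - drift z')" and "sv = (1 / \<sigma>) *\<^sub>R (b z - b z')"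
  have ds: "drift z + (\<delta> * \<sigma>) *\<^sub>R w = drift z' + (\<delta> * \<sigma>) *\<^sub>R (w + sx)" for w
    using delta_pos sigma_pos by (simp add: sx_def scaleR_add_right)
  have bs: "b z + \<sigma> *\<^sub>R w = b z' + \<sigma> *\<^sub>R (w + sv)" for w
    using sigma_pos by (simp add: sv_def scaleR_add_right)
  have "P f z = (\<integral>\<^sup>+w. \<integral>\<^sup>+w'. h (drift z' + (\<delta> * \<sigma>) *\<^sub>R (w + sx)) (b z' + \<sigma> *\<^sub>R (w' + sv)) \<partial>std_gaussian \<partial>std_gaussian)"
    unfolding Pf ds bs ..
  also have "\<dots> \<le> (\<integral>\<^sup>+w. ((\<integral>\<^sup>+w'. h (drift z' + (\<delta> * \<sigma>) *\<^sub>R (w + sx)) (b z' + \<sigma> *\<^sub>R w') \<partial>std_gaussian) + ennreal (3 / 2 * norm sv)) \<partial>std_gaussian)"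
    using h1 by (intro nn_integral_mono gaussian_shift[where f = "\<lambda>w'. h (drift z' + (\<delta> * \<sigma>) *\<^sub>R (_ + sx)) (b z' + \<sigma> *\<^sub>R w')"]) auto
  also have "\<dots> = (\<integral>\<^sup>+w. \<integral>\<^sup>+w'. h (drift z' + (\<delta> * \<sigma>) *\<^sub>R (w + sx)) (b z' + \<sigma> *\<^sub>R w') \<partial>std_gaussian \<partial>std_gaussian) + ennreal (3 / 2 * norm sv)"
    by (subst nn_integral_add) (measurable, simp only: nn_integral_const std_gaussian.emeasure_space_1 mult_1_right)
  also have "(\<integral>\<^sup>+w. \<integral>\<^sup>+w'. h (drift z' + (\<delta> * \<sigma>) *\<^sub>R (w + sx)) (b z' + \<sigma> *\<^sub>R w') \<partial>std_gaussian \<partial>std_gaussian)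
      \<le> P f z' + ennreal (3 / 2 * norm sx)"
  proof -
    have "(\<integral>\<^sup>+w'. h (drift z' + (\<delta> * \<sigma>) *\<^sub>R w) (b z' + \<sigma> *\<^sub>R w') \<partial>std_gaussian) \<le> 1" for w
    proof -
      have "(\<integral>\<^sup>+w'. h (drift z' + (\<delta> * \<sigma>) *\<^sub>R w) (b z' + \<sigma> *\<^sub>R w') \<partial>std_gaussian) \<le> (\<integral>\<^sup>+w'. 1 \<partial>(std_gaussian :: 'a measure))"
        using h1 by (intro nn_integral_mono) auto
      also have "\<dots> = 1" by (simp only: nn_integral_const std_gaussian.emeasure_space_1 mult_1_right)
      finally show ?thesis .
    qed
    then show ?thesis
      unfolding Pf by (intro gaussian_shift[where f = "\<lambda>w. \<integral>\<^sup>+w'. h (drift z' + (\<delta> * \<sigma>) *\<^sub>R w) (b z' + \<sigma> *\<^sub>R w') \<partial>std_gaussian"]) measurable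
  qed
  finally have "P f z \<le> P f z' + ennreal (3 / 2 * norm sx) + ennreal (3 / 2 * norm sv)"
    by (simp add: add_right_mono)
  also have "\<dots> = P f z' + ennreal (3 / 2 * (norm sx + norm sv))"
    by (simp add: add.assoc distrib_left)
  also have "\<dots> \<le> P f z' + ennreal (smooth_const * nb (z - z'))"
  proof (intro add_left_mono ennreal_leI)
    define x v where "x = norm (fst z - fst z')" and "v = norm (snd z - snd z')"
    define Mx where "Mx = max (2 + 3 * \<delta>\<^sup>2 * L / 2) (3 * \<delta>)"
    have xv: "0 \<le> x" "0 \<le> v" by (auto simp: x_def v_def)
    have Mx: "2 + 3 * \<delta>\<^sup>2 * L / 2 \<le> Mx" "3 * \<delta> \<le> Mx" "0 \<le> Mx" using delta_pos by (auto simp: Mx_def le_max_iff_disj)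
    have "norm (drift z - drift z') \<le> x + \<delta> * v + \<delta>\<^sup>2 / 2 * (L * x)"
    proof -
      have "drift z - drift z' = (fst z - fst z') + (\<delta> * \<eta>) *\<^sub>R (snd z - snd z') - (\<delta>\<^sup>2 / 2) *\<^sub>R (g (fst z) - g (fst z'))"
        by (simp add: drift_def algebra_simps)
      then have "norm (drift z - drift z') \<le> norm (fst z - fst z') + norm ((\<delta> * \<eta>) *\<^sub>R (snd z - snd z')) + norm ((\<delta>\<^sup>2 / 2) *\<^sub>R (g (fst z) - g (fst z')))"
        by (simp only:) (intro order_trans[OF norm_triangle_ineq4] add_right_mono norm_triangle_ineq)
      also have "norm ((\<delta> * \<eta>) *\<^sub>R (snd z - snd z')) \<le> \<delta> * v"
        using delta_pos eta_pos eta_lt_1 by (simp add: v_def mult_right_mono mult_left_le)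
      also have "norm ((\<delta>\<^sup>2 / 2) *\<^sub>R (g (fst z) - g (fst z'))) \<le> \<delta>\<^sup>2 / 2 * (L * x)"
        using lip by (simp add: x_def mult_left_mono)
      finally show ?thesis by (simp add: x_def)
    qed
    then have 1: "norm sx \<le> (x + \<delta> * v + \<delta>\<^sup>2 / 2 * (L * x)) / (\<delta> * \<sigma>)"
      using delta_pos sigma_pos by (simp add: sx_def divide_right_mono)
    have 2: "norm sv \<le> x / (\<delta> * \<sigma>)"
    proof -
      have "b z - b z' = - ((\<eta> / \<delta>) *\<^sub>R (fst z - fst z'))" by (simp add: b_def algebra_simps)
      then have "norm (b z - b z') = \<eta> / \<delta> * x" using eta_pos delta_pos by (simp add: x_def)
      also have "\<dots> \<le> 1 / \<delta> * x" using eta_lt_1 delta_pos xv by (intro mult_right_mono divide_right_mono) auto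
      finally have "norm (b z - b z') / \<sigma> \<le> (1 / \<delta> * x) / \<sigma>" using sigma_pos by (intro divide_right_mono) auto
      then show ?thesis using sigma_pos by (simp add: sv_def)
    qed
    have "norm sx + norm sv \<le> ((2 + \<delta>\<^sup>2 * L / 2) * x + \<delta> * v) / (\<delta> * \<sigma>)"
      using 1 2 by (simp add: add_divide_distrib algebra_simps)
    also have "\<dots> \<le> (Mx * (x + v / 3)) / (\<delta> * \<sigma>)"
    proof (rule divide_right_mono)
      have "(2 + \<delta>\<^sup>2 * L / 2) * x \<le> Mx * x"
        using Mx(1) xv L_pos by (intro mult_right_mono) (auto intro: order_trans[rotated])
      moreover have "\<delta> * v \<le> Mx / 3 * v" using Mx(2) xv by (intro mult_right_mono) auto
      ultimately show "(2 + \<delta>\<^sup>2 * L / 2) * x + \<delta> * v \<le> Mx * (x + v / 3)" by (simp add: distrib_left)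
    qed (use delta_pos sigma_pos in simp)
    also have "\<dots> \<le> (Mx * (16 / 15 * norm (z - z'))) / (\<delta> * \<sigma>)"
    proof (intro divide_right_mono mult_left_mono)
      have n2: "(norm (z - z'))\<^sup>2 = x\<^sup>2 + v\<^sup>2" by (simp add: norm_prod_def x_def v_def)
      have "0 \<le> (x - 3 * v)\<^sup>2" by simp
      then have "2 * (x * v) \<le> (x\<^sup>2 + 9 * v\<^sup>2) / 3" by (simp add: power2_eq_square algebra_simps)
      then have "(x + v / 3)\<^sup>2 \<le> 10 / 9 * (x\<^sup>2 + v\<^sup>2)" by (simp add: power2_eq_square algebra_simps)
      also have "\<dots> \<le> (16 / 15)\<^sup>2 * (x\<^sup>2 + v\<^sup>2)"
        by (intro mult_right_mono) (auto simp: power2_eq_square)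
      also have "\<dots> = (16 / 15 * norm (z - z'))\<^sup>2" unfolding power_mult_distrib n2 ..
      finally show "x + v / 3 \<le> 16 / 15 * norm (z - z')" by (rule power2_le_imp_le) simp
    qed (use Mx delta_pos sigma_pos in auto)
    also have "\<dots> \<le> (Mx * (16 / 15 * (sqrt 2 * max 1 \<omega> * nb (z - z')))) / (\<delta> * \<sigma>)"
      using norm_le_nb[of "z - z'"] Mx delta_pos sigma_pos by (intro divide_right_mono mult_left_mono) auto
    also have "\<dots> = 2 / 3 * (smooth_const * nb (z - z'))"
      unfolding smooth_const_def Mx_def[symmetric] by simp
    finally show "3 / 2 * (norm sx + norm sv) \<le> smooth_const * nb (z - z')" by simp
  qed
  finally show ?thesis .
qed

text \<open>Synchronous noise: contraction of the states becomes contraction of Lipschitz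
  constants.\<close>

lemma P_lipschitz:
  assumes [measurable]: "f \<in> borel_measurable borel" and f: "\<And>z z'. f z \<le> f z' + ennreal (c * nb (z - z'))" and c: "0 \<le> c"
  shows "P f z \<le> P f z' + ennreal (\<rho> * c * nb (z - z'))"
proof -
  have "P f z \<le> (\<integral>\<^sup>+w. \<integral>\<^sup>+w'. (f (stp z' w w') + ennreal (\<rho> * c * nb (z - z'))) \<partial>std_gaussian \<partial>std_gaussian)"
    unfolding P_def
  proof (intro nn_integral_mono)
    fix w w'
    have "f (stp z w w') \<le> f (stp z' w w') + ennreal (c * nb (stp z w w' - stp z' w w'))" by (rule f)
    also have "\<dots> \<le> f (stp z' w w') + ennreal (c * (\<rho> * nb (z - z')))"
      using c stp_contraction by (intro add_left_mono ennreal_leI mult_left_mono)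
    finally show "f (stp z w w') \<le> f (stp z' w w') + ennreal (\<rho> * c * nb (z - z'))" by (simp add: mult_ac)
  qed
  also have "\<dots> = P f z' + ennreal (\<rho> * c * nb (z - z'))"
  proof -
    define e where "e = ennreal (\<rho> * c * nb (z - z'))"
    have i: "(\<integral>\<^sup>+w'. (f (stp z' w w') + e) \<partial>std_gaussian) = (\<integral>\<^sup>+w'. f (stp z' w w') \<partial>std_gaussian) + e" for w
      by (subst nn_integral_add) (measurable, simp only: nn_integral_const std_gaussian.emeasure_space_1 mult_1_right)
    show ?thesis
      unfolding e_def[symmetric] i P_def
      by (subst nn_integral_add) (measurable, simp only: nn_integral_const std_gaussian.emeasure_space_1 mult_1_right)
  qed
  finally show ?thesis .
qed

end

section \<open>The total variation bound\<close>

context obabo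
begin

section \<open>Mean energy error of one step\<close>

lemma delta_L_sq_le: "\<delta>\<^sup>2 * L\<^sup>2 \<le> m / 60000"
proof -
  have "\<delta>\<^sup>2 * L\<^sup>2 \<le> \<delta>\<^sup>2 * (\<gamma>\<^sup>2 / 4)\<^sup>2"
    using L_le_gamma L_pos by (intro mult_left_mono power_mono) auto
  also have "\<dots> = (\<delta> * \<gamma>)\<^sup>2 * (\<gamma>\<^sup>2 / 16)" by (simp add: power2_eq_square)
  also have "\<dots> \<le> \<delta> * m / (33 * \<gamma>) * (\<gamma>\<^sup>2 / 16)" by (intro mult_right_mono h_sq_le) auto
  also have "\<dots> = (\<delta> * \<gamma>) * (m / 528)" using gamma_pos by (simp add: power2_eq_square)
  also have "\<dots> \<le> 1 / 132 * (m / 528)" using h_le m_pos by (intro mult_right_mono) auto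
  also have "\<dots> \<le> m / 60000" using m_pos by simp
  finally show ?thesis .
qed

text \<open>The Young weights burden the force term on purpose: it carries
  \<open>\<delta>\<^sup>2 * L\<^sup>2\<close>, negligible against \<open>m\<close>, whereas the
  coefficient of the velocity has to stay below 2.\<close>

lemma energy_error_pointwise:
  "\<bar>energy (verlet \<delta> z) - energy z\<bar> \<le> L * \<delta>\<^sup>2 / 8 * (8 / 5 * (norm (snd z))\<^sup>2 + 6 * \<delta>\<^sup>2 * L\<^sup>2 * (norm (fst z - xs))\<^sup>2)"
proof -
  define p where "p = snd z - (\<delta> / 2) *\<^sub>R g (fst z)"
  define q G V where "q = norm p" and "G = \<delta> * norm (g (fst z))" and "V = norm (snd z)"
  have pos: "0 \<le> q" "0 \<le> G" "0 \<le> V" using delta_pos by (auto simp: q_def G_def V_def)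
  have q: "q \<le> V + G / 2"
    using norm_triangle_ineq4[of "snd z" "(\<delta> / 2) *\<^sub>R g (fst z)"] delta_pos
    by (simp add: q_def p_def V_def G_def)
  have q2: "q\<^sup>2 \<le> 5 / 4 * V\<^sup>2 + 5 / 4 * G\<^sup>2"
  proof -
    have "q\<^sup>2 \<le> (V + G / 2)\<^sup>2" using q pos by (intro power_mono) auto
    also have "\<dots> = 5 / 4 * V\<^sup>2 + 5 / 4 * G\<^sup>2 - (V / 2 - G)\<^sup>2" by (simp add: power2_eq_square algebra_simps)
    finally show ?thesis using zero_le_power2[of "V / 2 - G"] by linarith
  qed
  have qG: "2 * (q * G) \<le> 1 / 4 * q\<^sup>2 + 4 * G\<^sup>2"
  proof -
    have "1 / 4 * q\<^sup>2 + 4 * G\<^sup>2 - 2 * (q * G) = (q / 2 - 2 * G)\<^sup>2" by (simp add: power2_eq_square algebra_simps)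
    then show ?thesis using zero_le_power2[of "q / 2 - 2 * G"] by linarith
  qed
  have "(1 + L * \<delta>\<^sup>2) * q\<^sup>2 \<le> 101 / 100 * q\<^sup>2"
    using L_h_sq_le[of \<delta>] delta_pos by (intro mult_right_mono) auto
  then have "(1 + L * \<delta>\<^sup>2) * q\<^sup>2 + 2 * (q * G) \<le> 63 / 50 * q\<^sup>2 + 4 * G\<^sup>2" using qG by linarith
  also have "\<dots> \<le> 63 / 40 * V\<^sup>2 + 6 * G\<^sup>2" using q2 zero_le_power2[of G] by linarith
  also have "\<dots> \<le> 8 / 5 * V\<^sup>2 + 6 * G\<^sup>2" using zero_le_power2[of V] by linarith
  also have "\<dots> \<le> 8 / 5 * V\<^sup>2 + 6 * (\<delta> * (L * norm (fst z - xs)))\<^sup>2"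
    using norm_g_le[of "fst z"] delta_pos pos unfolding G_def by (intro add_left_mono mult_left_mono power_mono) auto
  finally have "(1 + L * \<delta>\<^sup>2) * q\<^sup>2 + 2 * (q * G) \<le> 8 / 5 * V\<^sup>2 + 6 * \<delta>\<^sup>2 * L\<^sup>2 * (norm (fst z - xs))\<^sup>2"
    by (simp add: power_mult_distrib)
  then have "L * \<delta>\<^sup>2 / 8 * ((1 + L * \<delta>\<^sup>2) * q\<^sup>2 + 2 * (q * G)) \<le> L * \<delta>\<^sup>2 / 8 * (8 / 5 * V\<^sup>2 + 6 * \<delta>\<^sup>2 * L\<^sup>2 * (norm (fst z - xs))\<^sup>2)"
    using L_pos by (intro mult_left_mono) auto
  moreover have "\<bar>energy (verlet \<delta> z) - energy z\<bar> \<le> L * \<delta>\<^sup>2 / 8 * ((1 + L * \<delta>\<^sup>2) * q\<^sup>2 + 2 * (q * G))"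
    using energy_verlet_error[of \<delta> z] delta_pos by (simp add: p_def[symmetric] q_def G_def mult_ac)
  ultimately show ?thesis unfolding V_def by linarith
qed

lemma gibbs_second_moments:
  "(\<integral>\<^sup>+z. ennreal ((norm (snd z))\<^sup>2) \<partial>gibbs U) \<le> ennreal (real DIM('a))"
  "(\<integral>\<^sup>+z. ennreal ((norm (fst z - xs))\<^sup>2) \<partial>gibbs U) \<le> ennreal (real DIM('a) / m)"
  using gibbs_moment_snd[of 2] gibbs_moment_fst[of 2, OF _ g_xs] m_pos by simp_all

lemma energy_error_mean:
  "(\<integral>\<^sup>+z. ennreal \<bar>energy (verlet \<delta> z) - energy z\<bar> \<partial>gibbs U) \<le> ennreal (L * \<delta>\<^sup>2 * real DIM('a) / 4)"
proof -
  define a b where "a = L * \<delta>\<^sup>2 / 8 * (8 / 5)" and "b = L * \<delta>\<^sup>2 / 8 * (6 * \<delta>\<^sup>2 * L\<^sup>2)"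
  have ab: "0 \<le> a" "0 \<le> b" using L_pos by (auto simp: a_def b_def)
  have "(\<integral>\<^sup>+z. ennreal \<bar>energy (verlet \<delta> z) - energy z\<bar> \<partial>gibbs U)
      \<le> (\<integral>\<^sup>+z. (ennreal a * ennreal ((norm (snd z))\<^sup>2) + ennreal b * ennreal ((norm (fst z - xs))\<^sup>2)) \<partial>gibbs U)"
  proof (intro nn_integral_mono)
    fix z
    have "\<bar>energy (verlet \<delta> z) - energy z\<bar> \<le> a * (norm (snd z))\<^sup>2 + b * (norm (fst z - xs))\<^sup>2"
      using energy_error_pointwise[of z] unfolding a_def b_def distrib_left mult.assoc .
    then show "ennreal \<bar>energy (verlet \<delta> z) - energy z\<bar>
        \<le> ennreal a * ennreal ((norm (snd z))\<^sup>2) + ennreal b * ennreal ((norm (fst z - xs))\<^sup>2)"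
      using ab by (simp add: ennreal_mult[symmetric] ennreal_plus[symmetric] ennreal_leI del: ennreal_plus)
  qed
  also have "\<dots> = ennreal a * (\<integral>\<^sup>+z. ennreal ((norm (snd z))\<^sup>2) \<partial>gibbs U) + ennreal b * (\<integral>\<^sup>+z. ennreal ((norm (fst z - xs))\<^sup>2) \<partial>gibbs U)"
    by (simp add: nn_integral_add nn_integral_cmult)
  also have "\<dots> \<le> ennreal a * ennreal (real DIM('a)) + ennreal b * ennreal (real DIM('a) / m)"
    by (intro add_mono mult_left_mono gibbs_second_moments) auto
  also have "\<dots> = ennreal (a * real DIM('a) + b * (real DIM('a) / m))"
    using ab m_pos by (simp add: ennreal_mult[symmetric] ennreal_plus[symmetric] del: ennreal_plus)
  also have "\<dots> \<le> ennreal (L * \<delta>\<^sup>2 * real DIM('a) / 4)"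
  proof (rule ennreal_leI)
    \<comment> \<open>The sum of coefficients may not exceed 2; the resulting
      \<open>L * \<delta>\<^sup>2 / 4\<close> is what later lets \<open>L \<le> K4\<close> close the
      bound without slack.\<close>
    have "\<delta>\<^sup>2 * L\<^sup>2 / m \<le> 1 / 60000" using delta_L_sq_le m_pos by (simp add: field_simps)
    moreover have "8 / 5 + 6 * q \<le> 2" if "q \<le> 1 / 60000" for q :: real using that by simp
    ultimately have "8 / 5 + 6 * (\<delta>\<^sup>2 * L\<^sup>2 / m) \<le> 2" by blast
    then have "L * \<delta>\<^sup>2 * real DIM('a) / 8 * (8 / 5 + 6 * (\<delta>\<^sup>2 * L\<^sup>2 / m)) \<le> L * \<delta>\<^sup>2 * real DIM('a) / 8 * 2"
      using L_pos by (intro mult_left_mono) simp_all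
    moreover have "a * real DIM('a) + b * (real DIM('a) / m) = L * \<delta>\<^sup>2 * real DIM('a) / 8 * (8 / 5 + 6 * (\<delta>\<^sup>2 * L\<^sup>2 / m))"
      by (simp add: a_def b_def distrib_left mult_ac)
    moreover have "L * \<delta>\<^sup>2 * real DIM('a) / 8 * 2 = L * \<delta>\<^sup>2 * real DIM('a) / 4" by simp
    ultimately show "a * real DIM('a) + b * (real DIM('a) / m) \<le> L * \<delta>\<^sup>2 * real DIM('a) / 4" by (simp only:)
  qed
  finally show ?thesis .
qed

text \<open>\<open>verlet\<close> preserves Lebesgue measure, so only the energy error changes the Gibbs density.\<close>

lemma nn_integral_gibbs_verlet_le:
  assumes [measurable]: "F \<in> borel_measurable borel" and F1: "\<And>z. F z \<le> 1"
  shows "(\<integral>\<^sup>+z. F (verlet \<delta> z) \<partial>gibbs U) \<le> (\<integral>\<^sup>+z. F z \<partial>gibbs U) + ennreal (L * \<delta>\<^sup>2 * real DIM('a) / 4)"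
proof -
  define y where "y z = \<bar>energy (verlet \<delta> z) - energy z\<bar>" for z
  have [measurable]: "y \<in> borel_measurable borel" unfolding y_def[abs_def] by measurable
  have "(\<integral>\<^sup>+z. F (verlet \<delta> z) \<partial>gibbs U) = (\<integral>\<^sup>+z. ennreal (gibbs_dens z) * F (verlet \<delta> z) \<partial>lborel)"
    unfolding gibbs_density by (intro nn_integral_density) auto
  also have "\<dots> \<le> (\<integral>\<^sup>+z. (ennreal (gibbs_dens (verlet \<delta> z)) * F (verlet \<delta> z) + ennreal (gibbs_dens z) * ennreal (y z)) \<partial>lborel)"
  proof (intro nn_integral_mono)
    fix z
    have "exp (- energy z) \<le> exp (- energy (verlet \<delta> z)) + exp (- energy z) * y z"
    proof -
      define D where "D = energy (verlet \<delta> z) - energy z"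
      \<comment> \<open>The linear form of the density comparison makes the defect the Gibbs mean of
        the energy error.\<close>
      have "1 \<le> exp (- D) + \<bar>D\<bar>" using exp_ge_add_one_self[of "- D"] by linarith
      then have "exp (- energy z) * 1 \<le> exp (- energy z) * (exp (- D) + \<bar>D\<bar>)" by (intro mult_left_mono) auto
      then show ?thesis by (simp add: distrib_left mult_exp_exp D_def y_def)
    qed
    then have "gibbs_dens z \<le> gibbs_dens (verlet \<delta> z) + gibbs_dens z * y z"
      unfolding gibbs_dens_def using Zu_pos gauss_const_pos[where 'a='a]
      by (simp only: mult.assoc distrib_left[symmetric]) (intro mult_left_mono, auto)
    then have "ennreal (gibbs_dens z) \<le> ennreal (gibbs_dens (verlet \<delta> z)) + ennreal (gibbs_dens z) * ennreal (y z)"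
      using gibbs_dens_nonneg by (simp add: y_def ennreal_mult[symmetric] ennreal_plus[symmetric] ennreal_leI del: ennreal_plus)
    then have "ennreal (gibbs_dens z) * F (verlet \<delta> z)
        \<le> (ennreal (gibbs_dens (verlet \<delta> z)) + ennreal (gibbs_dens z) * ennreal (y z)) * F (verlet \<delta> z)"
      by (rule mult_right_mono) simp
    also have "\<dots> \<le> ennreal (gibbs_dens (verlet \<delta> z)) * F (verlet \<delta> z) + ennreal (gibbs_dens z) * ennreal (y z) * 1"
      unfolding distrib_right using F1 by (intro add_left_mono mult_left_mono) auto
    finally show "ennreal (gibbs_dens z) * F (verlet \<delta> z)
        \<le> ennreal (gibbs_dens (verlet \<delta> z)) * F (verlet \<delta> z) + ennreal (gibbs_dens z) * ennreal (y z)" by simp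
  qed
  also have "\<dots> = (\<integral>\<^sup>+z. ennreal (gibbs_dens (verlet \<delta> z)) * F (verlet \<delta> z) \<partial>lborel) + (\<integral>\<^sup>+z. ennreal (gibbs_dens z) * ennreal (y z) \<partial>lborel)"
    by (intro nn_integral_add) auto
  also have "(\<integral>\<^sup>+z. ennreal (gibbs_dens (verlet \<delta> z)) * F (verlet \<delta> z) \<partial>lborel) = (\<integral>\<^sup>+z. ennreal (gibbs_dens z) * F z \<partial>lborel)"
    by (rule nn_integral_verlet[where F = "\<lambda>z. ennreal (gibbs_dens z) * F z"]) measurable
  also have "\<dots> = (\<integral>\<^sup>+z. F z \<partial>gibbs U)"
    unfolding gibbs_density by (intro nn_integral_density[symmetric]) auto
  also have "(\<integral>\<^sup>+z. ennreal (gibbs_dens z) * ennreal (y z) \<partial>lborel) = (\<integral>\<^sup>+z. ennreal (y z) \<partial>gibbs U)"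
    unfolding gibbs_density by (intro nn_integral_density[symmetric]) auto
  also have "(\<integral>\<^sup>+z. F z \<partial>gibbs U) + \<dots> \<le> (\<integral>\<^sup>+z. F z \<partial>gibbs U) + ennreal (L * \<delta>\<^sup>2 * real DIM('a) / 4)"
    unfolding y_def by (intro add_left_mono energy_error_mean)
  finally show ?thesis .
qed

text \<open>Both refreshments preserve the Gibbs measure, so only the Verlet factor contributes a
  defect.\<close>

lemma nn_integral_gibbs_P_le:
  assumes [measurable]: "f \<in> borel_measurable borel" and f1: "\<And>z. f z \<le> 1"
  shows "(\<integral>\<^sup>+z. P f z \<partial>gibbs U) \<le> (\<integral>\<^sup>+z. f z \<partial>gibbs U) + ennreal (L * \<delta>\<^sup>2 * real DIM('a) / 4)"
proof -
  define H where "H y = (\<integral>\<^sup>+w'. f (ou y w') \<partial>std_gaussian)" for y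
  have [measurable]: "H \<in> borel_measurable borel" unfolding H_def[abs_def] by measurable
  have H1: "H y \<le> 1" for y
  proof -
    have "H y \<le> (\<integral>\<^sup>+w'. 1 \<partial>(std_gaussian :: 'a measure))" unfolding H_def using f1 by (intro nn_integral_mono) auto
    also have "\<dots> = 1" by (simp only: nn_integral_const std_gaussian.emeasure_space_1 mult_1_right)
    finally show ?thesis .
  qed
  have "(\<integral>\<^sup>+z. P f z \<partial>gibbs U) = (\<integral>\<^sup>+z. \<integral>\<^sup>+w. H (verlet \<delta> (ou z w)) \<partial>std_gaussian \<partial>gibbs U)"
    by (simp add: P_def stp_def H_def)
  also have "\<dots> = (\<integral>\<^sup>+z. H (verlet \<delta> z) \<partial>gibbs U)"
    by (rule nn_integral_gibbs_ou[of "\<lambda>y. H (verlet \<delta> y)"]) measurable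
  also have "\<dots> \<le> (\<integral>\<^sup>+z. H z \<partial>gibbs U) + ennreal (L * \<delta>\<^sup>2 * real DIM('a) / 4)"
    by (rule nn_integral_gibbs_verlet_le) (simp_all add: H1)
  also have "(\<integral>\<^sup>+z. H z \<partial>gibbs U) = (\<integral>\<^sup>+z. f z \<partial>gibbs U)"
    unfolding H_def by (rule nn_integral_gibbs_ou) measurable
  finally show ?thesis .
qed

section \<open>Iterates of the transition operator\<close>

lemma measurable_P_pow: "f \<in> borel_measurable borel \<Longrightarrow> (P ^^ n) f \<in> borel_measurable borel"
  by (induction n) auto

lemma P_pow_le_1: "(\<And>z. f z \<le> 1) \<Longrightarrow> (P ^^ n) f z \<le> 1"
  by (induction n arbitrary: z) (auto intro: P_le_1)

lemma nn_integral_invariant_pow: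
  assumes "invariant_prob (obabo_kernel \<delta> \<gamma> U) \<mu>" "f \<in> borel_measurable borel"
  shows "(\<integral>\<^sup>+z. (P ^^ n) f z \<partial>\<mu>) = (\<integral>\<^sup>+z. f z \<partial>\<mu>)"
  by (induction n) (auto simp: nn_integral_invariant[OF assms(1) measurable_P_pow[OF assms(2)], symmetric])

lemma nn_integral_gibbs_P_pow_le:
  assumes "f \<in> borel_measurable borel" and "\<And>z. f z \<le> 1"
  shows "(\<integral>\<^sup>+z. (P ^^ n) f z \<partial>gibbs U) \<le> (\<integral>\<^sup>+z. f z \<partial>gibbs U) + ennreal (real n * (L * \<delta>\<^sup>2 * real DIM('a) / 4))"
proof (induction n)
  case (Suc n)
  define e where "e = L * \<delta>\<^sup>2 * real DIM('a) / 4"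
  have e: "0 \<le> e" using L_pos by (simp add: e_def)
  have "(\<integral>\<^sup>+z. (P ^^ Suc n) f z \<partial>gibbs U) \<le> (\<integral>\<^sup>+z. (P ^^ n) f z \<partial>gibbs U) + ennreal e"
    unfolding e_def using nn_integral_gibbs_P_le[OF measurable_P_pow P_pow_le_1, OF assms] by simp
  also have "\<dots> \<le> ((\<integral>\<^sup>+z. f z \<partial>gibbs U) + ennreal (real n * e)) + ennreal e"
    using Suc unfolding e_def by (rule add_right_mono)
  also have "\<dots> = (\<integral>\<^sup>+z. f z \<partial>gibbs U) + ennreal (real (Suc n) * e)"
    using e by (simp add: add.assoc ennreal_plus[symmetric] distrib_right add.commute del: ennreal_plus)
  finally show ?case unfolding e_def .
qed simp

text \<open>The innermost application of \<open>P\<close>, that is the last step of the chain,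
  regularises; the other \<open>n\<close> steps contract. Hence \<open>Suc n\<close> steps but only
  the \<open>n\<close>-th power of \<rho>.\<close>

lemma P_pow_lipschitz:
  assumes f: "f \<in> borel_measurable borel" and f1: "\<And>z. f z \<le> 1"
  shows "(P ^^ Suc n) f z \<le> (P ^^ Suc n) f z' + ennreal (\<rho> ^ n * smooth_const * nb (z - z'))"
proof (induction n arbitrary: z z')
  case 0
  then show ?case using P_smoothing[OF f f1] by simp
next
  case (Suc n)
  have "P ((P ^^ Suc n) f) z \<le> P ((P ^^ Suc n) f) z' + ennreal (\<rho> * (\<rho> ^ n * smooth_const) * nb (z - z'))"
    using rho_pos smooth_const_nonneg by (intro P_lipschitz measurable_P_pow f Suc.IH) auto
  then show ?case by (simp add: mult.assoc)
qed

text \<open>Invariance replaces the indicator of \<open>A\<close> by its image under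
  \<open>Suc n\<close> steps, now Lipschitz. A cheap coupling carries its integral from \<mu> to the
  Gibbs measure, and the energy defects of the steps lead back to \<open>A\<close>.\<close>

lemma invariant_measure_le:
  assumes inv: "invariant_prob (obabo_kernel \<delta> \<gamma> U) \<mu>" and A: "A \<in> sets borel"
  shows "measure \<mu> A \<le> measure (gibbs U) A
    + (real (Suc n) * (L * \<delta>\<^sup>2 * real DIM('a) / 4) + \<rho> ^ n * smooth_const * (5 / 4 * err_p 1))"
proof -
  interpret \<mu>: prob_space \<mu> using inv by (simp add: invariant_prob_def)
  interpret G: prob_space "gibbs U" by (rule prob_space_gibbs)
  have sets_\<mu>: "sets \<mu> = sets borel" using inv by (simp add: invariant_prob_def)
  define f :: "'a \<times> 'a \<Rightarrow> ennreal" where "f = indicator A"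
  have f: "f \<in> borel_measurable borel" "\<And>z. f z \<le> 1" using A by (auto simp: f_def indicator_def)
  define h where "h = (P ^^ Suc n) f"
  have h[measurable]: "h \<in> borel_measurable borel" unfolding h_def by (rule measurable_P_pow[OF f(1)])
  define c where "c = \<rho> ^ n * smooth_const"
  have c: "0 \<le> c" using rho_pos smooth_const_nonneg by (simp add: c_def)
  define e where "e = L * \<delta>\<^sup>2 * real DIM('a) / 4"
  have e: "0 \<le> e" using L_pos by (simp add: e_def)
  have errp: "0 < err_p 1" using omega_pos delta_pos A_p_pos[of 1] rho_lt_1 by (simp add: err_p_def)
  \<comment> \<open>The tolerance is a quarter of the positive \<open>err_p 1\<close>, hence the
    factor 5/4.\<close>
  then obtain \<Gamma> where \<Gamma>: "\<Gamma> \<in> couplings (gibbs U) \<mu>" "cost 1 \<Gamma> \<le> ennreal (err_p 1 powr 1 + err_p 1 / 4)"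
    using ex_coupling_small_cost[OF inv, of 1 "err_p 1 / 4"] by auto
  have [measurable_cong]: "sets \<Gamma> = sets borel" using \<Gamma> by (simp add: couplings_def)
  have nbc: "nb (a - b) = nb (b - a)" for a b
  proof -
    have "nb (a - b) \<le> nb (b - a)" for a b
      using nb_diff[of 0 "b - a"] by (simp add: nb_def)
    then show ?thesis by (meson antisym)
  qed
  have "emeasure \<mu> A = (\<integral>\<^sup>+z. f z \<partial>\<mu>)" using A by (simp add: f_def sets_\<mu>)
  also have "\<dots> = (\<integral>\<^sup>+z. h z \<partial>\<mu>)" unfolding h_def by (rule nn_integral_invariant_pow[OF inv f(1), symmetric])
  also have "\<dots> = (\<integral>\<^sup>+z. h (snd z) \<partial>\<Gamma>)" using nn_integral_coupling(2)[OF \<Gamma>(1) h] by simp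
  also have "\<dots> \<le> (\<integral>\<^sup>+z. (h (fst z) + ennreal c * ennreal (nb (fst z - snd z) powr 1)) \<partial>\<Gamma>)"
  proof (intro nn_integral_mono)
    fix z
    show "h (snd z) \<le> h (fst z) + ennreal c * ennreal (nb (fst z - snd z) powr 1)"
      using P_pow_lipschitz[OF f, of n "snd z" "fst z", folded h_def c_def] c
      by (simp add: ennreal_mult nbc[of "snd z"])
  qed
  also have "\<dots> = (\<integral>\<^sup>+z. h (fst z) \<partial>\<Gamma>) + ennreal c * cost 1 \<Gamma>"
    unfolding cost_def by (simp add: nn_integral_add nn_integral_cmult)
  also have "\<dots> \<le> (\<integral>\<^sup>+z. h z \<partial>gibbs U) + ennreal c * ennreal (5 / 4 * err_p 1)"
    unfolding nn_integral_coupling(1)[OF \<Gamma>(1) h] using \<Gamma>(2) errp by (intro add_left_mono mult_left_mono) auto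
  also have "\<dots> \<le> ((\<integral>\<^sup>+z. f z \<partial>gibbs U) + ennreal (real (Suc n) * e)) + ennreal c * ennreal (5 / 4 * err_p 1)"
    unfolding h_def e_def by (intro add_right_mono nn_integral_gibbs_P_pow_le f)
  also have "(\<integral>\<^sup>+z. f z \<partial>gibbs U) = ennreal (measure (gibbs U) A)"
    using A by (simp add: f_def G.emeasure_eq_measure)
  also have "ennreal (measure (gibbs U) A) + ennreal (real (Suc n) * e) + ennreal c * ennreal (5 / 4 * err_p 1)
      = ennreal (measure (gibbs U) A + (real (Suc n) * e + c * (5 / 4 * err_p 1)))"
    using e c errp by (simp add: ennreal_mult[symmetric] ennreal_plus[symmetric] add.assoc del: ennreal_plus)
  finally show ?thesis
    unfolding \<mu>.emeasure_eq_measure c_def e_def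
    by (subst (asm) ennreal_le_iff) (use e c errp in \<open>auto simp: c_def e_def intro!: add_nonneg_nonneg\<close>)
qed

lemma tv_bound_aux:
  assumes inv: "invariant_prob (obabo_kernel \<delta> \<gamma> U) \<mu>"
  shows "tv_dist (gibbs U) \<mu> \<le> ennreal (2 * (real (Suc n) * (L * \<delta>\<^sup>2 * real DIM('a) / 4) + \<rho> ^ n * smooth_const * (5 / 4 * err_p 1)))"
proof (rule tv_dist_le)
  show "prob_space (gibbs U)" by (rule prob_space_gibbs)
  show "prob_space \<mu>" "sets \<mu> = sets borel" using inv by (auto simp: invariant_prob_def)
  show "measure \<mu> A \<le> measure (gibbs U) A + (real (Suc n) * (L * \<delta>\<^sup>2 * real DIM('a) / 4) + \<rho> ^ n * smooth_const * (5 / 4 * err_p 1))"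
    if "A \<in> sets borel" for A using inv that by (rule invariant_measure_le)
  show "0 \<le> real (Suc n) * (L * \<delta>\<^sup>2 * real DIM('a) / 4) + \<rho> ^ n * smooth_const * (5 / 4 * err_p 1)"
    using L_pos rho_pos smooth_const_nonneg err_p_nonneg[of 1] by (intro add_nonneg_nonneg) auto
qed simp

section \<open>Explicit constants and the choice of the number of steps\<close>

lemma K4_ge: "L \<le> K4 m L \<delta>"
proof -
  define a b c where "a = \<delta> / 4 + \<delta>\<^sup>2 * L / 4" and "b = \<delta> * L / sqrt m + \<delta>\<^sup>2 * L\<^sup>2 / (4 * m)" and "c = \<delta> * L\<^sup>2 / m"
  have pos: "0 \<le> a" "0 \<le> b" "0 \<le> c" using delta_pos L_pos m_pos by (auto simp: a_def b_def c_def)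
  have "L * 1 * 1 \<le> L * (1 + a) * (1 + b)" using pos L_pos by (intro mult_mono) auto
  then show ?thesis using pos by (simp add: K4_def a_def b_def c_def add.assoc)
qed

lemma K1_ge: "sqrt 3 \<le> K1 L"
proof -
  have "1 \<le> max \<omega> (1 / \<omega>)"
  proof (cases "\<omega> \<le> 1")
    case True
    then have "1 \<le> 1 / \<omega>" using omega_pos by simp
    then show ?thesis by (rule max.coboundedI2)
  qed simp
  then have "sqrt 3 * 1 \<le> sqrt 3 * max \<omega> (1 / \<omega>)" by (intro mult_left_mono) auto
  then show ?thesis by (simp add: K1_eq)
qed

text \<open>Extracts \<open>1 / (\<delta> * sqrt \<delta>)\<close> from the noise amplitude, the
  power that the choice of the number of steps must compensate.\<close>

lemma smooth_const_eq:
  "smooth_const = 8 / 5 * (sqrt (2 * pi) * K2 L \<gamma> \<delta>) / (\<delta> * sqrt \<delta>) * (sqrt 2 * max 1 \<omega>)"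
proof -
  have e: "K2 L \<gamma> \<delta> = sqrt (\<delta> / (2 * pi * \<sigma>\<^sup>2)) * max (2 + 3 * \<delta>\<^sup>2 * L / 2) (3 * \<delta>)"
    by (simp add: K2_def sigma_sq \<eta>_def)
  have "sqrt (\<delta> / (2 * pi * \<sigma>\<^sup>2)) = sqrt \<delta> / (sqrt (2 * pi) * \<sigma>)"
    using sigma_pos by (simp add: real_sqrt_divide real_sqrt_mult)
  then have "sqrt (2 * pi) * K2 L \<gamma> \<delta> / (\<delta> * sqrt \<delta>) = max (2 + 3 * \<delta>\<^sup>2 * L / 2) (3 * \<delta>) / (\<delta> * \<sigma>)"
    unfolding e using delta_pos sigma_pos by (simp del: max.bounded_iff)
  then show ?thesis
    unfolding smooth_const_def times_divide_eq_right[symmetric] by (simp only:)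
qed

end

context obabo
begin

lemma rho_pow_le: "\<rho> ^ n \<le> exp (- (\<delta> * \<kappa> / 2 * real n))"
proof -
  have "(exp (- (\<delta> * \<kappa> / 2)))\<^sup>2 = exp (- (\<delta> * \<kappa>))"
    by (simp add: power2_eq_square mult_exp_exp)
  then have "\<rho>\<^sup>2 \<le> (exp (- (\<delta> * \<kappa> / 2)))\<^sup>2"
    unfolding rho_sq using exp_ge_add_one_self[of "- (\<delta> * \<kappa>)"] by simp
  then have "\<rho> \<le> exp (- (\<delta> * \<kappa> / 2))" by (rule power2_le_imp_le) simp
  then have "\<rho> ^ n \<le> exp (- (\<delta> * \<kappa> / 2)) ^ n" using rho_pos by (intro power_mono) auto
  also have "\<dots> = exp (real n * - (\<delta> * \<kappa> / 2))" by (rule exp_of_nat_mult[symmetric])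
  finally show ?thesis by (simp add: mult.commute)
qed

text \<open>The logarithm of \<open>\<delta> ^ 3 * d\<close> in the statement comes from here: its
  square root supplies \<open>\<delta> * sqrt \<delta>\<close> against the regularisation constant,
  and the \<open>sqrt d\<close> which, with that of \<open>err_p 1\<close>, makes the factor
  \<open>d\<close>.\<close>

lemma tv_second_term:
  fixes l :: real
  defines "l \<equiv> \<bar>ln (\<delta> ^ 3 * real DIM('a))\<bar>"
  assumes n: "l + 3 \<le> \<delta> * \<kappa> * real (Suc n)"
  shows "2 * (\<rho> ^ n * smooth_const * (5 / 4 * err_p 1))
    \<le> \<delta> * real DIM('a) * (2 + l) * (2 * (K1 L)\<^sup>2 * K2 L \<gamma> \<delta> * K3 m L \<delta> / (\<kappa> * \<rho>))"
proof -
  define d where "d = real DIM('a)"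
  define x where "x = \<delta> ^ 3 * d"
  have d: "0 < d" by (simp add: d_def)
  have x: "0 < x" using d delta_pos by (simp add: x_def)
  have l: "l = \<bar>ln x\<bar>" by (simp add: l_def x_def d_def)
  have sx: "sqrt x = \<delta> * sqrt \<delta> * sqrt d"
    using delta_pos by (simp add: x_def power3_eq_cube real_sqrt_mult)
  \<comment> \<open>The additional 3 in the hypothesis gives \<open>exp (- (3 / 2))\<close>, at most
    8/29 by the quadratic Taylor bound. Working with \<open>Suc n\<close> here leaves the division
    by \<rho>, the square root in the claimed denominator.\<close>
  have decay: "\<rho> ^ Suc n \<le> 8 / 29 * sqrt x"
  proof -
    have "\<rho> ^ Suc n \<le> exp (- (\<delta> * \<kappa> / 2 * real (Suc n)))" by (rule rho_pow_le)
    also have "\<dots> \<le> exp (ln x / 2 + - (3 / 2))"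
    proof (simp only: exp_le_cancel_iff)
      have "- l \<le> ln x" unfolding l by linarith
      moreover have "\<delta> * \<kappa> / 2 * real (Suc n) = (\<delta> * \<kappa> * real (Suc n)) / 2" by simp
      ultimately show "- (\<delta> * \<kappa> / 2 * real (Suc n)) \<le> ln x / 2 + - (3 / 2)" using n by linarith
    qed
    also have "\<dots> = exp (- (3 / 2)) * sqrt x"
      using x by (simp only: exp_add ln_sqrt[symmetric]) simp
    also have "\<dots> \<le> 8 / 29 * sqrt x"
    proof (rule mult_right_mono)
      have "29 / 8 \<le> exp (3 / 2 :: real)"
        using exp_lower_Taylor_quadratic[of "3 / 2 :: real"] by (simp add: power2_eq_square)
      then show "exp (- (3 / 2)) \<le> (8 / 29 :: real)" by (simp add: exp_minus field_simps)
    qed (use x in simp)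
    finally show ?thesis .
  qed
  define B where "B = 1 + \<delta> * L / (2 * sqrt m)"
  define K2' where "K2' = K2 L \<gamma> \<delta>"
  define K3' where "K3' = K3 m L \<delta>"
  define K1' where "K1' = K1 L"
  have B: "0 \<le> B" using delta_pos L_pos m_pos by (simp add: B_def)
  have K1: "sqrt 3 \<le> K1'" "0 \<le> K1'" using K1_ge order_trans[OF _ K1_ge, of 0] by (auto simp: K1'_def)
  have K2: "0 \<le> K2'"
    using delta_pos one_minus_eta_sq_pos by (simp add: K2'_def K2_def \<eta>_def[symmetric] le_max_iff_disj)
  have K3: "L * B \<le> K3'" using K3_ge by (simp add: K3'_def B_def)
  have K3p: "0 \<le> K3'" using K3 B L_pos by (meson mult_nonneg_nonneg order_trans less_imp_le)
  \<comment> \<open>\<open>sqrt 2\<close> stems from the norm comparison,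
    \<open>sqrt (2 * pi)\<close> from \<open>K2\<close>; the product is below 4 since
    \<open>pi < 4\<close>.\<close>
  define c0 where "c0 = sqrt 2 * sqrt (2 * pi)"
  have c0: "c0 \<le> 4" "0 \<le> c0"
  proof -
    have "c0 = sqrt (2 * (2 * pi))" unfolding c0_def by (rule real_sqrt_mult[symmetric])
    also have "\<dots> \<le> sqrt 16" using pi_less_4 by (intro real_sqrt_le_mono) simp
    also have "sqrt 16 = 4" by (rule real_sqrt_unique) auto
    finally show "c0 \<le> 4" .
  qed (simp add: c0_def)
  define T where "T = K1' * K2' * K3' / (\<kappa> * \<rho>)"
  have T: "0 \<le> T" using K1 K2 K3p kappa_pos rho_pos by (simp add: T_def)
  have mo: "sqrt 3 * (max 1 \<omega> * \<omega> * B) \<le> K1' * K3'"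
  proof -
    have "sqrt 3 * (max 1 \<omega> * \<omega> * B) \<le> sqrt 3 * (max \<omega> (1 / \<omega>) * L * B)"
      using B by (intro mult_left_mono mult_right_mono max_omega) auto
    also have "\<dots> = K1' * (L * B)" by (simp add: K1'_def K1_eq)
    also have "\<dots> \<le> K1' * K3'" using K3 K1(2) by (rule mult_left_mono)
    finally show ?thesis .
  qed
  have sd: "0 < sqrt \<delta>" "sqrt d * sqrt d = d" "sqrt \<delta> * sqrt \<delta> = \<delta>" using delta_pos d by auto
  have e: "err_p 1 \<le> 12 / 5 * \<omega> * \<delta> * (sqrt d * B) / \<kappa>"
    using err_p_le[of 1] by (simp add: A_p_def dim_p_def B_def d_def)
  \<comment> \<open>The auxiliary \<open>sqrt 3\<close> completes
    \<open>max \<omega> (1 / \<omega>)\<close> to one factor \<open>K1\<close>; the other factor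
    \<open>K1\<close> is later obtained from its lower bound \<open>sqrt 3\<close>.\<close>
  have "sqrt 3 * (2 * (\<rho> ^ n * smooth_const * (5 / 4 * err_p 1)))
      \<le> sqrt 3 * (2 * (\<rho> ^ n * smooth_const * (5 / 4 * (12 / 5 * \<omega> * \<delta> * (sqrt d * B) / \<kappa>))))"
    using e rho_pos smooth_const_nonneg by (intro mult_left_mono) auto
  also have "\<dots> = 48 / 5 * c0 * (sqrt 3 * (max 1 \<omega> * \<omega> * B)) * (K2' * \<rho> ^ n * sqrt d / (sqrt \<delta> * \<kappa>))"
    unfolding smooth_const_eq K2'_def[symmetric] c0_def using delta_pos kappa_pos by (simp add: mult_ac)
  also have "\<dots> \<le> 48 / 5 * 4 * (K1' * K3') * (K2' * \<rho> ^ n * sqrt d / (sqrt \<delta> * \<kappa>))"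
    using c0 K1 K3p K2 B omega_pos rho_pos d delta_pos kappa_pos
    by (intro mult_right_mono[OF mult_mono[OF _ mo]]) auto
  also have "\<dots> = 48 / 5 * 4 * T * (\<rho> ^ Suc n * sqrt d / sqrt \<delta>)"
    using rho_pos kappa_pos sd(1) by (simp add: T_def field_simps)
  also have "\<dots> \<le> 48 / 5 * 4 * T * ((8 / 29 * sqrt x) * sqrt d / sqrt \<delta>)"
    using T decay d delta_pos by (intro mult_left_mono divide_right_mono mult_right_mono) auto
  also have "(8 / 29 * sqrt x) * sqrt d / sqrt \<delta> = 8 / 29 * (\<delta> * d)"
  proof -
    have "sqrt x * sqrt d / sqrt \<delta> = \<delta> * (sqrt d * sqrt d) * (sqrt \<delta> / sqrt \<delta>)"
      unfolding sx by simp
    also have "\<dots> = \<delta> * d" using sd by simp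
    finally have e: "sqrt x * sqrt d / sqrt \<delta> = \<delta> * d" .
    have "(8 / 29 * sqrt x) * sqrt d / sqrt \<delta> = 8 / 29 * (sqrt x * sqrt d / sqrt \<delta>)" by simp
    then show ?thesis unfolding e .
  qed
  \<comment> \<open>Numerically 1536/145, about 10.6. The 12 splits as
    \<open>sqrt 3 * 2 * 2 * sqrt 3\<close>, in which one 2 is bounded by
    \<open>2 + l\<close>.\<close>
  also have "48 / 5 * 4 * T * (8 / 29 * (\<delta> * d)) \<le> 12 * T * (\<delta> * d)"
    using T d delta_pos by (simp add: mult_right_mono)
  also have "\<dots> = sqrt 3 * (\<delta> * d * 2 * (2 * sqrt 3 * T))" by simp
  also have "\<dots> \<le> sqrt 3 * (\<delta> * d * (2 + l) * (2 * K1' * T))"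
    using T d delta_pos K1 by (intro mult_left_mono mult_mono mult_right_mono) (auto simp: l)
  finally have "sqrt 3 * (2 * (\<rho> ^ n * smooth_const * (5 / 4 * err_p 1))) \<le> sqrt 3 * (\<delta> * d * (2 + l) * (2 * K1' * T))" .
  then have "2 * (\<rho> ^ n * smooth_const * (5 / 4 * err_p 1)) \<le> \<delta> * d * (2 + l) * (2 * K1' * T)"
    by (simp only: mult_le_cancel_left_pos[of "sqrt 3"] real_sqrt_gt_zero zero_less_numeral)
  also have "2 * K1' * T = 2 * (K1 L)\<^sup>2 * K2 L \<gamma> \<delta> * K3 m L \<delta> / (\<kappa> * \<rho>)"
    by (simp add: T_def K1'_def K2'_def K3'_def power2_eq_square)
  finally show ?thesis by (simp only: d_def)
qed

theorem tv_bound: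
  assumes inv: "invariant_prob (obabo_kernel \<delta> \<gamma> U) \<mu>"
  shows "tv_dist (gibbs U) \<mu> \<le> ennreal (\<delta> * real DIM('a) * (2 + \<bar>ln (\<delta> ^ 3 * real DIM('a))\<bar>) *
    (2 * (K1 L)\<^sup>2 * K2 L \<gamma> \<delta> * K3 m L \<delta> / (\<kappa> * sqrt (1 - \<delta> * \<kappa>)) + K4 m L \<delta> / \<kappa>))"
proof -
  define l where "l = \<bar>ln (\<delta> ^ 3 * real DIM('a))\<bar>"
  have l: "0 \<le> l" by (simp add: l_def)
  have dk: "0 < \<delta> * \<kappa>" "\<delta> * \<kappa> \<le> 1 / 1000" using delta_pos kappa_pos delta_kappa_le by auto
  define r where "r = (l + 3) / (\<delta> * \<kappa>)"
  have r: "0 < r" using dk l by (simp add: r_def)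
  \<comment> \<open>\<open>Suc n\<close> is the ceiling of \<open>r\<close>: the least number of
    steps that meets the requirement of \<open>tv_second_term\<close>.\<close>
  define n where "n = nat \<lceil>r\<rceil> - 1"
  have "0 < nat \<lceil>r\<rceil>" using r by simp
  then have Sn: "Suc n = nat \<lceil>r\<rceil>" by (simp add: n_def)
  have n1: "r \<le> real (Suc n)" "real (Suc n) \<le> r + 1"
    unfolding Sn using r by (auto simp: of_nat_ceiling of_nat_nat)
  have N1: "l + 3 \<le> \<delta> * \<kappa> * real (Suc n)"
    using n1(1) dk unfolding r_def by (simp add: pos_divide_le_eq mult.commute)
  \<comment> \<open>The rounding costs at most \<open>\<delta> * \<kappa>\<close>, and the total
    \<open>l + 3 + \<delta> * \<kappa>\<close> fits into \<open>4 + 2 * l\<close>, which is what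
    produces the factor \<open>2 + l\<close>.\<close>
  have N2: "\<delta> * \<kappa> * real (Suc n) \<le> 2 * (2 + l)"
  proof -
    have "\<delta> * \<kappa> * real (Suc n) \<le> \<delta> * \<kappa> * (r + 1)" using n1(2) dk by (intro mult_left_mono) auto
    also have "\<dots> = l + 3 + \<delta> * \<kappa>"
    proof -
      have "\<delta> * \<kappa> * r = l + 3" 
      proof -
        have "q * (y / q) = y" if "q \<noteq> 0" for q y :: real using that by simp
        then show ?thesis unfolding r_def using dk(1) by (metis less_irrefl)
      qed
      then show ?thesis by (simp add: distrib_left)
    qed
    also have "\<dots> \<le> 2 * (2 + l)" using dk(2) l by (simp add: distrib_left)
    finally show ?thesis .
  qed
  have first: "2 * (real (Suc n) * (L * \<delta>\<^sup>2 * real DIM('a) / 4)) \<le> \<delta> * real DIM('a) * (2 + l) * (K4 m L \<delta> / \<kappa>)"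
  proof -
    have "2 * (real (Suc n) * (L * \<delta>\<^sup>2 * real DIM('a) / 4)) = (\<delta> * \<kappa> * real (Suc n)) * (\<delta> * real DIM('a) * (L / \<kappa>) / 2)"
      using kappa_pos by (simp add: power2_eq_square)
    also have "\<dots> \<le> (2 * (2 + l)) * (\<delta> * real DIM('a) * (L / \<kappa>) / 2)"
      using N2 delta_pos L_pos kappa_pos by (intro mult_right_mono) auto
    also have "\<dots> = \<delta> * real DIM('a) * (2 + l) * (L / \<kappa>)"
    proof -
      have e: "(2 * u) * (w / 2) = u * w" for u w :: real by simp
      show ?thesis unfolding e by (simp only: mult_ac)
    qed
    also have "\<dots> \<le> \<delta> * real DIM('a) * (2 + l) * (K4 m L \<delta> / \<kappa>)"
      using K4_ge kappa_pos delta_pos l by (intro mult_left_mono divide_right_mono) auto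
    finally show ?thesis .
  qed
  have "2 * (real (Suc n) * (L * \<delta>\<^sup>2 * real DIM('a) / 4) + \<rho> ^ n * smooth_const * (5 / 4 * err_p 1))
      \<le> \<delta> * real DIM('a) * (2 + l) * (K4 m L \<delta> / \<kappa>)
        + \<delta> * real DIM('a) * (2 + l) * (2 * (K1 L)\<^sup>2 * K2 L \<gamma> \<delta> * K3 m L \<delta> / (\<kappa> * \<rho>))"
    unfolding distrib_left[of 2] using first tv_second_term[OF N1[unfolded l_def]] unfolding l_def by (rule add_mono)
  also have "\<dots> = \<delta> * real DIM('a) * (2 + l) * (2 * (K1 L)\<^sup>2 * K2 L \<gamma> \<delta> * K3 m L \<delta> / (\<kappa> * sqrt (1 - \<delta> * \<kappa>)) + K4 m L \<delta> / \<kappa>)"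
    unfolding \<rho>_def by (simp only: distrib_left add.commute)
  finally show ?thesis
    unfolding l_def using order_trans[OF tv_bound_aux[OF inv, of n] ennreal_leI] by blast
qed

end

theorem proposition11:
  fixes U :: "real ^ 'n \<Rightarrow> real"
    and m L \<gamma> \<delta> :: real
    and \<pi>\<^sub>\<delta> :: "((real ^ 'n) \<times> (real ^ 'n)) measure"
  assumes "C2 U"
    and "0 < m" and "m \<le> L"
    and "\<And>x y. norm (grad U x - grad U y) \<le> L * norm (x - y)"
    and "\<And>x y. (x - y) \<bullet> (grad U x - grad U y) \<ge> m * (norm (x - y))\<^sup>2"
    and "\<gamma> \<ge> 2 * sqrt L"
    and "0 < \<delta>" and "\<delta> \<le> m / (33 * \<gamma> ^ 3)"
    and "invariant_prob (obabo_kernel \<delta> \<gamma> U) \<pi>\<^sub>\<delta>"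
  shows "(\<forall>p\<ge>1. wasserstein p (gibbs U) \<pi>\<^sub>\<delta> \<le>
            ennreal (\<delta> * sqrt (real CARD('n) + max (p - 2) 0) *
              (2 * K1 L * K3 m L \<delta> / kappa m \<gamma>))) \<and>
         tv_dist (gibbs U) \<pi>\<^sub>\<delta> \<le>
            ennreal (\<delta> * real CARD('n) * (2 + \<bar>ln (\<delta> ^ 3 * real CARD('n))\<bar>) *
              (2 * (K1 L)\<^sup>2 * K2 L \<gamma> \<delta> * K3 m L \<delta> / (kappa m \<gamma> * sqrt (1 - \<delta> * kappa m \<gamma>))
                + K4 m L \<delta> / kappa m \<gamma>)) \<and>
         ((\<lambda>s. K3 m L s) \<longlongrightarrow> L) (at_right 0) \<and>
         ((\<lambda>s. K4 m L s) \<longlongrightarrow> L) (at_right 0)"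
proof -
  interpret obabo U "grad U" m L \<gamma> \<delta>
    by unfold_locales (use assms C2_imp_GDERIV in auto)
  have \<kappa>: "\<kappa> = kappa m \<gamma>" by (simp add: \<kappa>_def)
  \<comment> \<open>Both constants are continuous in the step at 0, with value \<open>L\<close>
    there.\<close>
  have "((\<lambda>s. K3 m L s) \<longlongrightarrow> K3 m L 0) (at_right 0)"
    unfolding K3_def using m_pos by (intro tendsto_intros) auto
  moreover have "((\<lambda>s. K4 m L s) \<longlongrightarrow> K4 m L 0) (at_right 0)"
    unfolding K4_def using m_pos by (intro tendsto_intros) auto
  ultimately show ?thesis
    using wasserstein_bound[OF assms(9)] tv_bound[OF assms(9)] unfolding \<kappa>
    by (simp add: K3_def[of _ _ 0] K4_def[of _ _ 0])
qed

end
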